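(* Let $N\ge 2$ be an integer, let $J\in\mathbb{R}\setminus\{0\}$ and $f_0\in\mathbb{R}\setminus\{0\}$, and consider the Ising chain of length $N$ on $(\mathbb{C}^2)^{\otimes N}$ with Hamiltonian $H_f(t)=J[H_0+f(t)H_1]$, where $H_0=\sum_{n=1}^{N-1}Z_nZ_{n+1}$ and $H_1=\sum_{n=1}^{N}X_n$. Let $|\psi_0^{(f_0)}\rangle$ be the (non-degenerate) normalized ground state of $J[H_0+f_0H_1]$. Then, in the sense of asymptotic reachability defined in the context: (a) if $J<0$ and either $Jf_0<0$, or $Jf_0>0$ and $N$ is even, then $|\psi_d^{(1)}\rangle=\frac{1}{\sqrt2}(|0\cdots0\rangle+|1\cdots1\rangle)$ is asymptotically reachable from $|\psi_0^{(f_0)}\rangle$; (b) if $J<0$, $Jf_0>0$ and $N$ is odd, then $|\psi_d^{(2)}\rangle=\frac{1}{\sqrt2}(|0\cdots0\rangle-|1\cdots1\rangle)$ is asymptotically reachable from $|\psi_0^{(f_0)}\rangle$; (c) if $J>0$ and either $Jf_0<0$, or $Jf_0>0$ and $N$ is even, then $|\psi_d^{(3)}\rangle=\frac{1}{\sqrt2}(|0101\cdots\rangle+|1010\cdots\rangle)$ is asymptotically reachable from $|\psi_0^{(f_0)}\rangle$; (d) if $J>0$, $Jf_0>0$ and $N$ is odd, then $|\psi_d^{(4)}\rangle=\frac{1}{\sqrt2}(|0101\cdots\rangle-|1010\cdots\rangle)$ is asymptotically reachable from $|\psi_0^{(f_0)}\rangle$.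
   Context: $X=\begin{pmatrix}0&1\\1&0\end{pmatrix}$ and $Z=\begin{pmatrix}1&0\\0&-1\end{pmatrix}$ are Pauli matrices; $X_n$, $Z_n$ denote the operator acting as $X$, respectively $Z$, on the $n$-th tensor factor of $(\mathbb{C}^2)^{\otimes N}$ and as the identity on the other factors. $|0\rangle,|1\rangle$ are the eigenvectors of $Z$ with eigenvalues $+1,-1$; $|0101\cdots\rangle$ and $|1010\cdots\rangle$ denote the two alternating product basis vectors of length $N$ (beginning with $0$, respectively $1$). For $f_0\neq 0$ the lowest eigenvalue of $J[H_0+f_0H_1]$ is simple, so its ground state is unique up to a phase. The dynamics for a control $f$ is $\frac{d}{dt}|\psi(t)\rangle=-iJ[H_0+f(t)H_1]|\psi(t)\rangle$ (units $\hbar=1$). Asymptotic reachability: a unit vector $|\psi_d\rangle$ is asymptotically reachable from $|\psi_0^{(f_0)}\rangle$ if for every $\varepsilon>0$ there exist a finite time $t_f>0$ and a continuous real-valued control $f:[0,t_f]\to\mathbb{R}$ with $f(0)=f_0$ such that the solution with $|\psi(0)\rangle=|\psi_0^{(f_0)}\rangle$ satisfies $|\langle\psi_d|\psi(t_f)\rangle|^2>1-\varepsilon$. *)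

theory Defs
  imports Complex_Main "Jordan_Normal_Form.Char_Poly"
begin

text \<open>
  The space \<open>(\<complex>\<^sup>2)\<^sup>\<otimes>\<^sup>N\<close> is modelled as \<open>carrier_vec (2 ^ N)\<close> over the complex numbers, with Kronecker
  products as tensor products: the leftmost factor is the most significant part of an index.
\<close>

definition tensor_vec :: "complex vec \<Rightarrow> complex vec \<Rightarrow> complex vec" where
  "tensor_vec u v = vec (dim_vec u * dim_vec v)
     (\<lambda>i. u $ (i div dim_vec v) * v $ (i mod dim_vec v))"

definition tensor_mat :: "complex mat \<Rightarrow> complex mat \<Rightarrow> complex mat" where
  "tensor_mat A B = mat (dim_row A * dim_row B) (dim_col A * dim_col B)
     (\<lambda>(i, j). A $$ (i div dim_row B, j div dim_col B) * B $$ (i mod dim_row B, j mod dim_col B))"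

definition pauli_X :: "complex mat" where
  "pauli_X = mat_of_rows_list 2 [[0, 1], [1, 0]]"

definition pauli_Z :: "complex mat" where
  "pauli_Z = mat_of_rows_list 2 [[1, 0], [0, -1]]"

text \<open>Sites are numbered \<open>1, \<dots>, N\<close>.\<close>

definition site_op :: "nat \<Rightarrow> complex mat \<Rightarrow> nat \<Rightarrow> complex mat" where
  "site_op N A n = tensor_mat (tensor_mat (1\<^sub>m (2 ^ (n - 1))) A) (1\<^sub>m (2 ^ (N - n)))"

text \<open>Matrices of unrestricted dimension form no additive monoid, hence entrywise sums.\<close>

definition ising_H0 :: "nat \<Rightarrow> complex mat" where
  "ising_H0 N = mat (2 ^ N) (2 ^ N)
     (\<lambda>ij. \<Sum>n = 1..N - 1. (site_op N pauli_Z n * site_op N pauli_Z (n + 1)) $$ ij)"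

definition ising_H1 :: "nat \<Rightarrow> complex mat" where
  "ising_H1 N = mat (2 ^ N) (2 ^ N) (\<lambda>ij. \<Sum>n = 1..N. site_op N pauli_X n $$ ij)"

definition ising_H :: "nat \<Rightarrow> real \<Rightarrow> real \<Rightarrow> complex mat" where
  "ising_H N J f = complex_of_real J \<cdot>\<^sub>m (ising_H0 N + complex_of_real f \<cdot>\<^sub>m ising_H1 N)"

text \<open>\<open>ket [b\<^sub>1, \<dots>, b\<^sub>N]\<close> is the product vector \<open>|b\<^sub>1 \<dots> b\<^sub>N\<rangle>\<close>, for a list of entries 0 or 1.\<close>

primrec ket :: "nat list \<Rightarrow> complex vec" where
  "ket [] = vec 1 (\<lambda>_. 1)"
| "ket (b # bs) = tensor_vec (unit_vec 2 b) (ket bs)"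

definition ket_zeros :: "nat \<Rightarrow> complex vec" where
  "ket_zeros N = ket (replicate N 0)"

definition ket_ones :: "nat \<Rightarrow> complex vec" where
  "ket_ones N = ket (replicate N 1)"

definition ket_alt0 :: "nat \<Rightarrow> complex vec" where
  "ket_alt0 N = ket (map (\<lambda>n. n mod 2) [0..<N])"

definition ket_alt1 :: "nat \<Rightarrow> complex vec" where
  "ket_alt1 N = ket (map (\<lambda>n. (n + 1) mod 2) [0..<N])"

text \<open>
  Meant for Hermitian matrices: all their eigenvalues are real, so it is enough to compare
  with real ones.
\<close>

definition ground_state :: "complex mat \<Rightarrow> complex vec \<Rightarrow> bool" where
  "ground_state A v \<longleftrightarrow> v \<bullet>c v = 1 \<and>
     (\<exists>E :: real. eigenvector A v (complex_of_real E) \<and>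
        (\<forall>E' :: real. eigenvalue A (complex_of_real E') \<longrightarrow> E \<le> E'))"

text \<open>The Schroedinger equation on \<open>[0, t\<^sub>f]\<close>, componentwise, with one-sided derivatives at the ends.\<close>

definition schroedinger_solution ::
  "nat \<Rightarrow> real \<Rightarrow> (real \<Rightarrow> real) \<Rightarrow> real \<Rightarrow> complex vec \<Rightarrow> (real \<Rightarrow> complex vec) \<Rightarrow> bool" where
  "schroedinger_solution N J f t\<^sub>f \<psi>\<^sub>0 \<psi> \<longleftrightarrow>
     (\<forall>t \<in> {0..t\<^sub>f}. \<psi> t \<in> carrier_vec (2 ^ N)) \<and> \<psi> 0 = \<psi>\<^sub>0 \<and>
     (\<forall>t \<in> {0..t\<^sub>f}. \<forall>k < 2 ^ N.
        ((\<lambda>s. \<psi> s $ k) has_vector_derivative (- \<i> \<cdot>\<^sub>v (ising_H N J (f t) *\<^sub>v \<psi> t)) $ k)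
          (at t within {0..t\<^sub>f}))"

text \<open>
  Solutions are unique on \<open>[0, t\<^sub>f]\<close> (a linear equation with continuous coefficients), so
  the existential quantifier over \<open>\<psi>\<close> picks out the solution.
  Note that \<open>\<psi> \<bullet>c \<phi>\<close> is conjugate-linear in \<open>\<phi>\<close>, i.e. \<open>\<langle>\<phi>|\<psi>\<rangle>\<close> in physics notation.
\<close>

definition asymptotically_reachable ::
  "nat \<Rightarrow> real \<Rightarrow> real \<Rightarrow> complex vec \<Rightarrow> complex vec \<Rightarrow> bool" where
  "asymptotically_reachable N J f\<^sub>0 \<psi>\<^sub>0 \<psi>\<^sub>d \<longleftrightarrow>
     (\<forall>\<epsilon> > 0. \<exists>t\<^sub>f > 0. \<exists>f. continuous_on {0..t\<^sub>f} f \<and> f 0 = f\<^sub>0 \<and>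
        (\<exists>\<psi>. schroedinger_solution N J f t\<^sub>f \<psi>\<^sub>0 \<psi> \<and> (cmod (\<psi> t\<^sub>f \<bullet>c \<psi>\<^sub>d))\<^sup>2 > 1 - \<epsilon>))"

end

(*
The two product states minimizing the classical energy J H_0 are exchanged by the global flip
P = X_1 ... X_N, so H_0 is degenerate, but only once in each parity sector.  Ramping f linearly from
f_0 to 0 in a long time T, the state stays in the sector of the initial ground state and follows its
lowest level adiabatically.  After conjugation with Z_1 ... Z_N if J f_0 > 0, all off-diagonal entries
of the Hamiltonian are nonpositive, so by Perron-Frobenius its ground state is simple and even; adding
the penalty 1 - P, which is invisible to even states, keeps it simple also at f = 0.  Simplicity at
every point of the ramp gives a uniform gap g.

The adiabatic theorem is proved through the excess energy delta = <psi|H - E|psi>, along n steps of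
relative length h = 1/n: one step maps delta to at most (1 + k h) delta + O(h^2) + O(1/T) with k
depending only on the gap, hence delta = O(1/n) at the end if T = n^2.
*)

theory Submission
  imports Defs
begin

section \<open>Symmetric matrices\<close>

text \<open>In the Z basis the Hamiltonians are real symmetric and the gauge is a diagonal of signs,
  so a state enters as a pair (x, y) of real vectors and all spectral facts concern real quadratic
  forms. No spectral theorem is used: lowest levels are infima of the form and gaps are coercivity
  constants, both resting on Cauchy-Schwarz for positive semidefinite forms. The penalty gives a gap
  on the whole space instead of one sector, so the flow that is analysed is the penalized one; only
  in the end is it recognized as a solution of the true equation, because an even initial state
  stays even. Evenness refers to the gauged frame. The gauge commutes with the flip up to a factor 1
  or \<open>(- 1) ^ N\<close>, which becomes the relative sign in the target, while the sign of J
  selects the pair of product states: hence the four cases. Eigenvectors along the ramp are picked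
  independently at each parameter, so nothing may rely on their continuity; excess energy involves
  only the levels.\<close>

text \<open>A vector of length \<open>n\<close> is a function on \<open>nat\<close> of which only the values below \<open>n\<close> matter; similarly for matrices.\<close>

definition ip :: "nat \<Rightarrow> (nat \<Rightarrow> real) \<Rightarrow> (nat \<Rightarrow> real) \<Rightarrow> real" where
  "ip n u v = (\<Sum>i<n. u i * v i)"

definition ap :: "nat \<Rightarrow> (nat \<Rightarrow> nat \<Rightarrow> real) \<Rightarrow> (nat \<Rightarrow> real) \<Rightarrow> nat \<Rightarrow> real" where
  "ap n M u = (\<lambda>i. \<Sum>j<n. M i j * u j)"

definition symm :: "nat \<Rightarrow> (nat \<Rightarrow> nat \<Rightarrow> real) \<Rightarrow> bool" where
  "symm n M \<longleftrightarrow> (\<forall>i<n. \<forall>j<n. M i j = M j i)"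

definition nrm :: "nat \<Rightarrow> (nat \<Rightarrow> real) \<Rightarrow> real" where
  "nrm n u = sqrt (ip n u u)"

text \<open>A crude upper bound of the operator norm; what matters is that it depends neither on
  time nor on the state.\<close>

definition abs_entry_sum :: "nat \<Rightarrow> (nat \<Rightarrow> nat \<Rightarrow> real) \<Rightarrow> real" where
  "abs_entry_sum n M = (\<Sum>i<n. \<Sum>j<n. \<bar>M i j\<bar>)"

lemma ip_commute: "ip n u v = ip n v u"
  by (simp add: ip_def mult.commute)

lemma ip_cong: "(\<And>i. i < n \<Longrightarrow> u i = u' i) \<Longrightarrow> (\<And>i. i < n \<Longrightarrow> v i = v' i) \<Longrightarrow> ip n u v = ip n u' v'"
  by (simp add: ip_def)

lemma ap_cong: "(\<And>i. i < n \<Longrightarrow> u i = u' i) \<Longrightarrow> ap n M u = ap n M u'"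
  by (simp add: ap_def)

lemma ip_add_left: "ip n (\<lambda>i. u i + v i) w = ip n u w + ip n v w"
  and ip_add_right: "ip n w (\<lambda>i. u i + v i) = ip n w u + ip n w v"
  and ip_diff_left: "ip n (\<lambda>i. u i - v i) w = ip n u w - ip n v w"
  and ip_diff_right: "ip n w (\<lambda>i. u i - v i) = ip n w u - ip n w v"
  and ip_scale_left: "ip n (\<lambda>i. c * u i) w = c * ip n u w"
  and ip_scale_right: "ip n w (\<lambda>i. c * u i) = c * ip n w u"
  by (simp_all add: ip_def algebra_simps sum.distrib sum_subtractf sum_distrib_left)

lemma ap_add: "ap n M (\<lambda>i. u i + v i) = (\<lambda>i. ap n M u i + ap n M v i)"
  and ap_diff: "ap n M (\<lambda>i. u i - v i) = (\<lambda>i. ap n M u i - ap n M v i)"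
  and ap_scale: "ap n M (\<lambda>i. c * u i) = (\<lambda>i. c * ap n M u i)"
  and ap_mat_add: "ap n (\<lambda>i j. M i j + s * M' i j) u = (\<lambda>i. ap n M u i + s * ap n M' u i)"
  by (simp_all add: ap_def algebra_simps sum.distrib sum_subtractf sum_distrib_left)

lemmas lin_simps = ip_add_left ip_add_right ip_diff_left ip_diff_right ip_scale_left ip_scale_right
  ap_add ap_diff ap_scale ap_mat_add

lemma ap_shift: "i < n \<Longrightarrow> ap n (\<lambda>i j. M i j - E * of_bool (i = j)) u i = ap n M u i - E * u i"
  by (simp add: ap_def algebra_simps sum_subtractf if_distrib[where f = "\<lambda>x. _ * x"] of_bool_def sum.delta cong: if_cong)

lemma ip_ap_shift: "ip n v (ap n (\<lambda>i j. M i j - E * of_bool (i = j)) u) = ip n v (ap n M u) - E * ip n v u"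
proof -
  have "ip n v (ap n (\<lambda>i j. M i j - E * of_bool (i = j)) u) = ip n v (\<lambda>i. ap n M u i - E * u i)"
    by (rule ip_cong) (simp_all add: ap_shift)
  then show ?thesis by (simp add: lin_simps)
qed

lemma ap_rank_one: "ap n (\<lambda>i j. M i j + \<phi> i * \<phi> j) u i = ap n M u i + \<phi> i * ip n \<phi> u"
  by (simp add: ap_def ip_def algebra_simps sum.distrib sum_distrib_left)

lemma ip_ap_rank_one: "ip n v (ap n (\<lambda>i j. M i j + \<phi> i * \<phi> j) u) = ip n v (ap n M u) + ip n \<phi> v * ip n \<phi> u"
proof -
  have "ip n v (ap n (\<lambda>i j. M i j + \<phi> i * \<phi> j) u) = ip n v (\<lambda>i. ap n M u i + ip n \<phi> u * \<phi> i)"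
    by (rule ip_cong) (simp_all add: ap_rank_one)
  then show ?thesis by (simp add: lin_simps ip_commute)
qed

lemma ip_ap_symm:
  assumes "symm n M"
  shows "ip n u (ap n M v) = ip n (ap n M u) v"
proof -
  have "ip n u (ap n M v) = (\<Sum>i<n. \<Sum>j<n. u i * M i j * v j)"
    by (simp add: ip_def ap_def sum_distrib_left mult.assoc)
  also have "\<dots> = (\<Sum>j<n. \<Sum>i<n. u i * M i j * v j)"
    by (rule sum.swap)
  also have "\<dots> = (\<Sum>j<n. \<Sum>i<n. M j i * u i * v j)"
    using assms by (intro sum.cong refl) (simp add: symm_def)
  also have "\<dots> = ip n (ap n M u) v"
    by (simp add: ip_def ap_def sum_distrib_right)
  finally show ?thesis .
qed

lemma ip_nonneg: "0 \<le> ip n u u"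
  by (simp add: ip_def sum_nonneg)

lemma ip_eq_0: "ip n u u = 0 \<longleftrightarrow> (\<forall>i<n. u i = 0)"
  by (auto simp: ip_def sum_nonneg_eq_0_iff)

lemma nrm_nonneg [simp]: "0 \<le> nrm n u"
  by (simp add: nrm_def ip_nonneg)

lemma nrm_sq: "(nrm n u)\<^sup>2 = ip n u u"
  by (simp add: nrm_def ip_nonneg)

lemma ip_self: "ip n u u = nrm n u * nrm n u"
  by (simp add: nrm_sq flip: power2_eq_square)

text \<open>Discriminant argument for a form that may be degenerate. The degenerate case is what
  later forces a vector on which the form vanishes into the kernel.\<close>

lemma psd_Cauchy_Schwarz:
  assumes sym: "symm n M" and psd: "\<And>u. 0 \<le> ip n u (ap n M u)"
  shows "(ip n u (ap n M v))\<^sup>2 \<le> ip n u (ap n M u) * ip n v (ap n M v)"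
proof -
  define p q b where "p = ip n u (ap n M u)" and "q = ip n v (ap n M v)" and "b = ip n u (ap n M v)"
  have pq: "p \<ge> 0" "q \<ge> 0" by (simp_all add: p_def q_def psd)
  have vu: "ip n v (ap n M u) = b"
    unfolding b_def by (subst ip_ap_symm[OF sym]) (rule ip_commute)
  have quad: "0 \<le> s\<^sup>2 * p + 2 * s * t * b + t\<^sup>2 * q" for s t
  proof -
    have "0 \<le> ip n (\<lambda>i. s * u i + t * v i) (ap n M (\<lambda>i. s * u i + t * v i))" by (rule psd)
    also have "\<dots> = s\<^sup>2 * p + 2 * s * t * b + t\<^sup>2 * q"
      by (simp add: lin_simps vu flip: p_def q_def b_def) (simp add: algebra_simps power2_eq_square)
    finally show ?thesis .
  qed
  have "b\<^sup>2 \<le> p * q"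
  proof (cases "q = 0")
    case False
    then have "q > 0" using pq by simp
    have "0 \<le> q * (p * q - b\<^sup>2)"
      using quad[of q "- b"] by (simp add: algebra_simps power2_eq_square)
    then show ?thesis using \<open>q > 0\<close> by (simp add: zero_le_mult_iff)
  next
    case True
    \<comment> \<open>With q = 0, the weights s = b and t = -(p + 1) turn \<open>quad\<close> into 0
      <= -(p + 2) b^2.\<close>
    have "b * (p + 1) * b * 2 \<le> p * b * b"
      using quad[of b "- (p + 1)"] True quad[of "- b" "p+1"] by (simp add: algebra_simps power2_eq_square)
    then have "(p + 2) * b\<^sup>2 \<le> 0" by (simp add: algebra_simps power2_eq_square)
    then have "b\<^sup>2 \<le> 0" using pq by (simp add: mult_le_0_iff)
    then show ?thesis using True by simp
  qed
  then show ?thesis by (simp add: p_def q_def b_def)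
qed

lemma ip_Cauchy_Schwarz: "\<bar>ip n u v\<bar> \<le> nrm n u * nrm n v"
proof -
  let ?I = "\<lambda>i j. of_bool (i = j) :: real"
  have ap: "i < n \<Longrightarrow> ap n ?I u i = u i" for u i
    by (simp add: ap_def of_bool_def if_distrib[where f = "\<lambda>x. x * _"] sum.delta cong: if_cong)
  have ipI: "ip n u (ap n ?I v) = ip n u v" for u v
    by (rule ip_cong) (simp_all add: ap)
  have "(ip n u v)\<^sup>2 \<le> ip n u u * ip n v v"
  proof -
    have "symm n ?I" by (auto simp: symm_def)
    moreover have "0 \<le> ip n u (ap n ?I u)" for u by (simp only: ipI ip_nonneg)
    ultimately show ?thesis
      using psd_Cauchy_Schwarz[of n ?I u v] by (simp only: ipI)
  qed
  then have "(ip n u v)\<^sup>2 \<le> (nrm n u * nrm n v)\<^sup>2"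
    by (simp add: power_mult_distrib nrm_sq)
  then have "\<bar>ip n u v\<bar> \<le> \<bar>nrm n u * nrm n v\<bar>" by (simp only: abs_le_square_iff)
  then show ?thesis by (simp add: abs_mult)
qed

lemma abs_entry_sum_nonneg: "0 \<le> abs_entry_sum n M"
  by (simp add: abs_entry_sum_def sum_nonneg)

lemma abs_le_nrm: "i < n \<Longrightarrow> \<bar>u i\<bar> \<le> nrm n u"
proof -
  assume "i < n"
  then have "u i * u i \<le> ip n u u"
    unfolding ip_def by (intro member_le_sum) auto
  then show ?thesis unfolding nrm_def by (intro real_le_rsqrt) (simp add: power2_eq_square)
qed

lemma abs_ip_ap_le: "\<bar>ip n u (ap n M v)\<bar> \<le> abs_entry_sum n M * (nrm n u * nrm n v)"
proof -
  have "\<bar>ip n u (ap n M v)\<bar> = \<bar>\<Sum>i<n. \<Sum>j<n. M i j * (u i * v j)\<bar>"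
    by (simp add: ip_def ap_def sum_distrib_left mult_ac)
  also have "\<dots> \<le> (\<Sum>i<n. \<bar>\<Sum>j<n. M i j * (u i * v j)\<bar>)" by (rule sum_abs)
  also have "\<dots> \<le> (\<Sum>i<n. \<Sum>j<n. \<bar>M i j * (u i * v j)\<bar>)" by (intro sum_mono sum_abs)
  also have "\<dots> \<le> (\<Sum>i<n. \<Sum>j<n. \<bar>M i j\<bar> * (nrm n u * nrm n v))"
  proof (intro sum_mono)
    fix i j assume "i \<in> {..<n}" "j \<in> {..<n}"
    then have "\<bar>u i\<bar> * \<bar>v j\<bar> \<le> nrm n u * nrm n v"
      by (intro mult_mono) (simp_all add: abs_le_nrm)
    then show "\<bar>M i j * (u i * v j)\<bar> \<le> \<bar>M i j\<bar> * (nrm n u * nrm n v)"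
      unfolding abs_mult by (rule mult_left_mono) simp
  qed
  also have "\<dots> = abs_entry_sum n M * (nrm n u * nrm n v)"
    by (simp add: abs_entry_sum_def sum_distrib_right)
  finally show ?thesis .
qed

lemma nrm_ap_le: "nrm n (ap n M v) \<le> abs_entry_sum n M * nrm n v"
proof (cases "nrm n (ap n M v) = 0")
  case False
  then have pos: "nrm n (ap n M v) > 0" using nrm_nonneg[of n "ap n M v"] by linarith
  have "nrm n (ap n M v) * nrm n (ap n M v) = ip n (ap n M v) (ap n M v)"
    by (rule ip_self[symmetric])
  also have "\<dots> \<le> nrm n (ap n M v) * (abs_entry_sum n M * nrm n v)"
    using abs_ip_ap_le[of n "ap n M v" M v] by (simp add: algebra_simps)
  finally show ?thesis using pos by simp
qed (simp add: abs_entry_sum_nonneg)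

text \<open>An injective square system has nonzero determinant, hence an inverse. It is delivered as
  one matrix for all right-hand sides, so that \<open>abs_entry_sum n N\<close> bounds it
  uniformly.\<close>

lemma linear_system_solvable:
  assumes ker: "\<forall>u. (\<forall>i<n. ap n M u i = 0) \<longrightarrow> (\<forall>i<n. u i = 0)"
  shows "\<exists>N. \<forall>r. \<forall>i<n. ap n M (ap n N r) i = r i"
proof -
  define A where "A = mat n n (\<lambda>(i, j). M i j)"
  have A: "A \<in> carrier_mat n n" by (simp add: A_def)
  have "det A \<noteq> 0"
  proof
    assume "det A = 0"
    then obtain v where v: "v \<in> carrier_vec n" "v \<noteq> 0\<^sub>v n" "A *\<^sub>v v = 0\<^sub>v n"
      using det_0_iff_vec_prod_zero_field[OF A] by blast
    have "ap n M (\<lambda>i. v $ i) i = 0" if "i < n" for i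
    proof -
      have "ap n M (\<lambda>i. v $ i) i = (A *\<^sub>v v) $ i"
        using that v(1) by (auto simp: A_def ap_def scalar_prod_def atLeast0LessThan)
      then show ?thesis using v(3) that by simp
    qed
    then have "v $ i = 0" if "i < n" for i using ker that by blast
    then show False using v by (metis carrier_vecD eq_vecI index_zero_vec)
  qed
  then obtain B where B: "B \<in> carrier_mat n n" "A * B = 1\<^sub>m n"
    using det_non_zero_imp_unit[OF A, of "()"] by (auto simp: Units_def ring_mat_def)
  define N where "N = (\<lambda>i j. B $$ (i, j))"
  have "ap n M (ap n N r) i = r i" if i: "i < n" for r i
  proof -
    have MN: "(\<Sum>k<n. M i k * N k j) = of_bool (i = j)" if "j < n" for j
    proof -
      have "(A * B) $$ (i, j) = (\<Sum>k<n. M i k * N k j)"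
        using i that B(1) by (auto simp: A_def N_def scalar_prod_def atLeast0LessThan)
      then show ?thesis unfolding B(2) using i that by (simp add: of_bool_def split: if_splits)
    qed
    have "ap n M (ap n N r) i = (\<Sum>k<n. \<Sum>j<n. M i k * N k j * r j)"
      by (simp add: ap_def sum_distrib_left mult.assoc)
    also have "\<dots> = (\<Sum>j<n. \<Sum>k<n. M i k * N k j * r j)" by (rule sum.swap)
    also have "\<dots> = (\<Sum>j<n. of_bool (i = j) * r j)"
      by (intro sum.cong refl) (simp add: MN flip: sum_distrib_right)
    also have "\<dots> = r i"
      using i by (simp add: of_bool_def if_distrib[where f = "\<lambda>x. x * _"] sum.delta cong: if_cong)
    finally show ?thesis .
  qed
  then show ?thesis by blast
qed

text \<open>With v = M^-1 u, Cauchy-Schwarz for the form of \<open>M\<close> gives |u|^4 <= (u, M u)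
  (u, M^-1 u), and the last factor is at most |u|^2 times a bound of the inverse. So
  \<open>c\<close> is the reciprocal of that bound, with 1 added to avoid division by 0.\<close>

lemma psd_trivial_kernel_imp_coercive:
  assumes sym: "symm n M" and psd: "\<And>u. 0 \<le> ip n u (ap n M u)"
    and ker: "\<forall>u. (\<forall>i<n. ap n M u i = 0) \<longrightarrow> (\<forall>i<n. u i = 0)"
  shows "\<exists>c>0. \<forall>u. c * ip n u u \<le> ip n u (ap n M u)"
proof -
  obtain N where N: "\<And>r i. i < n \<Longrightarrow> ap n M (ap n N r) i = r i"
    using linear_system_solvable[OF ker] by blast
  define c where "c = 1 / (abs_entry_sum n N + 1)"
  have "c > 0" using abs_entry_sum_nonneg[of n N] by (simp add: c_def)
  moreover have "c * ip n u u \<le> ip n u (ap n M u)" for u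
  proof (cases "ip n u u = 0")
    case True
    then show ?thesis using psd[of u] by simp
  next
    case False
    then have pos: "ip n u u > 0" using ip_nonneg[of n u] by linarith
    define v where "v = ap n N u"
    have Mv: "ip n w (ap n M v) = ip n w u" for w
      by (rule ip_cong) (simp_all add: v_def N)
    have "ip n v u \<le> abs_entry_sum n N * ip n u u"
      using abs_ip_ap_le[of n u N u] by (simp add: v_def ip_commute[of n _ u] ip_self)
    also have "\<dots> \<le> (abs_entry_sum n N + 1) * ip n u u" using pos by (simp add: mult_right_mono)
    finally have vu: "ip n v u \<le> (abs_entry_sum n N + 1) * ip n u u" .
    have "(ip n u u)\<^sup>2 \<le> ip n u (ap n M u) * ip n v u"
      using psd_Cauchy_Schwarz[OF sym psd, of u v] by (simp add: Mv)
    also have "\<dots> \<le> ip n u (ap n M u) * ((abs_entry_sum n N + 1) * ip n u u)"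
      by (rule mult_left_mono[OF vu psd])
    finally have "ip n u u \<le> ip n u (ap n M u) * (abs_entry_sum n N + 1)"
      using pos by (simp add: power2_eq_square)
    then show ?thesis using abs_entry_sum_nonneg[of n N] by (simp add: c_def field_simps)
  qed
  ultimately show ?thesis by blast
qed

section \<open>The lowest eigenvalue as infimum of the quadratic form\<close>

lemma symm_shift: "symm n M \<Longrightarrow> symm n (\<lambda>i j. M i j - E * of_bool (i = j))"
  by (auto simp: symm_def)

lemma symm_rank_one: "symm n M \<Longrightarrow> symm n (\<lambda>i j. M i j + \<phi> i * \<phi> j)"
  by (auto simp: symm_def)

lemma exists_normalized:
  assumes "ip n u u \<noteq> 0"
  shows "\<exists>c. c \<noteq> 0 \<and> ip n (\<lambda>i. c * u i) (\<lambda>i. c * u i) = 1"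
proof -
  have "ip n u u > 0" using assms ip_nonneg[of n u] by linarith
  then have "ip n (\<lambda>i. (1 / nrm n u) * u i) (\<lambda>i. (1 / nrm n u) * u i) = 1 \<and> 1 / nrm n u \<noteq> 0"
    unfolding ip_scale_left ip_scale_right by (simp add: nrm_def)
  then show ?thesis by blast
qed

text \<open>E is the infimum of the form over unit vectors. It is attained: otherwise the
  nonnegative form of M - E would have trivial kernel, hence be coercive, and E + c would still be a
  lower bound.\<close>

lemma exists_lowest_eigenpair:
  assumes sym: "symm n M" and n: "n > 0"
  shows "\<exists>E \<phi>. ip n \<phi> \<phi> = 1 \<and> (\<forall>i<n. ap n M \<phi> i = E * \<phi> i) \<and> (\<forall>u. E * ip n u u \<le> ip n u (ap n M u))"
proof -
  define S where "S = {ip n u (ap n M u) | u. ip n u u = 1}"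
  define E where "E = Inf S"
  have "ip n (\<lambda>i. of_bool (i = 0)) (\<lambda>i. of_bool (i = 0)) = 1"
    using n by (simp add: ip_def of_bool_def sum.delta if_distrib[where f = "\<lambda>x. x * _"] cong: if_cong)
  then have ne: "S \<noteq> {}" unfolding S_def by blast
  have bb: "bdd_below S"
  proof (rule bdd_belowI)
    fix x assume "x \<in> S"
    then obtain u where "ip n u u = 1" "x = ip n u (ap n M u)" by (auto simp: S_def)
    then show "- abs_entry_sum n M \<le> x"
      using abs_ip_ap_le[of n u M u] by (simp add: nrm_def)
  qed
  have low: "E * ip n u u \<le> ip n u (ap n M u)" for u
  proof (cases "ip n u u = 0")
    case True
    then have "ip n u (ap n M u) = ip n (\<lambda>i. 0) (ap n M u)"
      by (intro ip_cong) (simp_all add: ip_eq_0)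
    then show ?thesis using True by (simp add: ip_def)
  next
    case False
    then obtain c where c: "c \<noteq> 0" "ip n (\<lambda>i. c * u i) (\<lambda>i. c * u i) = 1"
      using exists_normalized by blast
    then have "ip n (\<lambda>i. c * u i) (ap n M (\<lambda>i. c * u i)) \<in> S" unfolding S_def by blast
    then have "E \<le> ip n (\<lambda>i. c * u i) (ap n M (\<lambda>i. c * u i))"
      unfolding E_def by (rule cInf_lower[OF _ bb])
    then have "E * (c\<^sup>2 * ip n u u) \<le> c\<^sup>2 * ip n u (ap n M u)"
      using c(2) by (simp add: lin_simps power2_eq_square mult.assoc)
    then have "c\<^sup>2 * (E * ip n u u) \<le> c\<^sup>2 * ip n u (ap n M u)" by (simp add: algebra_simps)
    then show ?thesis using c(1) by simp
  qed
  define L where "L = (\<lambda>i j. M i j - E * of_bool (i = j))"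
  have psd: "0 \<le> ip n u (ap n L u)" for u
    using low[of u] by (simp add: L_def ip_ap_shift)
  have "\<exists>u. (\<forall>i<n. ap n L u i = 0) \<and> (\<exists>i<n. u i \<noteq> 0)"
  proof (rule ccontr)
    assume "\<not> ?thesis"
    then have "\<forall>u. (\<forall>i<n. ap n L u i = 0) \<longrightarrow> (\<forall>i<n. u i = 0)" by blast
    from psd_trivial_kernel_imp_coercive[OF _ psd this] symm_shift[OF sym]
    obtain c where c: "c > 0" "\<And>u. c * ip n u u \<le> ip n u (ap n L u)"
      unfolding L_def by blast
    have "E + c \<le> x" if "x \<in> S" for x
    proof -
      from that obtain u where "ip n u u = 1" "x = ip n u (ap n M u)" by (auto simp: S_def)
      then show ?thesis using c(2)[of u] by (simp add: L_def ip_ap_shift)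
    qed
    then have "E + c \<le> E" unfolding E_def using ne by (intro cInf_greatest) auto
    then show False using c(1) by simp
  qed
  then obtain u where u: "\<And>i. i < n \<Longrightarrow> ap n L u i = 0" "\<exists>i<n. u i \<noteq> 0" by blast
  then have "ip n u u \<noteq> 0" by (auto simp: ip_eq_0)
  then obtain c where c: "c \<noteq> 0" "ip n (\<lambda>i. c * u i) (\<lambda>i. c * u i) = 1"
    using exists_normalized by blast
  have "ap n M (\<lambda>i. c * u i) i = E * (c * u i)" if "i < n" for i
    using u(1)[OF that] by (simp add: lin_simps L_def ap_shift that)
  with c(2) low have "ip n (\<lambda>i. c * u i) (\<lambda>i. c * u i) = 1 \<and> (\<forall>i<n. ap n M (\<lambda>i. c * u i) i = E * (c * u i)) \<and>
      (\<forall>u. E * ip n u u \<le> ip n u (ap n M u))" by simp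
  then show ?thesis by (intro exI)
qed

section \<open>Gapped ground states\<close>

text \<open>\<open>ip n u u - (ip n \<phi> u)\<^sup>2\<close> is the squared norm of the part of u
  orthogonal to \<phi>. For g > 0 the inequality therefore says that E is a simple lowest level and
  that the rest of the spectrum lies at or above E + g.\<close>

definition gap_at :: "nat \<Rightarrow> (nat \<Rightarrow> nat \<Rightarrow> real) \<Rightarrow> real \<Rightarrow> (nat \<Rightarrow> real) \<Rightarrow> real \<Rightarrow> bool" where
  "gap_at n M E \<phi> g \<longleftrightarrow> ip n \<phi> \<phi> = 1 \<and> (\<forall>i<n. ap n M \<phi> i = E * \<phi> i) \<and>
     (\<forall>u. g * (ip n u u - (ip n \<phi> u)\<^sup>2) \<le> ip n u (ap n M u) - E * ip n u u)"

text \<open>Cauchy-Schwarz for the semidefinite form of L = M - E, applied to L u and u, bounds |L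
  u|^4 by a multiple of (u, L u) = 0.\<close>

lemma minimizer_is_eigenvector:
  assumes sym: "symm n M" and low: "\<And>u. E * ip n u u \<le> ip n u (ap n M u)"
    and eq: "ip n u (ap n M u) = E * ip n u u"
  shows "\<forall>i<n. ap n M u i = E * u i"
proof -
  define L where "L = (\<lambda>i j. M i j - E * of_bool (i = j))"
  have Q: "ip n v (ap n L w) = ip n v (ap n M w) - E * ip n v w" for v w
    unfolding L_def by (rule ip_ap_shift)
  have psd: "0 \<le> ip n v (ap n L v)" for v using low[of v] by (simp add: Q)
  have "(ip n (ap n L u) (ap n L u))\<^sup>2 \<le> ip n (ap n L u) (ap n L (ap n L u)) * ip n u (ap n L u)"
    using psd_Cauchy_Schwarz[OF _ psd] symm_shift[OF sym] unfolding L_def by blast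
  also have "ip n u (ap n L u) = 0" using eq by (simp add: Q)
  finally have "ip n (ap n L u) (ap n L u) = 0" by simp
  then have "\<forall>i<n. ap n L u i = 0" by (simp add: ip_eq_0)
  then show ?thesis by (simp add: L_def ap_shift)
qed

lemma ip_eigenvector:
  assumes "\<forall>i<n. ap n M \<phi> i = E * \<phi> i"
  shows "ip n u (ap n M \<phi>) = E * ip n u \<phi>"
proof -
  have "ip n u (ap n M \<phi>) = ip n u (\<lambda>i. E * \<phi> i)"
    using assms by (intro ip_cong) simp_all
  then show ?thesis by (simp add: lin_simps)
qed

text \<open>\<phi> lies in the kernel of M - E, so dropping the component along it leaves the form
  unchanged. Hence a gap need only be checked on vectors orthogonal to \<phi>.\<close>

lemma quadratic_form_minus_eigenvector:
  assumes sym: "symm n M" and unit: "ip n \<phi> \<phi> = 1" and eig: "\<forall>i<n. ap n M \<phi> i = E * \<phi> i"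
  defines "v \<equiv> \<lambda>u i. u i - ip n \<phi> u * \<phi> i"
  shows "ip n (v u) (ap n M (v u)) - E * ip n (v u) (v u) = ip n u (ap n M u) - E * ip n u u"
    and "ip n \<phi> (v u) = 0" and "ip n (v u) (v u) = ip n u u - (ip n \<phi> u)\<^sup>2"
proof -
  have e: "ip n w (ap n M \<phi>) = E * ip n w \<phi>" for w by (rule ip_eigenvector[OF eig])
  have e': "ip n \<phi> (ap n M w) = E * ip n \<phi> w" for w
    unfolding ip_ap_symm[OF sym] by (subst (1 2) ip_commute) (rule e)
  have c: "ip n u \<phi> = ip n \<phi> u" by (rule ip_commute)
  show "ip n (v u) (ap n M (v u)) - E * ip n (v u) (v u) = ip n u (ap n M u) - E * ip n u u"
    by (simp add: v_def lin_simps e e' c unit) (simp add: algebra_simps)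
  show "ip n \<phi> (v u) = 0" by (simp add: v_def lin_simps unit)
  show "ip n (v u) (v u) = ip n u u - (ip n \<phi> u)\<^sup>2"
    by (simp add: v_def lin_simps c unit power2_eq_square)
qed

lemma gap_atI_orthogonal:
  assumes sym: "symm n M" and unit: "ip n \<phi> \<phi> = 1" and eig: "\<forall>i<n. ap n M \<phi> i = E * \<phi> i"
    and orth: "\<And>u. ip n \<phi> u = 0 \<Longrightarrow> g * ip n u u \<le> ip n u (ap n M u) - E * ip n u u"
  shows "gap_at n M E \<phi> g"
  unfolding gap_at_def
proof (intro conjI allI)
  fix u
  note v = quadratic_form_minus_eigenvector[OF sym unit eig, of u]
  show "g * (ip n u u - (ip n \<phi> u)\<^sup>2) \<le> ip n u (ap n M u) - E * ip n u u"
    using orth[OF v(2)] v(1) unfolding v(3) by linarith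
qed (use unit eig in auto)

lemma gap_at_orth_nonneg:
  assumes "ip n \<phi> \<phi> = 1"
  shows "0 \<le> ip n u u - (ip n \<phi> u)\<^sup>2"
proof -
  have "\<bar>ip n \<phi> u\<bar> \<le> nrm n u"
    using ip_Cauchy_Schwarz[of n \<phi> u] assms by (simp add: nrm_def)
  then have "\<bar>ip n \<phi> u\<bar>\<^sup>2 \<le> (nrm n u)\<^sup>2" by (intro power_mono) auto
  then show ?thesis by (simp add: nrm_sq)
qed

lemma gap_at_mono:
  assumes "gap_at n M E \<phi> g" "g' \<le> g"
  shows "gap_at n M E \<phi> g'"
  using assms mult_right_mono[OF assms(2) gap_at_orth_nonneg[of n \<phi>]]
  unfolding gap_at_def by (meson order_trans)

lemma gap_at_lowest:
  assumes "gap_at n M E \<phi> g" "g \<ge> 0"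
  shows "E * ip n u u \<le> ip n u (ap n M u)"
proof -
  have "0 \<le> g * (ip n u u - (ip n \<phi> u)\<^sup>2)"
    using assms gap_at_orth_nonneg[of n \<phi> u] by (simp add: gap_at_def)
  then show ?thesis using assms(1) by (auto simp: gap_at_def dest: spec[of _ u])
qed

lemma gap_at_expectation:
  assumes "gap_at n M E \<phi> g"
  shows "ip n \<phi> (ap n M \<phi>) = E"
  using assms ip_eigenvector[of n M \<phi> E \<phi>] by (simp add: gap_at_def)

text \<open>Energy no higher than E leaves no room for a component orthogonal to \<phi>. In this
  form simplicity is used for the parity of \<phi> and for identifying the given initial
  state.\<close>

lemma gap_at_minimizer:
  assumes gap: "gap_at n M E \<phi> g" and "g > 0" and min: "ip n u (ap n M u) \<le> E * ip n u u"
  shows "\<forall>i<n. u i = ip n \<phi> u * \<phi> i"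
proof -
  have unit: "ip n \<phi> \<phi> = 1" using gap by (simp add: gap_at_def)
  have "g * (ip n u u - (ip n \<phi> u)\<^sup>2) \<le> 0"
    using gap min by (auto simp: gap_at_def dest: spec[of _ u])
  then have "ip n u u - (ip n \<phi> u)\<^sup>2 = 0"
    using \<open>g > 0\<close> gap_at_orth_nonneg[OF unit, of u] by (simp add: mult_le_0_iff)
  then have "ip n (\<lambda>i. u i - ip n \<phi> u * \<phi> i) (\<lambda>i. u i - ip n \<phi> u * \<phi> i) = 0"
    by (simp add: lin_simps unit ip_commute[of n u \<phi>] power2_eq_square)
  then show ?thesis by (simp add: ip_eq_0)
qed

text \<open>
  Perron--Frobenius: since the off-diagonal entries are nonpositive, \<open>|u|\<close> minimizes the quadratic
  form whenever \<open>u\<close> does, and irreducibility forbids a minimizer \<open>|u| \<noteq> 0\<close> to vanish anywhere.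
\<close>

lemma Perron_Frobenius_gap:
  assumes sym: "symm n M" and n: "n > 0"
    and off: "\<And>i j. i < n \<Longrightarrow> j < n \<Longrightarrow> i \<noteq> j \<Longrightarrow> M i j \<le> 0"
    and irr: "\<And>Z i. (\<And>i j. i < n \<Longrightarrow> j < n \<Longrightarrow> i \<noteq> j \<Longrightarrow> M i j < 0 \<Longrightarrow> Z i \<Longrightarrow> Z j) \<Longrightarrow>
                i < n \<Longrightarrow> Z i \<Longrightarrow> \<forall>j<n. Z j"
  shows "\<exists>E \<phi> g. g > 0 \<and> gap_at n M E \<phi> g \<and> (\<forall>i<n. \<phi> i > 0)"
proof -
  obtain E \<phi>0 where unit0: "ip n \<phi>0 \<phi>0 = 1" and eig0: "\<forall>i<n. ap n M \<phi>0 i = E * \<phi>0 i"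
    and low: "\<And>u. E * ip n u u \<le> ip n u (ap n M u)"
    using exists_lowest_eigenpair[OF sym n] by blast
  have abs_eig: "\<forall>i<n. ap n M (\<lambda>i. \<bar>u i\<bar>) i = E * \<bar>u i\<bar>" if "\<forall>i<n. ap n M u i = E * u i" for u
  proof (rule minimizer_is_eigenvector[OF sym low])
    have "ip n (\<lambda>i. \<bar>u i\<bar>) (ap n M (\<lambda>i. \<bar>u i\<bar>)) \<le> ip n u (ap n M u)"
      unfolding ip_def ap_def sum_distrib_left
    proof (intro sum_mono)
      fix i j assume ij: "i \<in> {..<n}" "j \<in> {..<n}"
      show "\<bar>u i\<bar> * (M i j * \<bar>u j\<bar>) \<le> u i * (M i j * u j)"
      proof (cases "i = j")
        case False
        have "M i j * \<bar>u i * u j\<bar> \<le> M i j * (u i * u j)"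
          using off[of i j] ij False by (intro mult_left_mono_neg) auto
        then show ?thesis by (simp add: abs_mult mult_ac)
      qed simp
    qed
    also have "\<dots> = E * ip n (\<lambda>i. \<bar>u i\<bar>) (\<lambda>i. \<bar>u i\<bar>)"
      using ip_eigenvector[OF that, of u] by (simp add: ip_def)
    finally show "ip n (\<lambda>i. \<bar>u i\<bar>) (ap n M (\<lambda>i. \<bar>u i\<bar>)) = E * ip n (\<lambda>i. \<bar>u i\<bar>) (\<lambda>i. \<bar>u i\<bar>)"
      using low[of "\<lambda>i. \<bar>u i\<bar>"] by linarith
  qed
  \<comment> \<open>At a zero i of w the eigenvalue equation is a sum of nonpositive terms equal to
    0, so w vanishes at every neighbour of i; irreducibility spreads this to all indices.\<close>
  have vanish: "\<forall>j<n. w j = 0"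
    if w: "\<forall>i<n. ap n M w i = E * w i" "\<forall>i<n. w i \<ge> 0" and i: "i < n" "w i = 0" for w i
  proof (rule irr[where Z = "\<lambda>i. w i = 0" and i = i])
    fix i j assume ij: "i < n" "j < n" "i \<noteq> j" "M i j < 0" "w i = 0"
    have "(\<Sum>k<n. - (M i k * w k)) = 0"
      using w(1) ij unfolding ap_def by (simp add: sum_negf)
    moreover have "0 \<le> - (M i k * w k)" if "k \<in> {..<n}" for k
    proof (cases "k = i")
      case False
      then have "M i k \<le> 0" using off that ij by auto
      then show ?thesis using w(2) that by (simp add: mult_nonpos_nonneg)
    qed (use ij in simp)
    ultimately have "- (M i j * w j) = 0"
      using sum_nonneg_eq_0_iff[of "{..<n}" "\<lambda>k. - (M i k * w k)"] ij by blast
    then show "w j = 0" using ij by simp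
  qed (use i in auto)
  define \<phi> where "\<phi> = (\<lambda>i. \<bar>\<phi>0 i\<bar>)"
  have unit: "ip n \<phi> \<phi> = 1" using unit0 by (simp add: \<phi>_def ip_def)
  have eig: "\<forall>i<n. ap n M \<phi> i = E * \<phi> i" unfolding \<phi>_def by (rule abs_eig[OF eig0])
  have pos: "\<phi> i > 0" if "i < n" for i
  proof (rule ccontr)
    assume "\<not> \<phi> i > 0"
    then have "\<phi> i = 0" by (simp add: \<phi>_def)
    then have "\<forall>j<n. \<phi> j = 0" using vanish[OF eig _ that] by (simp add: \<phi>_def)
    then have "ip n \<phi> \<phi> = 0" by (simp add: ip_eq_0)
    then show False using unit by simp
  qed
  have ker: "\<exists>t. \<forall>i<n. u i = t * \<phi> i" if u: "\<forall>i<n. ap n M u i = E * u i" for u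
  proof -
    \<comment> \<open>This t makes v vanish at index 0; then |v| is a nonnegative eigenvector with a
      zero, so v = 0.\<close>
    define t where "t = u 0 / \<phi> 0"
    define v where "v = (\<lambda>i. u i - t * \<phi> i)"
    have "\<forall>i<n. ap n M v i = E * v i"
      using u eig by (simp add: v_def lin_simps algebra_simps)
    from abs_eig[OF this] have "\<forall>j<n. \<bar>v j\<bar> = 0"
      by (rule vanish[where i = 0]) (use n pos[OF n] in \<open>auto simp: v_def t_def\<close>)
    then show ?thesis by (auto simp: v_def)
  qed
  define L where "L = (\<lambda>i j. M i j - E * of_bool (i = j))"
  \<comment> \<open>By \<open>ker\<close> the kernel of M - E is the line through \<phi>, so adding
    the projector on \<phi> makes the form definite. Its coercivity constant, read on the complement
    of \<phi>, is the gap.\<close>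
  define K where "K = (\<lambda>i j. L i j + \<phi> i * \<phi> j)"
  have Q: "ip n u (ap n K u) = (ip n u (ap n M u) - E * ip n u u) + (ip n \<phi> u)\<^sup>2" for u
    unfolding K_def L_def ip_ap_rank_one ip_ap_shift by (simp add: power2_eq_square)
  have symK: "symm n K" unfolding K_def L_def by (intro symm_rank_one symm_shift sym)
  have psd: "0 \<le> ip n u (ap n K u)" for u using low[of u] by (simp add: Q)
  have "\<forall>u. (\<forall>i<n. ap n K u i = 0) \<longrightarrow> (\<forall>i<n. u i = 0)"
  proof (intro allI impI)
    fix u i assume K0: "\<forall>i<n. ap n K u i = 0" and i: "i < n"
    have "ip n u (ap n K u) = 0" using K0 by (simp add: ip_def)
    then have "ip n u (ap n M u) - E * ip n u u = 0" "ip n \<phi> u = 0"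
      using low[of u] zero_le_power2[of "ip n \<phi> u"] unfolding Q by (linarith, simp add: add_nonneg_eq_0_iff)
    then have "\<forall>i<n. ap n M u i = E * u i"
      by (intro minimizer_is_eigenvector[OF sym low]) simp
    then obtain t where t: "\<forall>i<n. u i = t * \<phi> i" using ker by blast
    have "ip n \<phi> u = ip n \<phi> (\<lambda>i. t * \<phi> i)" using t by (intro ip_cong) simp_all
    then have "t = 0" using \<open>ip n \<phi> u = 0\<close> by (simp add: lin_simps unit)
    then show "u i = 0" using t i by simp
  qed
  from psd_trivial_kernel_imp_coercive[OF symK psd this]
  obtain c where c: "c > 0" "\<And>u. c * ip n u u \<le> ip n u (ap n K u)" by blast
  have "gap_at n M E \<phi> c"
  proof (rule gap_atI_orthogonal[OF sym unit eig])
    fix u assume "ip n \<phi> u = 0"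
    then show "c * ip n u u \<le> ip n u (ap n M u) - E * ip n u u"
      using c(2)[of u] by (simp add: Q)
  qed
  then show ?thesis using c(1) pos by blast
qed

text \<open>Any two vectors span a vector orthogonal to \<open>\<phi>\<close> (as in the Courant--Fischer principle), which bounds the second level of \<open>M'\<close>.\<close>

lemma gap_at_perturb:
  assumes gap: "gap_at n M E \<phi> g" and g: "g > 0" and n: "n > 0" and sym': "symm n M'"
    and close: "\<And>u. \<bar>ip n u (ap n M' u) - ip n u (ap n M u)\<bar> \<le> \<kappa> * ip n u u" and \<kappa>: "4 * \<kappa> \<le> g"
  shows "\<exists>E' \<phi>'. gap_at n M' E' \<phi>' (g / 2)"
proof -
  obtain E' \<phi>' where unit': "ip n \<phi>' \<phi>' = 1" and eig': "\<forall>i<n. ap n M' \<phi>' i = E' * \<phi>' i"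
    and low': "\<And>u. E' * ip n u u \<le> ip n u (ap n M' u)"
    using exists_lowest_eigenpair[OF sym' n] by blast
  have unit: "ip n \<phi> \<phi> = 1" using gap by (simp add: gap_at_def)
  have E': "E' \<le> E + \<kappa>"
    using low'[of \<phi>] close[of \<phi>] gap_at_expectation[OF gap] unit by simp
  \<comment> \<open>Orthogonally to the old \<phi>, M' is at least E + g - \<kappa>, while E' is at
    most E + \<kappa>; 4 \<kappa> <= g leaves g / 2.\<close>
  have orth: "g / 2 * ip n v v \<le> ip n v (ap n M' v) - E' * ip n v v" if "ip n \<phi> v = 0" for v
  proof -
    have "g * ip n v v \<le> ip n v (ap n M v) - E * ip n v v"
      using gap that by (auto simp: gap_at_def dest: spec[of _ v])
    moreover have "ip n v (ap n M v) - \<kappa> * ip n v v \<le> ip n v (ap n M' v)"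
      using close[of v] by simp
    moreover have "E' * ip n v v \<le> (E + \<kappa>) * ip n v v"
      using E' ip_nonneg by (rule mult_right_mono)
    moreover have "4 * \<kappa> * ip n v v \<le> g * ip n v v"
      using \<kappa> ip_nonneg by (rule mult_right_mono)
    ultimately show ?thesis by (simp add: algebra_simps)
  qed
  have "gap_at n M' E' \<phi>' (g / 2)"
  proof (rule gap_atI_orthogonal[OF sym' unit' eig'])
    fix u assume u: "ip n \<phi>' u = 0"
    define \<alpha> \<beta> where "\<alpha> = ip n \<phi> u" and "\<beta> = ip n \<phi> \<phi>'"
    define v where "v = (\<lambda>i. \<alpha> * \<phi>' i - \<beta> * u i)"
    have "ip n \<phi> v = 0" by (simp add: v_def lin_simps \<alpha>_def \<beta>_def)
    note o = orth[OF this]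
    have e: "ip n w (ap n M' \<phi>') = E' * ip n w \<phi>'" for w by (rule ip_eigenvector[OF eig'])
    have e': "ip n \<phi>' (ap n M' w) = E' * ip n \<phi>' w" for w
      unfolding ip_ap_symm[OF sym'] by (subst (1 2) ip_commute) (rule e)
    have vv: "ip n v v = \<alpha>\<^sup>2 + \<beta>\<^sup>2 * ip n u u"
      by (simp add: v_def lin_simps unit' u ip_commute[of n u \<phi>'] power2_eq_square)
    have Qv: "ip n v (ap n M' v) - E' * ip n v v = \<beta>\<^sup>2 * (ip n u (ap n M' u) - E' * ip n u u)"
      by (simp add: v_def lin_simps e e' unit' u ip_commute[of n u \<phi>'] power2_eq_square) (simp add: algebra_simps)
    \<comment> \<open>Otherwise \<open>\<phi>'\<close> itself would be orthogonal to \<phi>, and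
      \<open>orth\<close> would put it strictly above its own level.\<close>
    have "\<beta> \<noteq> 0"
    proof
      assume "\<beta> = 0"
      then have "g / 2 \<le> 0"
        using orth[of \<phi>'] e[of \<phi>'] by (simp add: \<beta>_def unit')
      then show False using g by simp
    qed
    have "g / 2 * (\<beta>\<^sup>2 * ip n u u) \<le> g / 2 * ip n v v"
      unfolding vv using g by (intro mult_left_mono) auto
    also have "\<dots> \<le> \<beta>\<^sup>2 * (ip n u (ap n M' u) - E' * ip n u u)" using o Qv by simp
    finally have "\<beta>\<^sup>2 * (g / 2 * ip n u u) \<le> \<beta>\<^sup>2 * (ip n u (ap n M' u) - E' * ip n u u)"
      by (simp add: mult_ac)
    then show "g / 2 * ip n u u \<le> ip n u (ap n M' u) - E' * ip n u u"
      using \<open>\<beta> \<noteq> 0\<close> by simp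
  qed
  then show ?thesis by blast
qed

text \<open>Compactness of [0, 1] as a bisection argument: gaps on two adjacent intervals give the
  smaller one on their union, and a gap at one point survives, halved, in a neighbourhood by
  \<open>gap_at_perturb\<close>.\<close>

lemma uniform_gap:
  fixes A B :: "nat \<Rightarrow> nat \<Rightarrow> real"
  defines "H \<equiv> \<lambda>\<tau> i j. A i j + \<tau> * B i j"
  assumes symA: "symm n A" and symB: "symm n B" and n: "n > 0"
    and gaps: "\<And>\<tau>. 0 \<le> \<tau> \<Longrightarrow> \<tau> \<le> 1 \<Longrightarrow> \<exists>E \<phi> g. g > 0 \<and> gap_at n (H \<tau>) E \<phi> g"
  shows "\<exists>g>0. \<forall>\<tau>\<in>{0..1}. \<exists>E \<phi>. gap_at n (H \<tau>) E \<phi> g"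
proof -
  have symH: "symm n (H \<tau>)" for \<tau> using symA symB by (simp add: H_def symm_def)
  define P where "P = (\<lambda>a b. \<exists>g>0. \<forall>\<tau>\<in>{a..b}. \<exists>E \<phi>. gap_at n (H \<tau>) E \<phi> g)"
  have "(0::real) \<le> 1" by simp
  then have "P 0 1"
  proof (induct rule: Bolzano)
    case (trans a b c)
    then obtain g1 g2 where g: "g1 > 0" "\<forall>\<tau>\<in>{a..b}. \<exists>E \<phi>. gap_at n (H \<tau>) E \<phi> g1"
      "g2 > 0" "\<forall>\<tau>\<in>{b..c}. \<exists>E \<phi>. gap_at n (H \<tau>) E \<phi> g2" unfolding P_def by blast
    have "\<exists>E \<phi>. gap_at n (H \<tau>) E \<phi> (min g1 g2)" if "\<tau> \<in> {a..c}" for \<tau>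
    proof (cases "\<tau> \<le> b")
      case True
      then show ?thesis using g(2) that gap_at_mono[of n "H \<tau>" _ _ g1 "min g1 g2"] by fastforce
    next
      case False
      then show ?thesis using g(4) that gap_at_mono[of n "H \<tau>" _ _ g2 "min g1 g2"] by fastforce
    qed
    then show ?case unfolding P_def using g(1,3) by (intro exI[of _ "min g1 g2"]) simp
  next
    case (local x)
    then obtain E \<phi> g where g: "g > 0" "gap_at n (H x) E \<phi> g" using gaps by blast
    \<comment> \<open>Within distance d the form changes by at most
      \<open>d * abs_entry_sum n B\<close> per unit of squared norm, which stays below the g / 4
      allowed by \<open>gap_at_perturb\<close>.\<close>
    define d where "d = g / (4 * (abs_entry_sum n B + 1))"
    have d: "d > 0" using g(1) abs_entry_sum_nonneg[of n B] by (simp add: d_def)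
    have "\<exists>E \<phi>. gap_at n (H \<tau>) E \<phi> (g / 2)" if "\<bar>\<tau> - x\<bar> \<le> d" for \<tau>
    proof (rule gap_at_perturb[OF g(2,1) n symH])
      fix u
      have "\<bar>ip n u (ap n (H \<tau>) u) - ip n u (ap n (H x) u)\<bar> = \<bar>\<tau> - x\<bar> * \<bar>ip n u (ap n B u)\<bar>"
        by (simp add: H_def lin_simps flip: left_diff_distrib abs_mult)
      also have "\<dots> \<le> d * (abs_entry_sum n B * ip n u u)"
        using that abs_ip_ap_le[of n u B u] d by (intro mult_mono) (auto simp: ip_self)
      finally show "\<bar>ip n u (ap n (H \<tau>) u) - ip n u (ap n (H x) u)\<bar> \<le> d * abs_entry_sum n B * ip n u u"
        by (simp add: mult.assoc)
    next
      show "4 * (d * abs_entry_sum n B) \<le> g"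
        using g(1) abs_entry_sum_nonneg[of n B] by (simp add: d_def field_simps)
    qed
    then have "\<forall>\<tau>\<in>{a..b}. \<exists>E \<phi>. gap_at n (H \<tau>) E \<phi> (g / 2)" if "a \<le> x" "x \<le> b" "b - a < d" for a b
      using that by auto
    then have "P a b" if "a \<le> x" "x \<le> b" "b - a < d" for a b
      unfolding P_def using that g(1) half_gt_zero by blast
    then show ?case using d by blast
  qed
  then show ?thesis by (simp only: P_def)
qed

text \<open>M - E plus the projector on \<phi> is invertible. Pairing the solution with \<phi> shows
  that it is orthogonal to \<phi>, as r is, so the projector drops out. The norm bound is the gap
  inequality at \<chi> combined with Cauchy-Schwarz.\<close>

lemma reduced_resolvent:
  assumes sym: "symm n M" and gap: "gap_at n M E \<phi> g" and g: "g > 0" and r: "ip n \<phi> r = 0"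
  shows "\<exists>\<chi>. (\<forall>i<n. ap n M \<chi> i - E * \<chi> i = r i) \<and> g * nrm n \<chi> \<le> nrm n r"
proof -
  have unit: "ip n \<phi> \<phi> = 1" and eig: "\<forall>i<n. ap n M \<phi> i = E * \<phi> i"
    and gp: "\<And>u. g * (ip n u u - (ip n \<phi> u)\<^sup>2) \<le> ip n u (ap n M u) - E * ip n u u"
    using gap by (auto simp: gap_at_def)
  define L where "L = (\<lambda>i j. M i j - E * of_bool (i = j))"
  define K where "K = (\<lambda>i j. L i j + \<phi> i * \<phi> j)"
  have Q: "ip n v (ap n K u) = (ip n v (ap n M u) - E * ip n v u) + ip n \<phi> v * ip n \<phi> u" for u v
    unfolding K_def L_def ip_ap_rank_one ip_ap_shift by simp
  have "\<forall>u. (\<forall>i<n. ap n K u i = 0) \<longrightarrow> (\<forall>i<n. u i = 0)"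
  proof (intro allI impI)
    fix u i assume K0: "\<forall>i<n. ap n K u i = 0" and i: "i < n"
    have "ip n u (ap n K u) = 0" using K0 by (simp add: ip_def)
    then have 0: "(ip n u (ap n M u) - E * ip n u u) + (ip n \<phi> u)\<^sup>2 = 0"
      by (simp add: Q power2_eq_square)
    have nn: "0 \<le> g * (ip n u u - (ip n \<phi> u)\<^sup>2)"
      using g gap_at_orth_nonneg[OF unit] by simp
    then have "(ip n \<phi> u)\<^sup>2 = 0" using 0 gp[of u] zero_le_power2[of "ip n \<phi> u"] by linarith
    then have "g * ip n u u \<le> 0" using 0 gp[of u] by simp
    then have "ip n u u = 0" using g ip_nonneg[of n u] by (simp add: mult_le_0_iff)
    then show "u i = 0" using i by (simp add: ip_eq_0)
  qed
  from linear_system_solvable[OF this] obtain N where N: "\<And>i. i < n \<Longrightarrow> ap n K (ap n N r) i = r i"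
    by blast
  define \<chi> where "\<chi> = ap n N r"
  have K\<chi>: "ip n v (ap n K \<chi>) = ip n v r" for v
    by (rule ip_cong) (simp_all add: \<chi>_def N)
  have "ip n \<phi> (ap n M \<chi>) = E * ip n \<phi> \<chi>"
    unfolding ip_ap_symm[OF sym] by (subst (1 2) ip_commute) (rule ip_eigenvector[OF eig])
  then have \<phi>\<chi>: "ip n \<phi> \<chi> = 0"
    using K\<chi>[of \<phi>] by (simp add: Q unit r)
  have "ap n M \<chi> i - E * \<chi> i = r i" if "i < n" for i
    using N[OF that] by (simp add: K_def L_def ap_rank_one ap_shift that \<phi>\<chi> flip: \<chi>_def)
  moreover have "g * nrm n \<chi> \<le> nrm n r"
  proof (cases "nrm n \<chi> = 0")
    case False
    then have pos: "nrm n \<chi> > 0" using nrm_nonneg[of n \<chi>] by linarith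
    have "g * (nrm n \<chi> * nrm n \<chi>) \<le> ip n \<chi> r"
      using gp[of \<chi>] K\<chi>[of \<chi>] by (simp add: Q \<phi>\<chi> ip_self)
    also have "\<dots> \<le> nrm n \<chi> * nrm n r"
      using ip_Cauchy_Schwarz[of n \<chi> r] by linarith
    finally have "nrm n \<chi> * (g * nrm n \<chi>) \<le> nrm n \<chi> * nrm n r" by (simp add: mult_ac)
    then show ?thesis using pos by simp
  qed simp
  ultimately show ?thesis by blast
qed

section \<open>The adiabatic theorem for a linear ramp\<close>

text \<open>The equation \<open>\<psi>' = - \<i> K \<psi>\<close> with real \<open>K\<close>, for \<open>\<psi> = x + \<i> y\<close>.\<close>

definition real_flow :: "nat \<Rightarrow> (real \<Rightarrow> nat \<Rightarrow> nat \<Rightarrow> real) \<Rightarrow> (real \<Rightarrow> nat \<Rightarrow> real) \<Rightarrow> (real \<Rightarrow> nat \<Rightarrow> real) \<Rightarrow> bool" where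
  "real_flow n K x y \<longleftrightarrow> (\<forall>t. \<forall>i<n.
     ((\<lambda>t. x t i) has_real_derivative ap n (K t) (y t) i) (at t) \<and>
     ((\<lambda>t. y t i) has_real_derivative - ap n (K t) (x t) i) (at t))"

section \<open>Derivatives of quadratic forms along a flow\<close>

lemma DERIV_ip:
  assumes "\<And>i. i < n \<Longrightarrow> ((\<lambda>t. u t i) has_real_derivative u' i) (at t)"
    and "\<And>i. i < n \<Longrightarrow> ((\<lambda>t. v t i) has_real_derivative v' i) (at t)"
  shows "((\<lambda>t. ip n (u t) (v t)) has_real_derivative ip n u' (v t) + ip n (u t) v') (at t)"
proof -
  have "((\<lambda>t. \<Sum>i<n. u t i * v t i) has_real_derivative (\<Sum>i<n. u' i * v t i + v' i * u t i)) (at t)"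
    by (intro DERIV_sum DERIV_mult assms) auto
  then show ?thesis by (simp add: ip_def sum.distrib mult.commute)
qed

lemma DERIV_ap:
  assumes "\<And>i. i < n \<Longrightarrow> ((\<lambda>t. u t i) has_real_derivative u' i) (at t)"
  shows "((\<lambda>t. ap n M (u t) i) has_real_derivative ap n M u' i) (at t)"
  unfolding ap_def by (intro DERIV_sum DERIV_cmult assms) auto

lemma DERIV_quadratic_form:
  assumes "symm n M" and "\<And>i. i < n \<Longrightarrow> ((\<lambda>t. u t i) has_real_derivative u' i) (at t)"
  shows "((\<lambda>t. ip n (u t) (ap n M (u t))) has_real_derivative 2 * ip n u' (ap n M (u t))) (at t)"
proof -
  have "ip n (u t) (ap n M u') = ip n u' (ap n M (u t))"
    by (subst ip_ap_symm[OF assms(1)]) (rule ip_commute)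
  then show ?thesis
    using DERIV_ip[of n u u' t "\<lambda>t. ap n M (u t)" "ap n M u'"] assms(2) DERIV_ap[of n u u' t M] by simp
qed

lemma DERIV_upper_bound:
  fixes f :: "real \<Rightarrow> real"
  assumes "a \<le> b" and f: "\<And>t. (f has_real_derivative f' t) (at t)"
    and le: "\<And>t. a \<le> t \<Longrightarrow> t \<le> b \<Longrightarrow> f' t \<le> c"
  shows "f b - f a \<le> c * (b - a)"
proof -
  have "((\<lambda>t. f t - c * t) has_real_derivative (f' t - c)) (at t)" for t
    using f[of t] by (auto intro!: derivative_eq_intros)
  then have "f b - c * b \<le> f a - c * a"
    using assms(1) le by (intro DERIV_nonpos_imp_nonincreasing[of a b "\<lambda>t. f t - c * t"]) force+
  then show ?thesis by (simp add: algebra_simps)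
qed

text \<open>The cross terms cancel by symmetry of K. As the equation is linear, the lemma also acts
  as a uniqueness statement when applied to a difference of solutions.\<close>

lemma real_flow_norm_conserved:
  assumes flow: "real_flow n K x y" and sym: "\<And>t. symm n (K t)"
  shows "ip n (x t) (x t) + ip n (y t) (y t) = ip n (x 0) (x 0) + ip n (y 0) (y 0)"
proof -
  define f where "f = (\<lambda>t. ip n (x t) (x t) + ip n (y t) (y t))"
  have x': "i < n \<Longrightarrow> ((\<lambda>t. x t i) has_real_derivative ap n (K t) (y t) i) (at t)"
    and y': "i < n \<Longrightarrow> ((\<lambda>t. y t i) has_real_derivative (-1) * ap n (K t) (x t) i) (at t)" for t i
    using flow unfolding real_flow_def by simp_all
  have "(f has_real_derivative 0) (at t)" for t
  proof -
    have "(f has_real_derivative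
        (ip n (ap n (K t) (y t)) (x t) + ip n (x t) (ap n (K t) (y t))) +
        (ip n (\<lambda>i. (-1) * ap n (K t) (x t) i) (y t) + ip n (y t) (\<lambda>i. (-1) * ap n (K t) (x t) i))) (at t)"
      unfolding f_def by (intro DERIV_add DERIV_ip x' y')
    moreover have "ip n (ap n (K t) (y t)) (x t) = ip n (ap n (K t) (x t)) (y t)"
      by (subst ip_ap_symm[OF sym, symmetric]) (rule ip_commute)
    ultimately show ?thesis
      unfolding ip_scale_left ip_scale_right ip_commute[of n "x t" "ap n (K t) (y t)"]
        ip_commute[of n "y t" "ap n (K t) (x t)"] by simp
  qed
  then have "f t = f 0" using DERIV_isconst_all by blast
  then show ?thesis by (simp add: f_def)
qed

locale linear_ramp =
  fixes n :: nat and A B :: "nat \<Rightarrow> nat \<Rightarrow> real" and T :: real and x y :: "real \<Rightarrow> nat \<Rightarrow> real"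
  assumes symA: "symm n A" and symB: "symm n B" and T: "T > 0"
    and flow: "real_flow n (\<lambda>t i j. A i j + (t / T) * B i j) x y"
    and unit0: "ip n (x 0) (x 0) + ip n (y 0) (y 0) = 1"
begin

abbreviation K :: "real \<Rightarrow> nat \<Rightarrow> nat \<Rightarrow> real" where
  "K t \<equiv> \<lambda>i j. A i j + (t / T) * B i j"

definition energy :: "real \<Rightarrow> real" where
  "energy t = ip n (x t) (ap n (K t) (x t)) + ip n (y t) (ap n (K t) (y t))"

definition slope :: "real \<Rightarrow> real" where
  "slope t = ip n (x t) (ap n B (x t)) + ip n (y t) (ap n B (y t))"

lemma symK: "symm n (K t)"
  using symA symB by (simp add: symm_def)

lemma DERIV_x: "i < n \<Longrightarrow> ((\<lambda>t. x t i) has_real_derivative ap n (K t) (y t) i) (at t)"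
  and DERIV_y: "i < n \<Longrightarrow> ((\<lambda>t. y t i) has_real_derivative (-1) * ap n (K t) (x t) i) (at t)"
  using flow unfolding real_flow_def by simp_all

lemma unit: "ip n (x t) (x t) + ip n (y t) (y t) = 1"
  using real_flow_norm_conserved[OF flow symK] unit0 by simp

text \<open>The motion of x and that of y contribute (K y, K x) with opposite signs; only the
  explicit time dependence of K, of size 1/T, is left.\<close>

lemma DERIV_energy: "(energy has_real_derivative slope t / T) (at t)"
proof -
  have e: "energy = (\<lambda>t. (ip n (x t) (ap n A (x t)) + (t / T) * ip n (x t) (ap n B (x t)))
      + (ip n (y t) (ap n A (y t)) + (t / T) * ip n (y t) (ap n B (y t))))"
    by (rule ext) (simp only: energy_def lin_simps)
  define x' where "x' = ap n (K t) (y t)"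
  define y' where "y' = (\<lambda>i. (-1) * ap n (K t) (x t) i)"
  have x': "i < n \<Longrightarrow> ((\<lambda>t. x t i) has_real_derivative x' i) (at t)" for i
    unfolding x'_def by (rule DERIV_x)
  have y': "i < n \<Longrightarrow> ((\<lambda>t. y t i) has_real_derivative y' i) (at t)" for i
    unfolding y'_def by (rule DERIV_y)
  have tT: "((\<lambda>t. t / T) has_real_derivative 1 / T) (at t)"
    using T by (auto intro!: derivative_eq_intros)
  have "(energy has_real_derivative
      (2 * ip n x' (ap n A (x t)) + (1 / T * ip n (x t) (ap n B (x t)) + 2 * ip n x' (ap n B (x t)) * (t / T)))
    + (2 * ip n y' (ap n A (y t)) + (1 / T * ip n (y t) (ap n B (y t)) + 2 * ip n y' (ap n B (y t)) * (t / T)))) (at t)"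
    unfolding e by (intro DERIV_add DERIV_mult tT DERIV_quadratic_form symA symB x' y')
  note D = this
  have split: "ip n u (ap n A z) + ip n u (ap n B z) * (t / T) = ip n u (ap n (K t) z)" for u z
    unfolding ap_mat_add ip_add_right ip_scale_right by simp
  have 1: "ip n x' (ap n A (x t)) + ip n x' (ap n B (x t)) * (t / T) = ip n (ap n (K t) (y t)) (ap n (K t) (x t))"
    unfolding split x'_def ..
  have 2: "ip n y' (ap n A (y t)) + ip n y' (ap n B (y t)) * (t / T) = - ip n (ap n (K t) (y t)) (ap n (K t) (x t))"
    unfolding split unfolding y'_def ip_scale_left ip_commute[of n "ap n (K t) (y t)"] by simp
  have alg: "(2 * a + (1 / T * sx + 2 * b * \<tau>)) + (2 * c + (1 / T * sy + 2 * d * \<tau>))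
      = (sx + sy) / T + 2 * (a + b * \<tau>) + 2 * (c + d * \<tau>)" for a b c d sx sy \<tau>
    by (simp add: add_divide_distrib algebra_simps)
  show ?thesis using D unfolding alg 1 2 by (simp add: slope_def)
qed

lemma slope_le: "\<bar>slope t\<bar> \<le> abs_entry_sum n B"
proof -
  have "\<bar>slope t\<bar> \<le> abs_entry_sum n B * ip n (x t) (x t) + abs_entry_sum n B * ip n (y t) (y t)"
    using abs_ip_ap_le[of n "x t" B "x t"] abs_ip_ap_le[of n "y t" B "y t"]
    by (simp add: slope_def ip_self)
  also have "\<dots> = abs_entry_sum n B" using unit[of t] by (simp flip: distrib_left)
  finally show ?thesis .
qed

lemma energy_lipschitz:
  assumes "s \<le> t"
  shows "energy t - energy s \<le> abs_entry_sum n B * ((t - s) / T)"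
proof -
  have "energy t - energy s \<le> (abs_entry_sum n B / T) * (t - s)"
    by (rule DERIV_upper_bound[OF assms DERIV_energy])
      (use slope_le T in \<open>auto intro!: divide_right_mono dest: abs_le_D1\<close>)
  then show ?thesis by simp
qed

text \<open>
  Off-diagonal matrix elements of \<open>B\<close> between the ground state \<open>\<phi>\<close> and its complement drive the
  transitions.  Writing \<open>(B - b) \<phi> = (H - E) \<chi>\<close> turns them, up to errors of order \<open>h\<close>, into the time
  derivative of the bounded quantity \<open>W = Im (\<langle>\<psi>|\<phi>\<rangle>\<langle>\<chi>|\<psi>\<rangle>)\<close>, \<open>\<psi> = x + \<i> y\<close>.  The frame \<open>\<phi>, \<chi>\<close> is frozen
  at the right end point of the step, where \<open>E\<^sub>1 \<le> \<langle>\<phi>|H(t\<^sub>1)|\<phi>\<rangle> = E\<^sub>2 - h b\<close>, so that no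
  differentiability of the eigenvectors is needed.
\<close>

lemma adiabatic_step:
  assumes t: "t1 \<le> t2" and g: "g > 0"
    and gap1: "gap_at n (K t1) E1 \<phi>1 g" and gap2: "gap_at n (K t2) E2 \<phi> g"
  defines "\<beta> \<equiv> abs_entry_sum n B" and "h \<equiv> (t2 - t1) / T"
  defines "\<kappa> \<equiv> 2 * \<beta> / g"
  shows "energy t2 - E2 \<le> (1 + \<kappa> * h) * (energy t1 - E1) + 5 * \<kappa> * \<beta> * h\<^sup>2 + 2 * \<kappa> / T"
proof -
  have h: "h \<ge> 0" and \<beta>: "\<beta> \<ge> 0" and \<kappa>: "\<kappa> \<ge> 0"
    using t T g by (simp_all add: h_def \<beta>_def \<kappa>_def abs_entry_sum_nonneg)
  have unit\<phi>: "ip n \<phi> \<phi> = 1" and eig: "\<forall>i<n. ap n (K t2) \<phi> i = E2 * \<phi> i"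
    and gp: "\<And>u. g * (ip n u u - (ip n \<phi> u)\<^sup>2) \<le> ip n u (ap n (K t2) u) - E2 * ip n u u"
    using gap2 by (auto simp: gap_at_def)
  have nrm\<phi>: "nrm n \<phi> = 1" by (simp add: nrm_def unit\<phi>)
  define b where "b = ip n \<phi> (ap n B \<phi>)"
  have b: "\<bar>b\<bar> \<le> \<beta>" using abs_ip_ap_le[of n \<phi> B \<phi>] by (simp add: b_def \<beta>_def nrm\<phi>)
  \<comment> \<open>The component of B \<phi> orthogonal to \<phi>, hence an admissible right-hand
    side for \<open>reduced_resolvent\<close>.\<close>
  define r where "r = (\<lambda>i. ap n B \<phi> i - b * \<phi> i)"
  have r\<phi>: "ip n \<phi> r = 0" by (simp add: r_def lin_simps unit\<phi> flip: b_def)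
  have ipr: "ip n r z = ip n \<phi> (ap n B z) - b * ip n \<phi> z" for z
    by (simp add: r_def lin_simps ip_ap_symm[OF symB])
  obtain \<chi> where \<chi>: "\<forall>i<n. ap n (K t2) \<chi> i - E2 * \<chi> i = r i" and "g * nrm n \<chi> \<le> nrm n r"
    using reduced_resolvent[OF symK gap2 g r\<phi>] by blast
  moreover have "nrm n r \<le> \<beta>"
  proof (rule power2_le_imp_le)
    have "ip n r r = ip n (ap n B \<phi>) (ap n B \<phi>) - b\<^sup>2"
      by (simp add: r_def lin_simps unit\<phi> ip_commute[of n "ap n B \<phi>" \<phi>] power2_eq_square flip: b_def)
    also have "\<dots> \<le> (nrm n (ap n B \<phi>))\<^sup>2" by (simp add: nrm_sq)
    also have "\<dots> \<le> \<beta>\<^sup>2"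
      using nrm_ap_le[of n B \<phi>] by (intro power_mono) (simp_all add: \<beta>_def nrm\<phi>)
    finally show "(nrm n r)\<^sup>2 \<le> \<beta>\<^sup>2" by (simp add: nrm_sq)
  qed (rule \<beta>)
  ultimately have nrm\<chi>: "nrm n \<chi> \<le> \<kappa> / 2" using g by (simp add: \<kappa>_def field_simps)

  have eK\<phi>: "ip n \<phi> (ap n (K t2) z) = E2 * ip n \<phi> z" for z
    unfolding ip_ap_symm[OF symK] by (subst (1 2) ip_commute) (rule ip_eigenvector[OF eig])
  have eK\<chi>: "ip n \<chi> (ap n (K t2) z) = E2 * ip n \<chi> z + ip n r z" for z
  proof -
    have "ip n (ap n (K t2) \<chi>) z = ip n (\<lambda>i. E2 * \<chi> i + r i) z"
      using \<chi> by (intro ip_cong) (auto simp: algebra_simps)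
    then show ?thesis unfolding ip_ap_symm[OF symK] by (simp add: lin_simps)
  qed
  have K_eq: "ip n u (ap n (K t) z) = ip n u (ap n (K t2) z) + ((t - t2) / T) * ip n u (ap n B z)" for u z t
    unfolding lin_simps by (simp add: diff_divide_distrib algebra_simps)

  define W where "W = (\<lambda>t. ip n \<phi> (x t) * ip n \<chi> (y t) - ip n \<phi> (y t) * ip n \<chi> (x t))"
  \<comment> \<open>\<open>b * (t / T)\<close> follows the moving level to first order, and
    \<open>2 / T * W t\<close> cancels the transition terms linear in r that occur in
    \<open>slope t\<close>.\<close>
  define F where "F = (\<lambda>t. energy t - b * (t / T) + 2 / T * W t)"
  \<comment> \<open>What K t - K t2 contributes to the derivative of W, without its small factor (t
    - t2) / T.\<close>
  define R where "R = (\<lambda>t. ip n \<phi> (ap n B (y t)) * ip n \<chi> (y t) - ip n \<phi> (x t) * ip n \<chi> (ap n B (x t))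
      + ip n \<phi> (ap n B (x t)) * ip n \<chi> (x t) - ip n \<phi> (y t) * ip n \<chi> (ap n B (y t)))"
  have ipc: "ip n u (\<lambda>i. 0) = 0" "ip n (\<lambda>i. 0) u = 0" for u by (simp_all add: ip_def)
  have DERIV_ipl: "((\<lambda>t. ip n u (x t)) has_real_derivative ip n u (ap n (K t) (y t))) (at t)"
    "((\<lambda>t. ip n u (y t)) has_real_derivative - ip n u (ap n (K t) (x t))) (at t)" for u t
    using DERIV_ip[of n "\<lambda>t. u" "\<lambda>i. 0" t x "ap n (K t) (y t)"]
      DERIV_ip[of n "\<lambda>t. u" "\<lambda>i. 0" t y "\<lambda>i. (-1) * ap n (K t) (x t) i"] DERIV_x DERIV_y
    unfolding ip_scale_right by (simp_all add: ipc)
  have DERIV_W: "(W has_real_derivative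
      (t - t2) / T * R t - ip n \<phi> (x t) * ip n r (x t) - ip n \<phi> (y t) * ip n r (y t)) (at t)" for t
  proof -
    have "(W has_real_derivative
      (ip n \<phi> (ap n (K t) (y t)) * ip n \<chi> (y t) + (- ip n \<chi> (ap n (K t) (x t))) * ip n \<phi> (x t))
      - ((- ip n \<phi> (ap n (K t) (x t))) * ip n \<chi> (x t) + ip n \<chi> (ap n (K t) (y t)) * ip n \<phi> (y t))) (at t)"
      unfolding W_def by (intro DERIV_diff DERIV_mult DERIV_ipl)
    then show ?thesis
      by (rule DERIV_cong) (simp only: K_eq[of _ t] eK\<phi> eK\<chi> R_def, simp add: algebra_simps)
  qed
  have DERIV_F: "(F has_real_derivative (slope t - b + 2 * ((t - t2) / T * R t
      - ip n \<phi> (x t) * ip n r (x t) - ip n \<phi> (y t) * ip n r (y t))) / T) (at t)" for t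
  proof -
    have "(F has_real_derivative slope t / T - b * (1 / T) + 2 / T * ((t - t2) / T * R t
      - ip n \<phi> (x t) * ip n r (x t) - ip n \<phi> (y t) * ip n r (y t))) (at t)"
      unfolding F_def
      by (intro DERIV_add DERIV_diff DERIV_energy DERIV_cmult DERIV_W) (use T in \<open>auto intro!: derivative_eq_intros\<close>)
    then show ?thesis by (rule DERIV_cong) (simp add: diff_divide_distrib add_divide_distrib)
  qed
  \<comment> \<open>Without its diagonal part b and the coupling to \<phi>, the expectation of B is
    that of B - b on the component v orthogonal to \<phi>. It is at most 2 \<beta> |v|^2, and the
    gap bounds |v|^2 by the excess energy over g: this is the origin of \<kappa> = 2 \<beta> /
    g.\<close>
  have complement: "ip n z (ap n B z) - b * ip n z z - 2 * ip n \<phi> z * ip n r z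
      \<le> \<kappa> * (ip n z (ap n (K t2) z) - E2 * ip n z z)" for z
  proof -
    define v where "v = (\<lambda>i. z i - ip n \<phi> z * \<phi> i)"
    have sw: "ip n z (ap n B \<phi>) = ip n \<phi> (ap n B z)" "ip n z \<phi> = ip n \<phi> z"
      unfolding ip_ap_symm[OF symB, of \<phi>] by (rule ip_commute)+
    have vv: "ip n v v = ip n z z - (ip n \<phi> z)\<^sup>2"
      by (simp add: v_def lin_simps sw unit\<phi> power2_eq_square)
    have "ip n z (ap n B z) - b * ip n z z - 2 * ip n \<phi> z * ip n r z = ip n v (ap n B v) - b * ip n v v"
      unfolding vv by (simp add: v_def lin_simps sw ipr flip: b_def) (simp add: algebra_simps power2_eq_square)
    also have "\<dots> \<le> \<beta> * ip n v v + \<beta> * ip n v v"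
    proof -
      have "ip n v (ap n B v) \<le> \<beta> * ip n v v"
        using abs_ip_ap_le[of n v B v] by (simp add: \<beta>_def ip_self)
      moreover have "- b * ip n v v \<le> \<beta> * ip n v v"
        using b by (intro mult_right_mono ip_nonneg) simp
      ultimately show ?thesis by simp
    qed
    also have "\<dots> = \<kappa> * (g * ip n v v)" using g by (simp add: \<kappa>_def)
    also have "\<dots> \<le> \<kappa> * (ip n z (ap n (K t2) z) - E2 * ip n z z)"
      using gp[of z] \<kappa> unfolding vv by (rule mult_left_mono)
    finally show ?thesis .
  qed
  have R_le: "\<bar>R t\<bar> \<le> \<kappa> * \<beta>" for t
  proof -
    have 1: "\<bar>ip n \<phi> (ap n B z) * ip n \<chi> z\<bar> \<le> (\<beta> * nrm n z) * (\<kappa> / 2 * nrm n z)" for z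
      unfolding abs_mult
    proof (rule mult_mono)
      show "\<bar>ip n \<phi> (ap n B z)\<bar> \<le> \<beta> * nrm n z"
        using abs_ip_ap_le[of n \<phi> B z] by (simp add: \<beta>_def nrm\<phi>)
      show "\<bar>ip n \<chi> z\<bar> \<le> \<kappa> / 2 * nrm n z"
        using ip_Cauchy_Schwarz[of n \<chi> z] mult_right_mono[OF nrm\<chi> nrm_nonneg[of n z]] by linarith
    qed (use \<beta> in auto)
    have 2: "\<bar>ip n \<phi> z * ip n \<chi> (ap n B z)\<bar> \<le> nrm n z * (\<kappa> / 2 * (\<beta> * nrm n z))" for z
      unfolding abs_mult
    proof (rule mult_mono)
      show "\<bar>ip n \<phi> z\<bar> \<le> nrm n z"
        using ip_Cauchy_Schwarz[of n \<phi> z] by (simp add: nrm\<phi>)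
      have "\<bar>ip n \<chi> (ap n B z)\<bar> \<le> nrm n \<chi> * nrm n (ap n B z)" by (rule ip_Cauchy_Schwarz)
      also have "\<dots> \<le> \<kappa> / 2 * (\<beta> * nrm n z)"
        using nrm_ap_le[of n B z] nrm\<chi> \<kappa> by (intro mult_mono) (auto simp: \<beta>_def)
      finally show "\<bar>ip n \<chi> (ap n B z)\<bar> \<le> \<kappa> / 2 * (\<beta> * nrm n z)" .
    qed auto
    have "\<bar>R t\<bar> \<le> \<kappa> * \<beta> * (nrm n (x t) * nrm n (x t)) + \<kappa> * \<beta> * (nrm n (y t) * nrm n (y t))"
      using 1[of "x t"] 1[of "y t"] 2[of "x t"] 2[of "y t"] unfolding R_def by (simp add: algebra_simps)
    also have "\<dots> = \<kappa> * \<beta>" using unit[of t] by (simp flip: ip_self distrib_left)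
    finally show ?thesis .
  qed
  have W_le: "\<bar>W t\<bar> \<le> \<kappa> / 2" for t
  proof -
    have 1: "\<bar>ip n \<phi> u * ip n \<chi> v\<bar> \<le> \<kappa> / 2 * (nrm n u * nrm n v)" for u v
    proof -
      have "\<bar>ip n \<phi> u * ip n \<chi> v\<bar> \<le> nrm n u * (\<kappa> / 2 * nrm n v)"
        unfolding abs_mult
      proof (rule mult_mono)
        show "\<bar>ip n \<phi> u\<bar> \<le> nrm n u"
          using ip_Cauchy_Schwarz[of n \<phi> u] by (simp add: nrm\<phi>)
        show "\<bar>ip n \<chi> v\<bar> \<le> \<kappa> / 2 * nrm n v"
          using ip_Cauchy_Schwarz[of n \<chi> v] mult_right_mono[OF nrm\<chi> nrm_nonneg[of n v]] by linarith
      qed auto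
      then show ?thesis by (simp add: mult_ac)
    qed
    have "\<bar>W t\<bar> \<le> \<kappa> / 2 * (2 * nrm n (x t) * nrm n (y t))"
      using 1[of "x t" "y t"] 1[of "y t" "x t"] unfolding W_def by (simp add: mult_ac)
    also have "\<dots> \<le> \<kappa> / 2 * ((nrm n (x t))\<^sup>2 + (nrm n (y t))\<^sup>2)"
      using \<kappa> by (intro mult_left_mono sum_squares_bound) auto
    also have "\<dots> = \<kappa> / 2" using unit[of t] by (simp add: nrm_sq)
    finally show ?thesis .
  qed

  have E_diff: "E1 \<le> E2 - h * b"
  proof -
    have "E1 * ip n \<phi> \<phi> \<le> ip n \<phi> (ap n (K t1) \<phi>)"
      using g by (intro gap_at_lowest[OF gap1]) simp
    also have "\<dots> = E2 - h * b"
      unfolding K_eq[of \<phi> t1] eK\<phi> unit\<phi> h_def b_def by (simp add: diff_divide_distrib algebra_simps)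
    finally show ?thesis by (simp add: unit\<phi>)
  qed
  \<comment> \<open>Of the 5 \<beta> h, one each comes from the drift of the energy since t1, from
    replacing K t by K t2, and from E1 - E2; the remaining two come from the term 2 R.\<close>
  have F'_le: "(slope t - b + 2 * ((t - t2) / T * R t
      - ip n \<phi> (x t) * ip n r (x t) - ip n \<phi> (y t) * ip n r (y t))) / T
      \<le> (\<kappa> * (energy t1 - E1 + 5 * \<beta> * h)) / T" if "t1 \<le> t" "t \<le> t2" for t
  proof (rule divide_right_mono)
    define d where "d = (t2 - t) / T"
    have d: "0 \<le> d" "d \<le> h" using that T by (simp_all add: d_def h_def divide_right_mono)
    have "(t - t2) / T * R t = - d * R t" by (simp add: d_def minus_divide_left)
    also have "\<dots> \<le> \<bar>d\<bar> * \<bar>R t\<bar>" by (metis abs_ge_self abs_minus_cancel abs_mult)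
    also have "\<dots> \<le> h * (\<kappa> * \<beta>)" using d R_le[of t] by (intro mult_mono) auto
    finally have 1: "(t - t2) / T * R t \<le> h * (\<kappa> * \<beta>)" .
    have "energy t \<le> energy t1 + \<beta> * ((t - t1) / T)"
      using energy_lipschitz[OF that(1)] by (simp add: \<beta>_def)
    also have "\<dots> \<le> energy t1 + \<beta> * h"
      using \<beta> that T by (intro add_left_mono mult_left_mono) (simp_all add: h_def divide_right_mono)
    finally have 2: "energy t \<le> energy t1 + \<beta> * h" .
    have "ip n (x t) (ap n (K t2) (x t)) + ip n (y t) (ap n (K t2) (y t)) = energy t + d * slope t"
      unfolding energy_def slope_def K_eq[of _ t] by (simp add: d_def diff_divide_distrib algebra_simps)
    also have "d * slope t \<le> h * \<beta>"
    proof -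
      have "d * slope t \<le> d * \<beta>"
        using slope_le[of t] d by (intro mult_left_mono) (auto simp: \<beta>_def)
      also have "\<dots> \<le> h * \<beta>" using d \<beta> by (intro mult_right_mono) auto
      finally show ?thesis .
    qed
    finally have 3: "ip n (x t) (ap n (K t2) (x t)) + ip n (y t) (ap n (K t2) (y t)) \<le> energy t + h * \<beta>"
      by simp
    have "- b * h \<le> \<beta> * h" using b h by (intro mult_right_mono) auto
    then have 4: "E1 - E2 \<le> \<beta> * h" using E_diff by (simp add: mult.commute)
    have "slope t - b - 2 * ip n \<phi> (x t) * ip n r (x t) - 2 * ip n \<phi> (y t) * ip n r (y t)
        \<le> \<kappa> * (ip n (x t) (ap n (K t2) (x t)) + ip n (y t) (ap n (K t2) (y t)) - E2)"
    proof -
      have u: "c = c * ip n (x t) (x t) + c * ip n (y t) (y t)" for c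
        using unit[of t] by (simp flip: distrib_left)
      show ?thesis
        using complement[of "x t"] complement[of "y t"] u[of b] u[of "\<kappa> * E2"]
        by (simp add: slope_def right_diff_distrib distrib_left mult.assoc)
    qed
    also have "\<dots> \<le> \<kappa> * (energy t1 - E1 + 3 * \<beta> * h)"
      using 2 3[unfolded mult.commute[of h \<beta>]] 4 \<kappa> by (intro mult_left_mono) linarith+
    finally have 5: "slope t - b - 2 * ip n \<phi> (x t) * ip n r (x t) - 2 * ip n \<phi> (y t) * ip n r (y t)
      \<le> \<kappa> * (energy t1 - E1 + 3 * \<beta> * h)" .
    show "slope t - b + 2 * ((t - t2) / T * R t
        - ip n \<phi> (x t) * ip n r (x t) - ip n \<phi> (y t) * ip n r (y t)) \<le> \<kappa> * (energy t1 - E1 + 5 * \<beta> * h)"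
    proof -
      have "\<kappa> * (energy t1 - E1 + 5 * \<beta> * h) = \<kappa> * (energy t1 - E1 + 3 * \<beta> * h) + 2 * (h * (\<kappa> * \<beta>))"
        by (simp add: algebra_simps)
      then show ?thesis using 1 5 unfolding mult.assoc right_diff_distrib[of 2] by linarith
    qed
  qed (use T in simp)
  have "F t2 - F t1 \<le> (\<kappa> * (energy t1 - E1 + 5 * \<beta> * h)) / T * (t2 - t1)"
    by (rule DERIV_upper_bound[OF t DERIV_F F'_le])
  also have "\<dots> = \<kappa> * (energy t1 - E1 + 5 * \<beta> * h) * h" by (simp add: h_def)
  finally have F: "F t2 - F t1 \<le> \<kappa> * (energy t1 - E1 + 5 * \<beta> * h) * h" .
  \<comment> \<open>Being a total derivative, the transition term costs only the end values of W,
    divided by T, however long the step.\<close>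
  have "W t1 - W t2 \<le> \<kappa>" using W_le[of t1] W_le[of t2] by linarith
  then have W: "2 / T * (W t1 - W t2) \<le> 2 / T * \<kappa>" using T by (intro mult_left_mono) auto
  have "energy t2 - energy t1 = (F t2 - F t1) + h * b + 2 / T * (W t1 - W t2)"
    by (simp add: F_def h_def diff_divide_distrib algebra_simps)
  then have "energy t2 - energy t1 \<le> \<kappa> * (energy t1 - E1 + 5 * \<beta> * h) * h + h * b + 2 / T * \<kappa>"
    using F W by linarith
  then show ?thesis using E_diff by (simp add: algebra_simps power2_eq_square)
qed

end

text \<open>The level is the minimum of the form on unit vectors. This ties the levels chosen along
  the ramp to the prescribed ones at its ends, although eigenvectors and gap constants may
  differ.\<close>

lemma gap_at_energy_unique:
  assumes "gap_at n M E \<phi> g" "g \<ge> 0" "gap_at n M E' \<phi>' g'" "g' \<ge> 0"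
  shows "E = E'"
  using gap_at_lowest[OF assms(1,2), of \<phi>'] gap_at_lowest[OF assms(3,4), of \<phi>]
    gap_at_expectation[OF assms(1)] gap_at_expectation[OF assms(3)] assms(1,3)
  by (simp add: gap_at_def)

text \<open>T is fixed before the flow is given. Unit norm and energy E0 express that the flow
  starts in the ground state, whatever its phase: the initial excess energy is 0.\<close>

lemma adiabatic_theorem:
  fixes A B :: "nat \<Rightarrow> nat \<Rightarrow> real"
  defines "H \<equiv> \<lambda>\<tau> i j. A i j + \<tau> * B i j"
  assumes symA: "symm n A" and symB: "symm n B" and n: "n > 0"
    and gaps: "\<And>\<tau>. 0 \<le> \<tau> \<Longrightarrow> \<tau> \<le> 1 \<Longrightarrow> \<exists>E \<phi> g. g > 0 \<and> gap_at n (H \<tau>) E \<phi> g"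
    and gap0: "gap_at n (H 0) E0 \<phi>0 g0" "g0 > 0" and gap1: "gap_at n (H 1) E1 \<phi>1 g1" "g1 > 0"
    and \<epsilon>: "\<epsilon> > 0"
  shows "\<exists>T>0. \<forall>x y. real_flow n (\<lambda>t. H (t / T)) x y \<and>
      ip n (x 0) (x 0) + ip n (y 0) (y 0) = 1 \<and>
      ip n (x 0) (ap n (H 0) (x 0)) + ip n (y 0) (ap n (H 0) (y 0)) = E0 \<longrightarrow>
      (ip n \<phi>1 (x T))\<^sup>2 + (ip n \<phi>1 (y T))\<^sup>2 > 1 - \<epsilon>"
proof -
  obtain g where g: "g > 0" and ex: "\<forall>\<tau>\<in>{0..1}. \<exists>E \<phi>. gap_at n (H \<tau>) E \<phi> g"
    using uniform_gap[OF symA symB n gaps[unfolded H_def]] unfolding H_def by blast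
  from bchoice[OF ex] obtain E where "\<forall>\<tau>\<in>{0..1}. \<exists>\<phi>. gap_at n (H \<tau>) (E \<tau>) \<phi> g" by blast
  from bchoice[OF this] obtain \<phi> where "\<forall>\<tau>\<in>{0..1}. gap_at n (H \<tau>) (E \<tau>) (\<phi> \<tau>) g" by blast
  then have gap: "\<And>\<tau>. 0 \<le> \<tau> \<Longrightarrow> \<tau> \<le> 1 \<Longrightarrow> gap_at n (H \<tau>) (E \<tau>) (\<phi> \<tau>) g" by simp
  have E0: "E 0 = E0" and E1: "E 1 = E1"
    using gap_at_energy_unique[OF gap[of 0] _ gap0(1)] gap_at_energy_unique[OF gap[of 1] _ gap1(1)]
      g gap0(2) gap1(2) by auto
  define \<beta> \<kappa> where "\<beta> = abs_entry_sum n B" and "\<kappa> = 2 * abs_entry_sum n B / g"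
  have \<beta>: "\<beta> \<ge> 0" and \<kappa>: "\<kappa> \<ge> 0" using g by (simp_all add: \<beta>_def \<kappa>_def abs_entry_sum_nonneg)
  \<comment> \<open>After m steps the excess is at most exp \<kappa> * m * e, where e is of order
    1/m^2; dividing by g1 turns it into lost fidelity. This m makes the result smaller than
    \<epsilon>.\<close>
  obtain m :: nat where m: "exp \<kappa> * (5 * \<kappa> * \<beta> + 2 * \<kappa>) / (\<epsilon> * g1) < real m"
    using reals_Archimedean2 by blast
  moreover have "0 \<le> exp \<kappa> * (5 * \<kappa> * \<beta> + 2 * \<kappa>) / (\<epsilon> * g1)"
    using \<beta> \<kappa> \<epsilon> gap1(2) by simp
  ultimately have m0: "real m > 0" by linarith
  define T where "T = (real m)\<^sup>2"
  have T: "T > 0" using m0 by (simp add: T_def)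
  define e where "e = (5 * \<kappa> * \<beta> + 2 * \<kappa>) / T"
  have e: "e \<ge> 0" using \<beta> \<kappa> T by (simp add: e_def)
  have "(ip n \<phi>1 (x T))\<^sup>2 + (ip n \<phi>1 (y T))\<^sup>2 > 1 - \<epsilon>"
    if flow: "real_flow n (\<lambda>t. H (t / T)) x y" and unit0: "ip n (x 0) (x 0) + ip n (y 0) (y 0) = 1"
      and init: "ip n (x 0) (ap n (H 0) (x 0)) + ip n (y 0) (ap n (H 0) (y 0)) = E0" for x y
  proof -
    interpret linear_ramp n A B T x y
      using symA symB T flow unit0 by unfold_locales (simp_all add: H_def)
    define s where "s = (\<lambda>k::nat. real k * T / real m)"
    have s: "s k / T = real k / real m" for k using T by (simp add: s_def)
    \<comment> \<open>Discrete Gronwall inequality: a step multiplies by 1 + \<kappa>/m <= exp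
      (\<kappa>/m) and adds e.\<close>
    have bound: "energy (s k) - E (real k / real m) \<le> exp (\<kappa> * (real k / real m)) * real k * e" if "k \<le> m" for k
      using that
    proof (induction k)
      case 0
      then show ?case using init E0 by (simp add: energy_def s_def H_def)
    next
      case (Suc k)
      have le: "real (Suc k) / real m \<le> 1" "real k / real m \<le> 1" using Suc.prems m0 by simp_all
      have gapk: "gap_at n (K (s k)) (E (real k / real m)) (\<phi> (real k / real m)) g"
        "gap_at n (K (s (Suc k))) (E (real (Suc k) / real m)) (\<phi> (real (Suc k) / real m)) g"
        unfolding s by (rule gap[unfolded H_def]; use le in simp)+
      have sle: "s k \<le> s (Suc k)" using T m0 by (simp add: s_def divide_right_mono)
      have h: "(s (Suc k) - s k) / T = 1 / real m"
        using T m0 by (simp add: s_def field_simps)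
      have "energy (s (Suc k)) - E (real (Suc k) / real m) \<le>
          (1 + \<kappa> * (1 / real m)) * (energy (s k) - E (real k / real m)) + 5 * \<kappa> * \<beta> * (1 / real m)\<^sup>2 + 2 * \<kappa> / T"
        using adiabatic_step[OF sle g gapk] unfolding h \<beta>_def \<kappa>_def .
      also have "\<dots> = (1 + \<kappa> * (1 / real m)) * (energy (s k) - E (real k / real m)) + e"
        by (simp add: e_def T_def power_divide add_divide_distrib)
      also have "\<dots> \<le> exp (\<kappa> * (1 / real m)) * (exp (\<kappa> * (real k / real m)) * real k * e)
          + exp (\<kappa> * (real (Suc k) / real m)) * e"
      proof (rule add_mono)
        have "(1 + \<kappa> * (1 / real m)) * (energy (s k) - E (real k / real m))
            \<le> (1 + \<kappa> * (1 / real m)) * (exp (\<kappa> * (real k / real m)) * real k * e)"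
          using Suc \<kappa> by (intro mult_left_mono) auto
        also have "\<dots> \<le> exp (\<kappa> * (1 / real m)) * (exp (\<kappa> * (real k / real m)) * real k * e)"
          using e by (intro mult_right_mono exp_ge_add_one_self) auto
        finally show "(1 + \<kappa> * (1 / real m)) * (energy (s k) - E (real k / real m))
            \<le> exp (\<kappa> * (1 / real m)) * (exp (\<kappa> * (real k / real m)) * real k * e)" .
        have "1 \<le> exp (\<kappa> * (real (Suc k) / real m))" using \<kappa> by simp
        then show "e \<le> exp (\<kappa> * (real (Suc k) / real m)) * e"
          using mult_right_mono[OF _ e] by fastforce
      qed
      also have "\<dots> = exp (\<kappa> * (real (Suc k) / real m)) * real (Suc k) * e"
      proof -
        have "exp (\<kappa> * (1 / real m)) * exp (\<kappa> * (real k / real m)) = exp (\<kappa> * (real (Suc k) / real m))"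
          by (simp add: add_divide_distrib distrib_left flip: exp_add)
        then show ?thesis by (simp add: algebra_simps)
      qed
      finally show ?case .
    qed
    have sm: "s m = T" using m0 by (simp add: s_def)
    have "energy T - E1 \<le> exp \<kappa> * real m * e"
      using bound[of m] m0 by (simp add: sm E1)
    also have "\<dots> = exp \<kappa> * (5 * \<kappa> * \<beta> + 2 * \<kappa>) / real m"
      using m0 by (simp add: e_def T_def power2_eq_square)
    also have "\<dots> < \<epsilon> * g1"
      using m m0 \<epsilon> gap1(2) by (simp add: field_simps)
    finally have small: "energy T - E1 < g1 * \<epsilon>" by (simp add: mult.commute)
    \<comment> \<open>The gap at the end point bounds the weight outside the span of
      \<open>\<phi>1\<close> by the excess energy over g1.\<close>
    have gp: "g1 * (ip n u u - (ip n \<phi>1 u)\<^sup>2) \<le> ip n u (ap n (H 1) u) - E1 * ip n u u" for u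
      using gap1(1) by (simp add: gap_at_def)
    have "K T = H 1" using T by (simp add: H_def)
    then have "energy T - E1 = (ip n (x T) (ap n (H 1) (x T)) - E1 * ip n (x T) (x T))
        + (ip n (y T) (ap n (H 1) (y T)) - E1 * ip n (y T) (y T))"
      using unit[of T] by (simp add: energy_def algebra_simps flip: distrib_left)
    also have "\<dots> \<ge> g1 * (1 - ((ip n \<phi>1 (x T))\<^sup>2 + (ip n \<phi>1 (y T))\<^sup>2))"
    proof -
      have "g1 * (1 - ((ip n \<phi>1 (x T))\<^sup>2 + (ip n \<phi>1 (y T))\<^sup>2))
          = g1 * (ip n (x T) (x T) - (ip n \<phi>1 (x T))\<^sup>2) + g1 * (ip n (y T) (y T) - (ip n \<phi>1 (y T))\<^sup>2)"
        unfolding unit[of T, symmetric] by (simp add: algebra_simps)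
      then show ?thesis using gp[of "x T"] gp[of "y T"] by linarith
    qed
    finally have "g1 * (1 - ((ip n \<phi>1 (x T))\<^sup>2 + (ip n \<phi>1 (y T))\<^sup>2)) < g1 * \<epsilon>" using small by linarith
    then show ?thesis using gap1(2) by simp
  qed
  then show ?thesis using T by blast
qed

section \<open>Linear differential equations with affine coefficients\<close>

text \<open>Power series coefficients of the solution of z' = (A + t B) z. Comparing coefficients of
  t^(m+1) gives (m + 2) c(m+2) = A c(m+1) + B c(m); the factor t makes the recursion reach back two
  places.\<close>

fun series_coeff :: "nat \<Rightarrow> (nat \<Rightarrow> nat \<Rightarrow> complex) \<Rightarrow> (nat \<Rightarrow> nat \<Rightarrow> complex) \<Rightarrow> (nat \<Rightarrow> complex) \<Rightarrow>
    nat \<Rightarrow> nat \<Rightarrow> complex" where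
  "series_coeff n A B z0 0 k = z0 k"
| "series_coeff n A B z0 (Suc 0) k = (\<Sum>j<n. A k j * z0 j)"
| "series_coeff n A B z0 (Suc (Suc m)) k =
    ((\<Sum>j<n. A k j * series_coeff n A B z0 (Suc m) j) + (\<Sum>j<n. B k j * series_coeff n A B z0 m j))
      / of_nat (m + 2)"

lemma norm_matrix_vector_sum_le:
  fixes A :: "nat \<Rightarrow> nat \<Rightarrow> complex"
  shows "(\<Sum>k<n. norm (\<Sum>j<n. A k j * v j)) \<le> (\<Sum>k<n. \<Sum>j<n. norm (A k j)) * (\<Sum>j<n. norm (v j))"
proof -
  have "(\<Sum>k<n. norm (\<Sum>j<n. A k j * v j)) \<le> (\<Sum>k<n. \<Sum>j<n. norm (A k j) * (\<Sum>i<n. norm (v i)))"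
  proof (intro sum_mono sum_norm_le)
    fix k j assume "j \<in> {..<n}"
    then have "norm (v j) \<le> (\<Sum>i<n. norm (v i))" by (intro member_le_sum) auto
    then show "norm (A k j * v j) \<le> norm (A k j) * (\<Sum>i<n. norm (v i))"
      by (simp add: norm_mult mult_left_mono)
  qed
  then show ?thesis by (simp add: sum_distrib_right)
qed

text \<open>Weighted with R^m, the recursion reads s(m+2) <= (\<alpha> R s(m+1) + \<beta> R^2 s(m))
  / (m + 2), which cannot raise the maximum once m + 2 exceeds \<alpha> R + \<beta> R^2. R is
  arbitrary, so the series converges everywhere.\<close>

lemma series_coeff_bounded:
  assumes R: "R \<ge> 0"
  shows "\<exists>C. \<forall>m. \<forall>k<n. norm (series_coeff n A B z0 m k) * R ^ m \<le> C"
proof -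
  define c where "c = series_coeff n A B z0"
  define s where "s = (\<lambda>m. (\<Sum>k<n. norm (c m k)) * R ^ m)"
  define \<alpha> \<beta> where "\<alpha> = (\<Sum>k<n. \<Sum>j<n. norm (A k j))" and "\<beta> = (\<Sum>k<n. \<Sum>j<n. norm (B k j))"
  have \<alpha>\<beta>: "\<alpha> \<ge> 0" "\<beta> \<ge> 0" by (simp_all add: \<alpha>_def \<beta>_def sum_nonneg)
  have step: "s (Suc (Suc m)) \<le> (\<alpha> * R * s (Suc m) + \<beta> * R\<^sup>2 * s m) / real (m + 2)" for m
  proof -
    have "(\<Sum>k<n. norm (c (Suc (Suc m)) k))
        \<le> (\<Sum>k<n. (norm (\<Sum>j<n. A k j * c (Suc m) j) + norm (\<Sum>j<n. B k j * c m j)) / real (m + 2))"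
      unfolding c_def series_coeff.simps norm_divide norm_of_nat
      by (intro sum_mono divide_right_mono norm_triangle_ineq) simp
    also have "\<dots> = ((\<Sum>k<n. norm (\<Sum>j<n. A k j * c (Suc m) j)) + (\<Sum>k<n. norm (\<Sum>j<n. B k j * c m j))) / real (m + 2)"
      by (simp only: sum.distrib flip: sum_divide_distrib)
    also have "\<dots> \<le> (\<alpha> * (\<Sum>j<n. norm (c (Suc m) j)) + \<beta> * (\<Sum>j<n. norm (c m j))) / real (m + 2)"
      unfolding \<alpha>_def \<beta>_def by (intro divide_right_mono add_mono norm_matrix_vector_sum_le) simp
    finally have "s (Suc (Suc m)) \<le> (\<alpha> * (\<Sum>j<n. norm (c (Suc m) j)) + \<beta> * (\<Sum>j<n. norm (c m j))) / real (m + 2) * R ^ Suc (Suc m)"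
      unfolding s_def using R by (intro mult_right_mono) auto
    then show ?thesis by (simp add: s_def algebra_simps power2_eq_square)
  qed
  obtain M :: nat where M: "\<alpha> * R + \<beta> * R\<^sup>2 \<le> real M" using real_arch_simple by blast
  \<comment> \<open>Beyond index M + 1 the divisor p + 2 is larger than M, so the maximum of the
    initial stretch bounds everything.\<close>
  define C where "C = Max (s ` {..M + 1})"
  have sC: "s m \<le> C" for m
  proof (induction m rule: less_induct)
    case (less m)
    show ?case
    proof (cases "m \<le> M + 1")
      case True
      then show ?thesis unfolding C_def by (intro Max_ge) auto
    next
      case False
      then obtain p where p: "m = Suc (Suc p)" "M \<le> p" by (metis Suc_eq_plus1 Suc_leI Suc_le_D not_less_eq_eq)
      have "0 \<le> s 0" by (simp add: s_def sum_nonneg)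
      also have "s 0 \<le> C" unfolding C_def by (intro Max_ge) auto
      finally have C: "0 \<le> C" .
      have "s m \<le> (\<alpha> * R * s (Suc p) + \<beta> * R\<^sup>2 * s p) / real (p + 2)" using step p by simp
      also have "\<dots> \<le> (\<alpha> * R * C + \<beta> * R\<^sup>2 * C) / real (p + 2)"
        using less.IH[of p] less.IH[of "Suc p"] p(1) \<alpha>\<beta> R by (intro divide_right_mono add_mono mult_left_mono) auto
      also have "\<dots> = (\<alpha> * R + \<beta> * R\<^sup>2) * C / real (p + 2)" by (simp add: algebra_simps)
      also have "\<dots> \<le> real (p + 2) * C / real (p + 2)"
        using M p(2) C by (intro divide_right_mono mult_right_mono) auto
      finally show ?thesis by simp
    qed
  qed
  have "norm (c m k) * R ^ m \<le> C" if "k < n" for m k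
  proof -
    have "norm (c m k) \<le> (\<Sum>k<n. norm (c m k))" using that by (intro member_le_sum) auto
    then have "norm (c m k) * R ^ m \<le> s m" unfolding s_def using R by (intro mult_right_mono) auto
    then show ?thesis using sC[of m] by linarith
  qed
  then show ?thesis unfolding c_def by blast
qed

lemma series_coeff_summable:
  assumes "k < n"
  shows "summable (\<lambda>m. series_coeff n A B z0 m k * t ^ m)"
proof -
  define R where "R = norm t + 1"
  have R: "R > 0" "norm t < R" by (simp_all add: R_def add_nonneg_pos)
  obtain C where C: "\<And>m. norm (series_coeff n A B z0 m k) * R ^ m \<le> C"
    using series_coeff_bounded[of R n A B z0] R assms by auto
  show ?thesis
  proof (rule summable_comparison_test)
    show "summable (\<lambda>m. C * (norm t / R) ^ m)"
      using R by (intro summable_mult summable_geometric) simp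
    have "norm (series_coeff n A B z0 m k * t ^ m) \<le> C * (norm t / R) ^ m" for m
    proof -
      have "norm (series_coeff n A B z0 m k * t ^ m) = norm (series_coeff n A B z0 m k) * R ^ m * (norm t / R) ^ m"
        using R by (simp add: norm_mult norm_power power_divide)
      also have "\<dots> \<le> C * (norm t / R) ^ m" using C R by (intro mult_right_mono) auto
      finally show ?thesis .
    qed
    then show "\<exists>N. \<forall>m\<ge>N. norm (series_coeff n A B z0 m k * t ^ m) \<le> C * (norm t / R) ^ m" by blast
  qed
qed

text \<open>For affine coefficients the formal power series is entire, so termwise differentiation
  gives a global solution without continuation from interval to interval.\<close>

lemma linear_ode_solution:
  fixes A B :: "nat \<Rightarrow> nat \<Rightarrow> complex"
  shows "\<exists>z. (\<forall>k<n. z 0 k = z0 k) \<and>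
    (\<forall>t. \<forall>k<n. ((\<lambda>t. z t k) has_field_derivative (\<Sum>j<n. (A k j + t * B k j) * z t j)) (at t))"
proof -
  define c where "c = series_coeff n A B z0"
  define z where "z = (\<lambda>t k. \<Sum>m. c m k * t ^ m)"
  have sm: "k < n \<Longrightarrow> summable (\<lambda>m. c m k * t ^ m)" for k t
    unfolding c_def by (rule series_coeff_summable)
  have z: "k < n \<Longrightarrow> (\<lambda>m. c m k * t ^ m) sums z t k" for k t
    unfolding z_def by (intro summable_sums sm)
  have "((\<lambda>t. z t k) has_field_derivative (\<Sum>j<n. (A k j + t * B k j) * z t j)) (at t)" if k: "k < n" for k t
  proof -
    \<comment> \<open>Multiplication by t shifts the B part by one index, so it has no term at m =
      0.\<close>
    define b where "b = (\<lambda>m. if m = 0 then 0 else (\<Sum>j<n. B k j * c (m - 1) j) * t ^ m)"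
    have "diffs (\<lambda>m. c m k) m * t ^ m = (\<Sum>j<n. A k j * (c m j * t ^ m)) + b m" for m
    proof (cases m)
      case 0
      then show ?thesis by (simp add: diffs_def c_def b_def)
    next
      case (Suc p)
      have "diffs (\<lambda>m. c m k) m = (\<Sum>j<n. A k j * c m j) + (\<Sum>j<n. B k j * c p j)"
        unfolding diffs_def c_def Suc series_coeff.simps
        by (simp add: field_simps del: of_nat_Suc of_nat_add)
      then show ?thesis by (simp add: b_def Suc distrib_right sum_distrib_right mult.assoc)
    qed
    moreover have "(\<lambda>m. \<Sum>j<n. A k j * (c m j * t ^ m)) sums (\<Sum>j<n. A k j * z t j)"
      by (intro sums_sum sums_mult z) simp
    moreover have "b sums (\<Sum>j<n. t * B k j * z t j)"
    proof -
      have "(\<lambda>m. \<Sum>j<n. t * B k j * (c m j * t ^ m)) sums (\<Sum>j<n. t * B k j * z t j)"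
        by (intro sums_sum sums_mult z) simp
      moreover have "(\<lambda>m. \<Sum>j<n. t * B k j * (c m j * t ^ m)) = (\<lambda>m. b (Suc m))"
        by (simp add: b_def sum_distrib_left mult_ac)
      ultimately show ?thesis using sums_Suc[of b "\<Sum>j<n. t * B k j * z t j"] by (simp add: b_def)
    qed
    ultimately have "(\<lambda>m. diffs (\<lambda>m. c m k) m * t ^ m) sums (\<Sum>j<n. (A k j + t * B k j) * z t j)"
      using sums_add by (fastforce simp: distrib_right sum.distrib)
    then show ?thesis
      using termdiffs_strong_converges_everywhere[of "\<lambda>m. c m k" t] sm[OF k]
      unfolding z_def by (simp add: sums_iff)
  qed
  moreover have "z 0 k = z0 k" for k
    unfolding z_def powser_zero by (simp add: c_def)
  ultimately show ?thesis by blast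
qed

text \<open>The series solution for complex time, restricted to the real line: real and imaginary
  part of -i K (x + i y) are K y and -K x.\<close>

lemma real_flow_exists:
  fixes A B :: "nat \<Rightarrow> nat \<Rightarrow> real"
  shows "\<exists>x y. real_flow n (\<lambda>t i j. A i j + (t / T) * B i j) x y \<and> (\<forall>i<n. x 0 i = x0 i \<and> y 0 i = y0 i)"
proof -
  obtain z where z0: "\<forall>k<n. z 0 k = Complex (x0 k) (y0 k)"
    and z': "\<And>t k. k < n \<Longrightarrow> ((\<lambda>t. z t k) has_field_derivative
      (\<Sum>j<n. (- \<i> * of_real (A k j) + t * (- \<i> * of_real (B k j / T))) * z t j)) (at t)"
    using linear_ode_solution[of n "\<lambda>k. Complex (x0 k) (y0 k)" "\<lambda>k j. - \<i> * of_real (A k j)"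
        "\<lambda>k j. - \<i> * of_real (B k j / T)"] by blast
  define x y where "x = (\<lambda>t k. Re (z (of_real t) k))" and "y = (\<lambda>t k. Im (z (of_real t) k))"
  have "((\<lambda>t. x t k) has_real_derivative ap n (\<lambda>i j. A i j + (t / T) * B i j) (y t) k) (at t) \<and>
     ((\<lambda>t. y t k) has_real_derivative - ap n (\<lambda>i j. A i j + (t / T) * B i j) (x t) k) (at t)"
    if k: "k < n" for t k
  proof -
    define d where "d = (\<Sum>j<n. (- \<i> * of_real (A k j) + of_real t * (- \<i> * of_real (B k j / T))) * z (of_real t) j)"
    have "((\<lambda>t. z t k) has_derivative (\<lambda>h. d * h)) (at (of_real t))"
      using z'[OF k, of "of_real t"] unfolding has_field_derivative_def d_def by simp
    moreover have "(of_real has_derivative (of_real :: real \<Rightarrow> complex)) (at t)"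
      by (rule bounded_linear.has_derivative[OF bounded_linear_of_real has_derivative_ident])
    ultimately have "((\<lambda>t. z (of_real t) k) has_derivative (\<lambda>h. d * of_real h)) (at t)"
      by (rule has_derivative_compose[rotated])
    then have "((\<lambda>t. z (of_real t) k) has_vector_derivative d) (at t)"
      by (simp add: has_vector_derivative_def scaleR_conv_of_real mult.commute)
    moreover have "Re d = ap n (\<lambda>i j. A i j + (t / T) * B i j) (y t) k"
      unfolding d_def ap_def Re_sum y_def by (intro sum.cong) (simp_all add: algebra_simps)
    moreover have "Im d = - ap n (\<lambda>i j. A i j + (t / T) * B i j) (x t) k"
      unfolding d_def ap_def Im_sum x_def sum_negf[symmetric] by (intro sum.cong) (simp_all add: algebra_simps)
    ultimately show ?thesis
      unfolding has_vector_derivative_complex_iff by (simp add: x_def y_def)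
  qed
  moreover have "\<forall>i<n. x 0 i = x0 i \<and> y 0 i = y0 i"
    using z0 by (simp add: x_def y_def)
  ultimately show ?thesis unfolding real_flow_def by blast
qed

section \<open>Matrix entries of the Ising chain\<close>

text \<open>Bit \<open>q\<close> of a basis index belongs to site \<open>N - q\<close>.\<close>

definition spin :: "nat \<Rightarrow> nat \<Rightarrow> real" where
  "spin q i = (if bit i q then - 1 else 1)"

text \<open>The diagonal entry of \<open>ising_H0 N\<close> at index i.\<close>

definition bond :: "nat \<Rightarrow> nat \<Rightarrow> real" where
  "bond N i = (\<Sum>q<N - 1. spin q i * spin (Suc q) i)"

text \<open>The entries of \<open>ising_H1 N\<close>: the adjacency matrix of the N-dimensional
  hypercube.\<close>

definition flips :: "nat \<Rightarrow> nat \<Rightarrow> nat \<Rightarrow> real" where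
  "flips N i j = (\<Sum>q<N. of_bool (j = flip_bit q i))"

lemma less_exp_iff_bits: "i < 2 ^ N \<longleftrightarrow> (\<forall>q\<ge>N. \<not> bit i q)" for i :: nat
proof
  assume "i < 2 ^ N"
  then have "take_bit N i = i" by (rule take_bit_nat_eq_self)
  then show "\<forall>q\<ge>N. \<not> bit i q" by (metis bit_take_bit_iff not_less)
next
  assume high: "\<forall>q\<ge>N. \<not> bit i q"
  have "bit (take_bit N i) q = bit i q" for q
    using high by (cases "q < N") (simp_all add: bit_take_bit_iff)
  then have "take_bit N i = i" by (intro bit_eqI) blast
  then show "i < 2 ^ N" by (simp add: take_bit_nat_eq_self_iff)
qed

lemma eq_if_bits_eq: "i < 2 ^ N \<Longrightarrow> j < 2 ^ N \<Longrightarrow> (\<And>q. q < N \<Longrightarrow> bit i q = bit j q) \<Longrightarrow> i = j" for i j :: nat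
  by (rule bit_eqI) (metis less_exp_iff_bits not_less)

lemma flip_bit_less: "i < 2 ^ N \<Longrightarrow> q < N \<Longrightarrow> flip_bit q i < 2 ^ N" for i :: nat
  by (auto simp: less_exp_iff_bits bit_flip_bit_iff)

lemma site_op_dim:
  assumes "1 \<le> k" "k \<le> N" "A \<in> carrier_mat 2 2"
  shows "site_op N A k \<in> carrier_mat (2 ^ N) (2 ^ N)"
proof -
  have "2 ^ (k - 1) * 2 * 2 ^ (N - k) = (2::nat) ^ N"
    using assms by (simp flip: power_add power_Suc2)
  then show ?thesis using assms by (auto simp: site_op_def tensor_mat_def)
qed

text \<open>Division and remainder by m split an index into the bits above position N - k, that bit,
  and the bits below. The identities on the outer factors force the outer parts of i and j to
  agree.\<close>

lemma site_op_entry: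
  assumes k: "1 \<le> k" "k \<le> N" and A: "A \<in> carrier_mat 2 2" and ij: "i < 2 ^ N" "j < 2 ^ N"
  defines "m \<equiv> 2 ^ (N - k)"
  shows "site_op N A k $$ (i, j) =
    of_bool (i div m div 2 = j div m div 2 \<and> i mod m = j mod m) * A $$ (i div m mod 2, j div m mod 2)"
proof -
  have dims: "2 ^ (k - 1) * 2 * m = 2 ^ N"
    using k by (simp add: m_def flip: power_add power_Suc2)
  have m: "m > 0" by (simp add: m_def)
  have lt: "x div m < 2 ^ (k - 1) * 2" "x div m div 2 < 2 ^ (k - 1)" if "x < 2 ^ N" for x
  proof -
    show 1: "x div m < 2 ^ (k - 1) * 2" using that dims by (simp add: less_mult_imp_div_less)
    then show "x div m div 2 < 2 ^ (k - 1)" by (simp add: less_mult_imp_div_less)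
  qed
  have "site_op N A k $$ (i, j) = tensor_mat (1\<^sub>m (2 ^ (k - 1))) A $$ (i div m, j div m) * 1\<^sub>m m $$ (i mod m, j mod m)"
    unfolding site_op_def using A ij dims
    by (simp add: tensor_mat_def carrier_matD[OF A] flip: m_def)
  also have "tensor_mat (1\<^sub>m (2 ^ (k - 1))) A $$ (i div m, j div m)
      = 1\<^sub>m (2 ^ (k - 1)) $$ (i div m div 2, j div m div 2) * A $$ (i div m mod 2, j div m mod 2)"
    using lt(1)[OF ij(1)] lt(1)[OF ij(2)] by (simp add: tensor_mat_def carrier_matD[OF A])
  finally show ?thesis using lt(2)[OF ij(1)] lt(2)[OF ij(2)] m by simp
qed

lemma div_mod_eq_iff_bits:
  fixes i j :: nat
  shows "i div 2 ^ q div 2 = j div 2 ^ q div 2 \<and> i mod 2 ^ q = j mod 2 ^ q \<longleftrightarrow> (\<forall>p. p \<noteq> q \<longrightarrow> bit i p = bit j p)"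
proof -
  have 1: "x div 2 ^ q div 2 = drop_bit (Suc q) x" "x mod 2 ^ q = take_bit q x" for x :: nat
    by (simp_all only: drop_bit_eq_div take_bit_eq_mod power_Suc2 div_mult2_eq)
  show ?thesis
    unfolding 1
  proof (rule iffI; (intro conjI allI impI)?)
    fix p assume eq: "drop_bit (Suc q) i = drop_bit (Suc q) j \<and> take_bit q i = take_bit q j" and "p \<noteq> q"
    then consider "p < q" | d where "p = Suc q + d" by (metis le_Suc_ex linorder_neqE_nat Suc_leI)
    then show "bit i p = bit j p"
    proof cases
      case 1
      then show ?thesis using eq by (metis bit_take_bit_iff)
    next
      case 2
      have "bit (drop_bit (Suc q) i) d = bit (drop_bit (Suc q) j) d" using eq by simp
      then show ?thesis by (simp only: bit_drop_bit_eq 2 o_def)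
    qed
  next
    assume "\<forall>p. p \<noteq> q \<longrightarrow> bit i p = bit j p"
    then show "drop_bit (Suc q) i = drop_bit (Suc q) j" "take_bit q i = take_bit q j"
      by (auto intro!: bit_eqI simp: bit_drop_bit_eq bit_take_bit_iff)
  qed
qed

lemma div_exp_mod_2: "i div 2 ^ q mod 2 = of_bool (bit i q)" for i :: nat
  by (simp add: bit_iff_odd mod_2_eq_odd)

lemma site_op_pauli_Z:
  assumes "1 \<le> k" "k \<le> N" "i < 2 ^ N" "j < 2 ^ N"
  shows "site_op N pauli_Z k $$ (i, j) = of_real (of_bool (i = j) * spin (N - k) i)"
proof -
  have Z: "pauli_Z \<in> carrier_mat 2 2" by (rule carrier_matI) (simp_all add: pauli_Z_def mat_of_rows_list_def)
  have "bit i p = bit j p" if "\<forall>p. p \<noteq> N - k \<longrightarrow> bit i p = bit j p" "bit i (N - k) = bit j (N - k)" for p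
    using that by metis
  then have "(\<forall>p. p \<noteq> N - k \<longrightarrow> bit i p = bit j p) \<and> bit i (N - k) = bit j (N - k) \<longleftrightarrow> i = j"
    by (auto intro: bit_eqI)
  then show ?thesis
    unfolding site_op_entry[OF assms(1,2) Z assms(3,4)] div_mod_eq_iff_bits div_exp_mod_2
    by (auto simp: pauli_Z_def mat_of_rows_list_def spin_def)
qed

lemma site_op_pauli_X:
  assumes "1 \<le> k" "k \<le> N" "i < 2 ^ N" "j < 2 ^ N"
  shows "site_op N pauli_X k $$ (i, j) = of_bool (j = flip_bit (N - k) i)"
proof -
  have X: "pauli_X \<in> carrier_mat 2 2" by (rule carrier_matI) (simp_all add: pauli_X_def mat_of_rows_list_def)
  have "(\<forall>p. p \<noteq> N - k \<longrightarrow> bit i p = bit j p) \<and> bit i (N - k) \<noteq> bit j (N - k) \<longleftrightarrow> j = flip_bit (N - k) i"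
    unfolding bit_eq_iff[of j] bit_flip_bit_iff by auto metis+
  then show ?thesis
    unfolding site_op_entry[OF assms(1,2) X assms(3,4)] div_mod_eq_iff_bits div_exp_mod_2
    by (auto simp: pauli_X_def mat_of_rows_list_def)
qed

lemma ising_H_dim: "ising_H N J f \<in> carrier_mat (2 ^ N) (2 ^ N)"
  by (simp add: ising_H_def ising_H0_def ising_H1_def)

lemma ising_H_entry:
  assumes ij: "i < 2 ^ N" "j < 2 ^ N"
  shows "ising_H N J f $$ (i, j) = of_real (of_bool (i = j) * (J * bond N i) + J * f * flips N i j)"
proof -
  have Z: "pauli_Z \<in> carrier_mat 2 2" by (rule carrier_matI) (simp_all add: pauli_Z_def mat_of_rows_list_def)
  have ZZ: "(site_op N pauli_Z n * site_op N pauli_Z (n + 1)) $$ (i, j)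
      = of_real (of_bool (i = j) * (spin (N - n) i * spin (N - (n + 1)) i))" if n: "n \<in> {1..N - 1}" for n
  proof -
    have D: "site_op N pauli_Z n \<in> carrier_mat (2 ^ N) (2 ^ N)" "site_op N pauli_Z (n + 1) \<in> carrier_mat (2 ^ N) (2 ^ N)"
      using n by (auto intro!: site_op_dim Z)
    have "(site_op N pauli_Z n * site_op N pauli_Z (n + 1)) $$ (i, j)
        = (\<Sum>l<2 ^ N. site_op N pauli_Z n $$ (i, l) * site_op N pauli_Z (n + 1) $$ (l, j))"
      using D ij by (auto simp: scalar_prod_def atLeast0LessThan carrier_matD[OF D(1)] carrier_matD[OF D(2)])
    also have "\<dots> = (\<Sum>l<2 ^ N. if l = i then of_real (of_bool (i = j) * (spin (N - n) i * spin (N - (n + 1)) i)) else 0)"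
    proof (intro sum.cong refl)
      fix l :: nat assume "l \<in> {..<2 ^ N}"
      have "1 \<le> n" "n \<le> N" "n + 1 \<le> N" using n by auto
      with \<open>l \<in> {..<2 ^ N}\<close> show "site_op N pauli_Z n $$ (i, l) * site_op N pauli_Z (n + 1) $$ (l, j) =
          (if l = i then of_real (of_bool (i = j) * (spin (N - n) i * spin (N - (n + 1)) i)) else 0)"
        using site_op_pauli_Z[of n N i l] site_op_pauli_Z[of "n + 1" N l j] ij by auto
    qed
    also have "\<dots> = of_real (of_bool (i = j) * (spin (N - n) i * spin (N - (n + 1)) i))"
      using ij by simp
    finally show ?thesis .
  qed
  have "ising_H0 N $$ (i, j) = (\<Sum>n = 1..N - 1. of_real (of_bool (i = j) * (spin (N - n) i * spin (N - (n + 1)) i)))"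
    using ij ZZ by (simp add: ising_H0_def)
  also have "\<dots> = (\<Sum>q<N - 1. of_real (of_bool (i = j) * (spin q i * spin (Suc q) i)))"
    \<comment> \<open>Sites count from 1 at the left, bits from 0 at the right: the bond of sites n
      and n + 1 joins bits N - n and N - n - 1, so q = N - 1 - n.\<close>
    by (rule sum.reindex_bij_witness[of _ "\<lambda>q. N - 1 - q" "\<lambda>n. N - 1 - n"]) (auto simp: Suc_diff_Suc mult.commute)
  finally have H0: "ising_H0 N $$ (i, j) = of_real (of_bool (i = j) * bond N i)"
    by (simp add: bond_def sum_distrib_left)
  have "ising_H1 N $$ (i, j) = (\<Sum>n = 1..N. of_bool (j = flip_bit (N - n) i))"
    using ij by (simp add: ising_H1_def site_op_pauli_X)
  also have "\<dots> = (\<Sum>q<N. of_bool (j = flip_bit q i))"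
    by (rule sum.reindex_bij_witness[of _ "\<lambda>q. N - q" "\<lambda>n. N - n"]) auto
  finally have H1: "ising_H1 N $$ (i, j) = of_real (flips N i j)"
    by (simp add: flips_def)
  show ?thesis
    using ij H0 H1 by (simp add: ising_H_def ising_H0_def ising_H1_def algebra_simps)
qed

lemma ising_H_mult_vec:
  assumes "k < 2 ^ N" "v \<in> carrier_vec (2 ^ N)"
  shows "(ising_H N J f *\<^sub>v v) $ k =
    (\<Sum>j<2 ^ N. of_real (of_bool (k = j) * (J * bond N k) + J * f * flips N k j) * v $ j)"
proof -
  have "(ising_H N J f *\<^sub>v v) $ k = (\<Sum>j<2 ^ N. ising_H N J f $$ (k, j) * v $ j)"
    using assms ising_H_dim[of N J f] by (auto simp: scalar_prod_def atLeast0LessThan carrier_matD[OF ising_H_dim])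
  then show ?thesis using assms(1) by (simp add: ising_H_entry)
qed

text \<open>The head of the list is the leftmost factor, hence the most significant bit: prepending
  b adds b * 2 ^ length bs to the index.\<close>

lemma ket_unit_vec:
  assumes "\<forall>b\<in>set bs. b < 2"
  shows "\<exists>v<2 ^ length bs. ket bs = unit_vec (2 ^ length bs) v \<and>
    (\<forall>q<length bs. bit v q \<longleftrightarrow> bs ! (length bs - 1 - q) = 1)"
  using assms
proof (induction bs)
  case Nil
  have "ket [] = unit_vec 1 0" by (intro eq_vecI) auto
  then show ?case by auto
next
  case (Cons b bs)
  define m where "m = (2::nat) ^ length bs"
  from Cons obtain v where v: "v < m" "ket bs = unit_vec m v"
    and bits: "\<And>q. q < length bs \<Longrightarrow> bit v q \<longleftrightarrow> bs ! (length bs - 1 - q) = 1"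
    by (auto simp: m_def)
  have b: "b < 2" using Cons.prems by simp
  have m: "m > 0" by (simp add: m_def)
  have lt: "b * m + v < 2 * m"
  proof -
    have "b * m \<le> 1 * m" using b by (intro mult_right_mono) auto
    then show ?thesis using v(1) by linarith
  qed
  have "ket (b # bs) = unit_vec (2 * m) (b * m + v)"
  proof (rule eq_vecI)
    fix i assume "i < dim_vec (unit_vec (2 * m) (b * m + v) :: complex vec)"
    then have i: "i < 2 * m" by simp
    have "i = b * m + v \<longleftrightarrow> i div m = b \<and> i mod m = v"
    proof
      assume "i div m = b \<and> i mod m = v"
      then show "i = b * m + v" using div_mult_mod_eq[of i m] by simp
    qed (use v(1) m in simp)
    moreover have "i div m < 2" using i by (simp add: less_mult_imp_div_less)
    ultimately show "ket (b # bs) $ i = unit_vec (2 * m) (b * m + v) $ i"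
      using i v b lt m by (auto simp: tensor_vec_def)
  qed (simp add: tensor_vec_def v(2))
  moreover have "bit (b * m + v) q \<longleftrightarrow> (b # bs) ! (length (b # bs) - 1 - q) = 1" if q: "q < length (b # bs)" for q
  proof (cases "q = length bs")
    case True
    have "(b * m + v) div m = b" using v(1) m by simp
    then show ?thesis using b True by (auto simp: bit_iff_odd m_def less_2_cases_iff)
  next
    case False
    then have q: "q < length bs" using q by simp
    then have "bit (b * m + v) q = bit (take_bit (length bs) (b * m + v)) q" by (simp add: bit_take_bit_iff)
    also have "take_bit (length bs) (b * m + v) = v" using v(1) by (simp add: take_bit_eq_mod m_def)
    also have "bit v q \<longleftrightarrow> (b # bs) ! (length (b # bs) - 1 - q) = 1"
    proof -
      have "length (b # bs) - 1 - q = Suc (length bs - 1 - q)" using q by simp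
      then show ?thesis unfolding bits[OF q] by (simp only: nth_Cons_Suc)
    qed
    finally show ?thesis .
  qed
  ultimately show ?case using lt by (auto simp: m_def)
qed

section \<open>Gaps along the ramp\<close>

text \<open>
  The global spin flip \<open>P\<close> acts on basis indices as \<open>cpl\<close>.  \<open>stoq N J s\<close> is \<open>J H\<^sub>0 - s H\<^sub>1\<close> (stoquastic for
  \<open>s \<ge> 0\<close>), and \<open>penalized N J s\<close> is \<open>J H\<^sub>0 - s H\<^sub>1 + 1 - P\<close>.
\<close>

definition cpl :: "nat \<Rightarrow> nat \<Rightarrow> nat" where
  "cpl N i = xor (mask N) i"

definition stoq :: "nat \<Rightarrow> real \<Rightarrow> real \<Rightarrow> nat \<Rightarrow> nat \<Rightarrow> real" where
  "stoq N J s i j = of_bool (i = j) * (J * bond N i) - s * flips N i j"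

definition penalized :: "nat \<Rightarrow> real \<Rightarrow> real \<Rightarrow> nat \<Rightarrow> nat \<Rightarrow> real" where
  "penalized N J s i j = stoq N J s i j + of_bool (i = j) - of_bool (j = cpl N i)"

section \<open>Bit arithmetic of single flips and of the global flip\<close>

lemma bit_cpl: "bit (cpl N i) q \<longleftrightarrow> (q < N) \<noteq> bit i q"
  by (simp add: cpl_def bit_xor_iff bit_mask_iff)

lemma cpl_less: "i < 2 ^ N \<Longrightarrow> cpl N i < 2 ^ N"
  by (auto simp: less_exp_iff_bits bit_cpl)

lemma cpl_cpl [simp]: "cpl N (cpl N i) = i"
  by (rule bit_eqI) (auto simp: bit_cpl)

lemma cpl_eq_iff: "cpl N i = j \<longleftrightarrow> i = cpl N j"
  by auto

lemma cpl_neq: "N > 0 \<Longrightarrow> cpl N i \<noteq> i"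
  using bit_cpl[of N i 0] by auto

lemma flip_bit_flip_bit [simp]: "flip_bit q (flip_bit q i) = i" for i :: nat
  by (rule bit_eqI) (auto simp: bit_flip_bit_iff)

lemma flip_bit_neq: "flip_bit q i \<noteq> i" for i :: nat
proof
  assume "flip_bit q i = i"
  then have "bit (flip_bit q i) q = bit i q" by simp
  then show False by (simp add: bit_flip_bit_iff)
qed

lemma cpl_flip_bit: "cpl N (flip_bit q i) = flip_bit q (cpl N i)"
  by (rule bit_eqI) (auto simp: bit_flip_bit_iff bit_cpl)

lemma flips_sym: "flips N i j = flips N j i"
proof -
  have "j = flip_bit q i \<longleftrightarrow> i = flip_bit q j" for q by auto
  then show ?thesis by (simp add: flips_def)
qed

lemma flips_cpl: "flips N (cpl N i) (cpl N j) = flips N i j"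
proof -
  have "cpl N j = flip_bit q (cpl N i) \<longleftrightarrow> j = flip_bit q i" for q
    unfolding cpl_flip_bit[symmetric] by (metis cpl_cpl)
  then show ?thesis by (simp add: flips_def)
qed

lemma flips_nonneg: "0 \<le> flips N i j"
  by (simp add: flips_def sum_nonneg)

lemma flips_flip_bit: "q < N \<Longrightarrow> 1 \<le> flips N i (flip_bit q i)"
proof -
  assume "q < N"
  then have "of_bool (flip_bit q i = flip_bit q i) \<le> flips N i (flip_bit q i)"
    unfolding flips_def by (intro member_le_sum[where f = "\<lambda>p. of_bool (flip_bit q i = flip_bit p i)"]) auto
  then show ?thesis by simp
qed

lemma spin_sq [simp]: "spin q i * spin q i = 1"
  by (simp add: spin_def)

lemma spin_cpl: "q < N \<Longrightarrow> spin q (cpl N i) = - spin q i"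
  by (simp add: spin_def bit_cpl)

lemma spin_flip_bit: "spin p (flip_bit q i) = (if p = q then - 1 else 1) * spin p i"
  by (auto simp: spin_def bit_flip_bit_iff)

lemma bond_cpl: "bond N (cpl N i) = bond N i"
  unfolding bond_def by (intro sum.cong) (auto simp: spin_cpl)

lemma sum_cpl: "(\<Sum>i<2 ^ N. f (cpl N i)) = (\<Sum>i<2 ^ N. f i)"
  by (rule sum.reindex_bij_witness[of _ "cpl N" "cpl N"]) (auto intro: cpl_less)

lemma stoq_sym: "symm n (stoq N J s)"
  by (auto simp: symm_def stoq_def flips_sym)

lemma penalized_sym: "symm n (penalized N J s)"
proof -
  have "j = cpl N i \<longleftrightarrow> i = cpl N j" for i j by auto
  then show ?thesis
    using stoq_sym[of n N J s] by (auto simp: symm_def penalized_def)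
qed

lemma stoq_cpl: "stoq N J s (cpl N i) (cpl N j) = stoq N J s i j"
proof -
  have "cpl N i = cpl N j \<longleftrightarrow> i = j" by (metis cpl_cpl)
  then show ?thesis by (simp add: stoq_def bond_cpl flips_cpl)
qed

lemma ap_cpl:
  assumes "\<And>i j. M (cpl N i) (cpl N j) = M i j"
  shows "ap (2 ^ N) M u (cpl N i) = ap (2 ^ N) M (\<lambda>i. u (cpl N i)) i"
proof -
  have "ap (2 ^ N) M u (cpl N i) = (\<Sum>j<2 ^ N. M (cpl N i) (cpl N j) * u (cpl N j))"
    unfolding ap_def by (rule sum_cpl[symmetric])
  then show ?thesis by (simp add: assms ap_def)
qed

lemma penalized_cpl: "penalized N J s (cpl N i) (cpl N j) = penalized N J s i j"
proof -
  have "cpl N i = cpl N j \<longleftrightarrow> i = j" "cpl N j = cpl N (cpl N i) \<longleftrightarrow> j = cpl N i" by (metis cpl_cpl)+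
  then show ?thesis unfolding penalized_def stoq_cpl by simp
qed

lemma ap_penalized:
  assumes "i < 2 ^ N"
  shows "ap (2 ^ N) (penalized N J s) u i = ap (2 ^ N) (stoq N J s) u i + u i - u (cpl N i)"
proof -
  have "(\<Sum>j<2 ^ N. of_bool (i = j) * u j) = (\<Sum>j<2 ^ N. if i = j then u j else 0)"
    "(\<Sum>j<2 ^ N. of_bool (j = cpl N i) * u j) = (\<Sum>j<2 ^ N. if j = cpl N i then u j else 0)"
    by (intro sum.cong; simp)+
  then show ?thesis
    using assms cpl_less[OF assms] by (simp add: ap_def penalized_def algebra_simps sum.distrib sum_subtractf)
qed

text \<open>Since P is a symmetric involution, 1 - P is half its own square, so the penalty is |u -
  P u|^2 / 2: nonnegative, and zero on even vectors.\<close>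

lemma ip_penalized:
  "ip (2 ^ N) u (ap (2 ^ N) (penalized N J s) u) =
   ip (2 ^ N) u (ap (2 ^ N) (stoq N J s) u) + (\<Sum>i<2 ^ N. (u i - u (cpl N i))\<^sup>2) / 2"
proof -
  have "ip (2 ^ N) u (ap (2 ^ N) (penalized N J s) u)
      = ip (2 ^ N) u (\<lambda>i. (ap (2 ^ N) (stoq N J s) u i + u i) - u (cpl N i))"
    by (rule ip_cong) (simp_all add: ap_penalized)
  moreover have "(\<Sum>i<2 ^ N. (u i - u (cpl N i))\<^sup>2)
      = 2 * ip (2 ^ N) u u - 2 * ip (2 ^ N) u (\<lambda>i. u (cpl N i))"
  proof -
    have "(\<Sum>i<2 ^ N. (u i - u (cpl N i))\<^sup>2)
        = (\<Sum>i<2 ^ N. u i * u i) + (\<Sum>i<2 ^ N. u (cpl N i) * u (cpl N i)) - 2 * (\<Sum>i<2 ^ N. u i * u (cpl N i))"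
      by (simp add: power2_eq_square algebra_simps sum.distrib sum_subtractf sum_distrib_left)
    then show ?thesis by (simp add: ip_def sum_cpl[of "\<lambda>i. u i * u i"])
  qed
  ultimately show ?thesis by (simp add: lin_simps)
qed

text \<open>The hypercube is connected: induction on k, where j agrees with i from bit k on,
  flipping the highest bit in which they differ.\<close>

lemma closed_under_flips:
  fixes Z :: "nat \<Rightarrow> bool"
  assumes flip: "\<forall>i<2 ^ N. \<forall>q<N. Z i \<longrightarrow> Z (flip_bit q i)"
    and i: "i < 2 ^ N" "Z i" and j: "j < 2 ^ N"
  shows "Z j"
proof -
  have "Z j" if "j < 2 ^ N" "\<forall>q\<ge>k. bit j q = bit i q" for j k
    using that
  proof (induction k arbitrary: j)
    case 0
    then have "j = i" by (intro bit_eqI) simp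
    then show ?case using i by simp
  next
    case (Suc k)
    show ?case
    proof (cases "bit j k = bit i k")
      case True
      then have "\<forall>q\<ge>k. bit j q = bit i q" using Suc.prems(2) by (metis le_antisym not_less_eq_eq)
      then show ?thesis using Suc by blast
    next
      case False
      then have k: "k < N" using Suc.prems(1) i(1) by (metis less_exp_iff_bits not_less)
      have "\<forall>q\<ge>k. bit (flip_bit k j) q = bit i q"
      proof (intro allI impI)
        fix q assume "k \<le> q"
        then show "bit (flip_bit k j) q = bit i q"
          using Suc.prems(2) False by (cases "q = k") (auto simp: bit_flip_bit_iff)
      qed
      then have "Z (flip_bit k j)"
        using Suc.IH flip_bit_less[OF Suc.prems(1) k] by blast
      then show ?thesis using flip flip_bit_less[OF Suc.prems(1) k] k by force
    qed
  qed
  from this[of j N] show ?thesis using i j by (simp add: less_exp_iff_bits)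
qed

text \<open>Irreducibility is the connectedness of the hypercube. One triple serves both matrices:
  the penalty vanishes on the even \<phi> and can only raise the form elsewhere.\<close>

lemma transverse_gap:
  assumes s: "s > 0"
  shows "\<exists>E \<phi> g. g > 0 \<and> gap_at (2 ^ N) (stoq N J s) E \<phi> g \<and> gap_at (2 ^ N) (penalized N J s) E \<phi> g \<and>
    (\<forall>i<2 ^ N. \<phi> (cpl N i) = \<phi> i)"
proof -
  have off: "stoq N J s i j \<le> 0" if "i \<noteq> j" for i j
    using that s flips_nonneg[of N i j] by (simp add: stoq_def)
  have irr: "\<forall>j<2 ^ N. Z j"
    if closed: "\<And>i j. i < 2 ^ N \<Longrightarrow> j < 2 ^ N \<Longrightarrow> i \<noteq> j \<Longrightarrow> stoq N J s i j < 0 \<Longrightarrow> Z i \<Longrightarrow> Z j"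
      and i: "i < 2 ^ N" "Z i" for Z i
  proof (intro allI impI)
    fix j :: nat assume "j < 2 ^ N"
    show "Z j"
    proof (rule closed_under_flips[where Z = Z, OF _ i(1) _ \<open>j < 2 ^ N\<close>]; (intro i(2))?; intro allI impI)
      fix i q assume iq: "i < 2 ^ N" "q < N" "Z i"
      have "stoq N J s i (flip_bit q i) < 0"
        using flips_flip_bit[OF iq(2), of i] s flip_bit_neq[of q i]
        by (simp add: stoq_def mult_pos_pos less_le_trans[of 0 1])
      then show "Z (flip_bit q i)"
        using closed[OF iq(1) flip_bit_less[OF iq(1,2)] flip_bit_neq[symmetric]] iq(3) by blast
    qed
  qed
  have "\<exists>E \<phi> g. g > 0 \<and> gap_at (2 ^ N) (stoq N J s) E \<phi> g \<and> (\<forall>i<2 ^ N. \<phi> i > 0)"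
  proof (rule Perron_Frobenius_gap[OF stoq_sym])
    show "(2::nat) ^ N > 0" by simp
    show "stoq N J s i j \<le> 0" if "i \<noteq> j" for i j using that by (rule off)
    fix Z :: "nat \<Rightarrow> bool" and i
    assume "\<And>i j. i < 2 ^ N \<Longrightarrow> j < 2 ^ N \<Longrightarrow> i \<noteq> j \<Longrightarrow> stoq N J s i j < 0 \<Longrightarrow> Z i \<Longrightarrow> Z j" "i < 2 ^ N" "Z i"
    then show "\<forall>j<2 ^ N. Z j" by (rule irr)
  qed
  then obtain E \<phi> g where g: "g > 0" and gap: "gap_at (2 ^ N) (stoq N J s) E \<phi> g" and pos: "\<forall>i<2 ^ N. \<phi> i > 0"
    by blast
  have unit: "ip (2 ^ N) \<phi> \<phi> = 1" and eig: "\<forall>i<2 ^ N. ap (2 ^ N) (stoq N J s) \<phi> i = E * \<phi> i"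
    and gp: "\<And>u. g * (ip (2 ^ N) u u - (ip (2 ^ N) \<phi> u)\<^sup>2) \<le> ip (2 ^ N) u (ap (2 ^ N) (stoq N J s) u) - E * ip (2 ^ N) u u"
    using gap by (auto simp: gap_at_def)
  \<comment> \<open>The flipped \<phi> has the same energy, so it is c * \<phi> by simplicity;
    flipping twice gives c^2 = 1, and positivity of \<phi> leaves c = 1.\<close>
  have sym\<phi>: "\<forall>i<2 ^ N. \<phi> (cpl N i) = \<phi> i"
  proof -
    define u where "u = (\<lambda>i. \<phi> (cpl N i))"
    have "\<forall>i<2 ^ N. ap (2 ^ N) (stoq N J s) u i = E * u i"
      unfolding u_def ap_cpl[of "stoq N J s" N, OF stoq_cpl, symmetric] using eig cpl_less by blast
    from ip_eigenvector[OF this, of u]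
    have "ip (2 ^ N) u (ap (2 ^ N) (stoq N J s) u) \<le> E * ip (2 ^ N) u u" by simp
    from gap_at_minimizer[OF gap g this] obtain c where c: "\<And>i. i < 2 ^ N \<Longrightarrow> \<phi> (cpl N i) = c * \<phi> i"
      unfolding u_def by blast
    have c1: "c = 1" if "p > 0" "q > 0" "q = c * p" "p = c * q" for p q
    proof -
      have "c > 0" using that(1-3) by (simp add: zero_less_mult_iff)
      have "p = c * (c * p)" using that(4) unfolding that(3) .
      then have "p * (c * c) = p * 1" by (simp only: mult_ac mult_1)
      then have "c * c = 1" using that(1) by simp
      then show "c = 1" using \<open>c > 0\<close> by (auto simp: square_eq_1_iff)
    qed
    have 0: "(0::nat) < 2 ^ N" by simp
    have "\<phi> 0 > 0" "\<phi> (cpl N 0) > 0" using pos 0 cpl_less[OF 0] by blast+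
    moreover have "\<phi> (cpl N (cpl N 0)) = c * \<phi> (cpl N 0)" by (rule c[OF cpl_less[OF 0]])
    ultimately have "c = 1" using c1[OF _ _ c[OF 0]] unfolding cpl_cpl by blast
    then show ?thesis using c by simp
  qed
  have "gap_at (2 ^ N) (penalized N J s) E \<phi> g"
    unfolding gap_at_def
  proof (intro conjI allI impI)
    fix i :: nat assume "i < 2 ^ N"
    then show "ap (2 ^ N) (penalized N J s) \<phi> i = E * \<phi> i"
      using eig sym\<phi> by (simp add: ap_penalized)
  next
    fix u :: "nat \<Rightarrow> real"
    have "0 \<le> (\<Sum>i<2 ^ N. (u i - u (cpl N i))\<^sup>2)" by (intro sum_nonneg) simp
    then show "g * (ip (2 ^ N) u u - (ip (2 ^ N) \<phi> u)\<^sup>2)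
        \<le> ip (2 ^ N) u (ap (2 ^ N) (penalized N J s) u) - E * ip (2 ^ N) u u"
      using gp[of u] unfolding ip_penalized by linarith
  qed (rule unit)
  then show ?thesis using g gap sym\<phi> by blast
qed

text \<open>The GHZ state in the gauged frame, always with a plus sign; the relative sign of the
  target comes back through the gauge.\<close>

definition cat_state :: "nat \<Rightarrow> nat \<Rightarrow> nat \<Rightarrow> real" where
  "cat_state N w i = of_bool (i = w \<or> i = cpl N w) / sqrt 2"

lemma sum_cat_state:
  fixes h :: "nat \<Rightarrow> real"
  assumes "N > 0" "w < 2 ^ N"
  shows "(\<Sum>i<2 ^ N. of_bool (i = w \<or> i = cpl N w) * h i) = h w + h (cpl N w)"
proof -
  have "(\<Sum>i<2 ^ N. of_bool (i = w \<or> i = cpl N w) * h i) = (\<Sum>i\<in>{w, cpl N w}. h i)"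
    using assms cpl_less[OF assms(2)] by (intro sum.mono_neutral_cong_right) auto
  then show ?thesis using cpl_neq[OF assms(1), of w] by simp
qed

lemma ip_cat_state:
  assumes "N > 0" "w < 2 ^ N"
  shows "ip (2 ^ N) (cat_state N w) u = (u w + u (cpl N w)) / sqrt 2"
  using sum_cat_state[OF assms, of u]
  by (simp add: ip_def cat_state_def flip: sum_divide_distrib)

text \<open>The bonds determine a configuration up to the global flip, so i differs from w in at
  least one bond. All bonds of w are minimal, and a broken one costs 2 |J|.\<close>

lemma bond_gap:
  assumes N: "N \<ge> 2" and w: "w < 2 ^ N" and min: "\<forall>q<N - 1. J * (spin q w * spin (Suc q) w) = - \<bar>J\<bar>"
    and i: "i < 2 ^ N" "i \<noteq> w" "i \<noteq> cpl N w" and J: "J \<noteq> 0"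
  shows "J * bond N w + 2 * \<bar>J\<bar> \<le> J * bond N i"
proof -
  have val: "spin q j = 1 \<or> spin q j = - 1" for q j by (simp add: spin_def)
  have bond_val: "J * (spin q i * spin (Suc q) i) = \<bar>J\<bar> \<or> J * (spin q i * spin (Suc q) i) = - \<bar>J\<bar>" for q
    using val[of q i] val[of "Suc q" i] by (auto simp: abs_if)
  have "\<exists>q<N - 1. J * (spin q i * spin (Suc q) i) \<noteq> - \<bar>J\<bar>"
  proof (rule ccontr)
    assume "\<not> ?thesis"
    then have eq: "spin q i * spin (Suc q) i = spin q w * spin (Suc q) w" if "q < N - 1" for q
      using min that J by (metis mult_cancel_left)
    \<comment> \<open>Equal bonds mean that both configurations change sign from q to q + 1 or
      neither does, so their relative spin is constant along the chain.\<close>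
    have const: "spin q i * spin q w = spin 0 i * spin 0 w" if "q < N" for q
      using that
    proof (induction q)
      case (Suc q)
      then have "spin q i * spin (Suc q) i = spin q w * spin (Suc q) w" using eq by simp
      then have "spin (Suc q) i * spin (Suc q) w = spin q i * spin q w"
        using val[of q i] val[of q w] val[of "Suc q" i] val[of "Suc q" w] by auto
      then show ?case using Suc by simp
    qed simp
    consider "spin 0 i * spin 0 w = 1" | "spin 0 i * spin 0 w = - 1"
      using val[of 0 i] val[of 0 w] by auto
    then show False
    proof cases
      case 1
      have "i = w"
      proof (rule eq_if_bits_eq[OF i(1) w])
        fix q assume "q < N"
        then show "bit i q = bit w q" using const[of q] 1 by (auto simp: spin_def split: if_splits)
      qed
      then show False using i by simp
    next
      case 2
      have "i = cpl N w"
      proof (rule eq_if_bits_eq[OF i(1) cpl_less[OF w]])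
        fix q assume "q < N"
        then show "bit i q = bit (cpl N w) q"
          using const[of q] 2 by (auto simp: spin_def bit_cpl split: if_splits)
      qed
      then show False using i by simp
    qed
  qed
  then obtain p where p: "p < N - 1" "J * (spin p i * spin (Suc p) i) = \<bar>J\<bar>" using bond_val by blast
  define D where "D = (\<lambda>q. J * (spin q i * spin (Suc q) i) - J * (spin q w * spin (Suc q) w))"
  have "D p \<le> (\<Sum>q<N - 1. D q)"
  proof (intro member_le_sum)
    fix q assume "q \<in> {..<N - 1} - {p}"
    then show "0 \<le> D q" using bond_val[of q] min by (auto simp: D_def)
  qed (use p in auto)
  moreover have "D p = 2 * \<bar>J\<bar>" using p min by (simp add: D_def)
  moreover have "(\<Sum>q<N - 1. D q) = J * bond N i - J * bond N w"
    by (simp add: D_def bond_def sum_subtractf sum_distrib_left)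
  ultimately show ?thesis by simp
qed

lemma classical_gap:
  assumes N: "N \<ge> 2" and w: "w < 2 ^ N" and min: "\<forall>q<N - 1. J * (spin q w * spin (Suc q) w) = - \<bar>J\<bar>"
    and J: "J \<noteq> 0"
  shows "\<exists>g>0. gap_at (2 ^ N) (penalized N J 0) (J * bond N w) (cat_state N w) g"
proof -
  \<comment> \<open>2 |J| is the cost of a broken bond. The odd combination of w and w' is lifted by
    the penalty alone, by 2, of which 1 suffices.\<close>
  define g where "g = min 1 (2 * \<bar>J\<bar>)"
  have g: "g > 0" "g \<le> 1" "g \<le> 2 * \<bar>J\<bar>" using J by (simp_all add: g_def)
  have N0: "N > 0" using N by simp
  define w' where "w' = cpl N w"
  have w': "w' < 2 ^ N" "w' \<noteq> w" using cpl_less[OF w] cpl_neq[OF N0] by (auto simp: w'_def)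
  have ap0: "ap (2 ^ N) (stoq N J 0) u i = J * bond N i * u i" if "i < 2 ^ N" for u i
  proof -
    have "ap (2 ^ N) (stoq N J 0) u i = (\<Sum>j<2 ^ N. if i = j then J * bond N i * u j else 0)"
      unfolding ap_def stoq_def by (intro sum.cong) auto
    then show ?thesis using that by simp
  qed
  have "gap_at (2 ^ N) (penalized N J 0) (J * bond N w) (cat_state N w) g"
    unfolding gap_at_def
  proof (intro conjI allI impI)
    show "ip (2 ^ N) (cat_state N w) (cat_state N w) = 1"
      unfolding ip_cat_state[OF N0 w] by (simp add: cat_state_def)
  next
    fix i :: nat assume i: "i < 2 ^ N"
    show "ap (2 ^ N) (penalized N J 0) (cat_state N w) i = J * bond N w * cat_state N w i"
    proof -
      have "cat_state N w (cpl N i) = cat_state N w i" by (auto simp: cat_state_def cpl_eq_iff)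
      moreover have "bond N i = bond N w \<or> cat_state N w i = 0"
        by (auto simp: cat_state_def bond_cpl)
      ultimately show ?thesis by (auto simp: ap_penalized[OF i] ap0[OF i])
    qed
  next
    fix u :: "nat \<Rightarrow> real"
    define a where "a = (\<lambda>i. J * bond N i - J * bond N w)"
    define R where "R = {..<2 ^ N} - {w, w'}"
    have split: "(\<Sum>i<2 ^ N. h i) = h w + h w' + (\<Sum>i\<in>R. h i)" for h :: "nat \<Rightarrow> real"
    proof -
      have "(\<Sum>i<2 ^ N. h i) = (\<Sum>i\<in>{w, w'}. h i) + (\<Sum>i\<in>R. h i)"
        unfolding R_def using w w' by (subst add.commute, intro sum.subset_diff) auto
      then show ?thesis using w' by simp
    qed
    have uu: "ip (2 ^ N) u u = (u w)\<^sup>2 + (u w')\<^sup>2 + (\<Sum>i\<in>R. (u i)\<^sup>2)"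
      using split[of "\<lambda>i. u i * u i"] by (simp add: ip_def power2_eq_square)
    have "g * (ip (2 ^ N) u u - (ip (2 ^ N) (cat_state N w) u)\<^sup>2) = g * ((u w - u w')\<^sup>2 / 2) + (\<Sum>i\<in>R. g * (u i)\<^sup>2)"
      unfolding uu ip_cat_state[OF N0 w] w'_def[symmetric]
      by (simp add: power_divide sum_distrib_left[symmetric] field_simps power2_eq_square)
    also have "\<dots> \<le> (u w - u w')\<^sup>2 + (\<Sum>i\<in>R. a i * (u i)\<^sup>2)"
    proof (intro add_mono sum_mono mult_right_mono)
      have "g * ((u w - u w')\<^sup>2 / 2) \<le> 1 * ((u w - u w')\<^sup>2 / 2)" using g by (intro mult_right_mono) auto
      then show "g * ((u w - u w')\<^sup>2 / 2) \<le> (u w - u w')\<^sup>2"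
        using zero_le_power2[of "u w - u w'"] by linarith
      fix i assume "i \<in> R"
      then show "g \<le> a i"
        using bond_gap[OF N w min _ _ _ J, of i] g by (auto simp: R_def w'_def a_def)
    qed simp
    also have "\<dots> \<le> (\<Sum>i<2 ^ N. (u i - u (cpl N i))\<^sup>2) / 2 + (\<Sum>i<2 ^ N. a i * (u i)\<^sup>2)"
    proof (intro add_mono)
      \<comment> \<open>The pair occurs twice, at i = w and at i = w', which makes up for the
        division by 2.\<close>
      have "(\<Sum>i<2 ^ N. (u i - u (cpl N i))\<^sup>2) \<ge> (u w - u w')\<^sup>2 + (u w' - u w)\<^sup>2"
        unfolding split by (simp add: w'_def sum_nonneg)
      then show "(u w - u w')\<^sup>2 \<le> (\<Sum>i<2 ^ N. (u i - u (cpl N i))\<^sup>2) / 2"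
        by (simp add: power2_commute[of "u w'"])
      show "(\<Sum>i\<in>R. a i * (u i)\<^sup>2) \<le> (\<Sum>i<2 ^ N. a i * (u i)\<^sup>2)"
        unfolding split[of "\<lambda>i. a i * (u i)\<^sup>2"] by (simp add: a_def w'_def bond_cpl)
    qed
    also have "\<dots> = ip (2 ^ N) u (ap (2 ^ N) (penalized N J 0) u) - J * bond N w * ip (2 ^ N) u u"
    proof -
      have "ip (2 ^ N) u (ap (2 ^ N) (stoq N J 0) u) = (\<Sum>i<2 ^ N. J * bond N i * (u i)\<^sup>2)"
        unfolding ip_def by (intro sum.cong) (auto simp: ap0 power2_eq_square)
      then show ?thesis
        unfolding ip_penalized by (simp add: a_def ip_def power2_eq_square algebra_simps sum_subtractf sum_distrib_left)
    qed
    finally show "g * (ip (2 ^ N) u u - (ip (2 ^ N) (cat_state N w) u)\<^sup>2)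
        \<le> ip (2 ^ N) u (ap (2 ^ N) (penalized N J 0) u) - J * bond N w * ip (2 ^ N) u u" .
  qed
  then show ?thesis using g(1) by blast
qed

text \<open>The difference of a solution and its flipped image solves the same equation and starts
  at 0; norm conservation keeps it there.\<close>

lemma real_flow_cpl:
  assumes flow: "real_flow (2 ^ N) K x y" and sym: "\<And>t. symm (2 ^ N) (K t)"
    and K: "\<And>t i j. K t (cpl N i) (cpl N j) = K t i j"
    and init: "\<forall>i<2 ^ N. x 0 (cpl N i) = x 0 i \<and> y 0 (cpl N i) = y 0 i"
  shows "\<forall>i<2 ^ N. x t (cpl N i) = x t i \<and> y t (cpl N i) = y t i"
proof -
  define u v where "u = (\<lambda>t i. x t i - x t (cpl N i))" and "v = (\<lambda>t i. y t i - y t (cpl N i))"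
  have "real_flow (2 ^ N) K u v"
    unfolding real_flow_def
  proof (intro allI impI)
    fix t and i :: nat assume i: "i < 2 ^ N"
    have d: "((\<lambda>t. x t j) has_real_derivative ap (2 ^ N) (K t) (y t) j) (at t)"
      "((\<lambda>t. y t j) has_real_derivative - ap (2 ^ N) (K t) (x t) j) (at t)" if "j < 2 ^ N" for j
      using flow that unfolding real_flow_def by simp_all
    have "((\<lambda>t. u t i) has_real_derivative ap (2 ^ N) (K t) (y t) i - ap (2 ^ N) (K t) (y t) (cpl N i)) (at t)"
      "((\<lambda>t. v t i) has_real_derivative - ap (2 ^ N) (K t) (x t) i - (- ap (2 ^ N) (K t) (x t) (cpl N i))) (at t)"
      unfolding u_def v_def by (intro DERIV_diff d i cpl_less[OF i])+
    then show "((\<lambda>t. u t i) has_real_derivative ap (2 ^ N) (K t) (v t) i) (at t) \<and>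
        ((\<lambda>t. v t i) has_real_derivative - ap (2 ^ N) (K t) (u t) i) (at t)"
      unfolding ap_cpl[of "K t" N, OF K] by (simp add: u_def v_def ap_diff)
  qed
  from real_flow_norm_conserved[OF this sym, of t]
  have "ip (2 ^ N) (u t) (u t) + ip (2 ^ N) (v t) (v t) = ip (2 ^ N) (u 0) (u 0) + ip (2 ^ N) (v 0) (v 0)" .
  moreover have "ip (2 ^ N) (u 0) (u 0) = 0" "ip (2 ^ N) (v 0) (v 0) = 0"
    using init by (simp_all add: ip_eq_0 u_def v_def)
  ultimately have "ip (2 ^ N) (u t) (u t) = 0" "ip (2 ^ N) (v t) (v t) = 0"
    using ip_nonneg[of "2 ^ N" "u t"] ip_nonneg[of "2 ^ N" "v t"] by linarith+
  then show ?thesis by (simp add: ip_eq_0 u_def v_def)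
qed

section \<open>Reachability\<close>

text \<open>The state x + i y of the stoquastic frame, carried back to the original frame by the
  diagonal matrix of the signs \<sigma>.\<close>

definition gauged_vec :: "nat \<Rightarrow> (nat \<Rightarrow> real) \<Rightarrow> (nat \<Rightarrow> real) \<Rightarrow> (nat \<Rightarrow> real) \<Rightarrow> complex vec" where
  "gauged_vec N \<sigma> x y = vec (2 ^ N) (\<lambda>i. of_real (\<sigma> i) * Complex (x i) (y i))"

lemma gauged_vec_carrier [simp]: "gauged_vec N \<sigma> x y \<in> carrier_vec (2 ^ N)"
  by (simp add: gauged_vec_def)

text \<open>
  If \<open>J f > 0\<close>, conjugation with \<open>Z\<^sub>1 \<cdots> Z\<^sub>N\<close> reverses the sign of the transverse field.
\<close>

lemma sign_gauge_exists:
  fixes J f0 :: real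
  assumes "J * f0 \<noteq> 0"
  shows "\<exists>\<sigma>. (\<forall>i. \<sigma> i * \<sigma> i = 1) \<and> (\<forall>q<N. \<forall>i. J * f0 * (\<sigma> i * \<sigma> (flip_bit q i)) = - \<bar>J * f0\<bar>) \<and>
    (\<forall>i. \<sigma> (cpl N i) = (if J * f0 < 0 then 1 else (- 1) ^ N) * \<sigma> i)"
proof (cases "J * f0 < 0")
  case True
  then show ?thesis by (intro exI[of _ "\<lambda>_. 1 :: real"]) simp
next
  case False
  \<comment> \<open>A single flip changes one factor of the product, the global flip all N of them;
    this is where the parity of N enters.\<close>
  define \<sigma> where "\<sigma> = (\<lambda>i. \<Prod>q<N. spin q i)"
  have sq: "\<sigma> i * \<sigma> i = 1" for i
    by (simp add: \<sigma>_def flip: prod.distrib)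
  have flip: "\<sigma> (flip_bit q i) = - \<sigma> i" if "q < N" for q i
  proof -
    have "\<sigma> (flip_bit q i) = (\<Prod>p<N. if p = q then - 1 else 1) * \<sigma> i"
      unfolding \<sigma>_def spin_flip_bit by (rule prod.distrib)
    then show ?thesis using that by (simp add: prod.delta)
  qed
  have cpl: "\<sigma> (cpl N i) = (- 1) ^ N * \<sigma> i" for i
  proof -
    have "\<sigma> (cpl N i) = (\<Prod>q<N. - 1 * spin q i)"
      unfolding \<sigma>_def by (intro prod.cong) (auto simp: spin_cpl)
    also have "\<dots> = (- 1) ^ N * \<sigma> i" unfolding \<sigma>_def prod.distrib by simp
    finally show ?thesis .
  qed
  show ?thesis
    using False assms sq flip cpl by (intro exI[of _ \<sigma>]) (simp add: sq)
qed

text \<open>The gauge commutes with the diagonal part, and a flip entry acquires \<sigma> k *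
  \<sigma> j, turning J f0 into -|J f0|. The factor c carries the ramp, so one gauge serves all
  times.\<close>

lemma ising_H_gauged_vec:
  fixes c :: real
  assumes sq: "\<And>i. \<sigma> i * \<sigma> i = 1"
    and flip: "\<And>q i. q < N \<Longrightarrow> J * f0 * (\<sigma> i * \<sigma> (flip_bit q i)) = - \<bar>J * f0\<bar>"
    and k: "k < 2 ^ N"
  defines "M \<equiv> stoq N J (\<bar>J * f0\<bar> * c)"
  shows "(ising_H N J (f0 * c) *\<^sub>v gauged_vec N \<sigma> x y) $ k =
    of_real (\<sigma> k) * Complex (ap (2 ^ N) M x k) (ap (2 ^ N) M y k)"
proof -
  have flips: "J * f0 * c * flips N k j * \<sigma> j = \<sigma> k * (- (\<bar>J * f0\<bar> * c * flips N k j))" for j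
  proof -
    have "J * f0 * \<sigma> j * of_bool (j = flip_bit q k) = - (\<bar>J * f0\<bar> * \<sigma> k * of_bool (j = flip_bit q k))" if "q < N" for q
    proof (cases "j = flip_bit q k")
      case True
      have "J * f0 * \<sigma> j = (\<sigma> k * \<sigma> k) * (J * f0 * \<sigma> j)" by (simp add: sq)
      also have "\<dots> = \<sigma> k * (J * f0 * (\<sigma> k * \<sigma> j))" by (simp only: mult_ac)
      also have "\<dots> = - (\<bar>J * f0\<bar> * \<sigma> k)" unfolding True flip[OF that] by simp
      finally show ?thesis using True by simp
    qed simp
    then have "J * f0 * \<sigma> j * flips N k j = - (\<bar>J * f0\<bar> * \<sigma> k * flips N k j)"
      unfolding flips_def sum_distrib_left sum_negf[symmetric] by (intro sum.cong) auto
    then have "c * (J * f0 * \<sigma> j * flips N k j) = c * (- (\<bar>J * f0\<bar> * \<sigma> k * flips N k j))" by (rule arg_cong)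
    then show ?thesis by (simp only: mult_ac mult_minus_right)
  qed
  have coeff: "(of_bool (k = j) * (J * bond N k) + J * (f0 * c) * flips N k j) * \<sigma> j = \<sigma> k * M k j" for j
  proof -
    have "of_bool (k = j) * (J * bond N k) * \<sigma> j = \<sigma> k * (of_bool (k = j) * (J * bond N k))" by auto
    then show ?thesis using flips[of j] by (simp add: M_def stoq_def algebra_simps)
  qed
  have "(ising_H N J (f0 * c) *\<^sub>v gauged_vec N \<sigma> x y) $ k
      = (\<Sum>j<2 ^ N. of_real (of_bool (k = j) * (J * bond N k) + J * (f0 * c) * flips N k j) * (of_real (\<sigma> j) * Complex (x j) (y j)))"
    unfolding ising_H_mult_vec[OF k gauged_vec_carrier] by (intro sum.cong) (auto simp: gauged_vec_def)
  also have "\<dots> = (\<Sum>j<2 ^ N. of_real (\<sigma> k * M k j) * Complex (x j) (y j))"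
    by (intro sum.cong refl) (simp only: coeff[symmetric] of_real_mult mult.assoc)
  also have "\<dots> = of_real (\<sigma> k) * (\<Sum>j<2 ^ N. of_real (M k j) * Complex (x j) (y j))"
    by (simp add: sum_distrib_left mult.assoc)
  also have "(\<Sum>j<2 ^ N. of_real (M k j) * Complex (x j) (y j)) = Complex (ap (2 ^ N) M x k) (ap (2 ^ N) M y k)"
    by (rule complex_eqI) (simp_all add: ap_def)
  finally show ?thesis .
qed

lemma cscalar_prod_gauged_vec:
  fixes \<sigma> :: "nat \<Rightarrow> real"
  assumes sq: "\<And>i. \<sigma> i * \<sigma> i = 1"
  shows "gauged_vec N \<sigma> x y \<bullet>c gauged_vec N \<sigma> x y = of_real (ip (2 ^ N) x x + ip (2 ^ N) y y)"
proof -
  have "gauged_vec N \<sigma> x y \<bullet>c gauged_vec N \<sigma> x y = (\<Sum>i<2 ^ N. of_real (x i * x i + y i * y i))"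
    unfolding scalar_prod_def gauged_vec_def
  proof (simp add: atLeast0LessThan, intro sum.cong refl)
    fix i
    have "of_real (\<sigma> i) * Complex (x i) (y i) * cnj (of_real (\<sigma> i) * Complex (x i) (y i))
        = of_real (\<sigma> i * \<sigma> i) * (Complex (x i) (y i) * cnj (Complex (x i) (y i)))" by simp
    also have "\<dots> = of_real (x i * x i + y i * y i)"
      unfolding sq by (simp add: complex_eq_iff)
    finally show "of_real (\<sigma> i) * Complex (x i) (y i) * (of_real (\<sigma> i) * cnj (Complex (x i) (y i)))
        = of_real (x i) * of_real (x i) + of_real (y i) * of_real (y i)" by simp
  qed
  then show ?thesis by (simp add: ip_def sum.distrib)
qed

text \<open>The gauged real and imaginary parts satisfy the eigenvalue equation of a real matrix
  separately, at a level not above E, so both are multiples of \<phi>; a + i b is the free phase of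
  the ground state.\<close>

lemma ground_state_gauged:
  assumes gs: "ground_state (ising_H N J f0) \<psi>0"
    and sq: "\<And>i. \<sigma> i * \<sigma> i = 1"
    and flip: "\<And>q i. q < N \<Longrightarrow> J * f0 * (\<sigma> i * \<sigma> (flip_bit q i)) = - \<bar>J * f0\<bar>"
    and gap: "gap_at (2 ^ N) (stoq N J \<bar>J * f0\<bar>) E \<phi> g" and g: "g > 0"
  shows "\<exists>a b. \<psi>0 = gauged_vec N \<sigma> (\<lambda>i. a * \<phi> i) (\<lambda>i. b * \<phi> i) \<and> a\<^sup>2 + b\<^sup>2 = 1"
proof -
  let ?n = "2 ^ N :: nat" and ?M = "stoq N J \<bar>J * f0\<bar>"
  obtain E' where unit: "\<psi>0 \<bullet>c \<psi>0 = 1" and ev: "eigenvector (ising_H N J f0) \<psi>0 (complex_of_real E')"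
    and least: "\<And>E''. eigenvalue (ising_H N J f0) (complex_of_real E'') \<Longrightarrow> E' \<le> E''"
    using gs unfolding ground_state_def by blast
  have dim: "\<psi>0 \<in> carrier_vec ?n"
    using ev ising_H_dim[of N J f0] by (simp add: eigenvector_def)
  have H: "(ising_H N J f0 *\<^sub>v gauged_vec N \<sigma> x y) $ k
      = of_real (\<sigma> k) * Complex (ap ?n ?M x k) (ap ?n ?M y k)" if "k < ?n" for k x y
    using ising_H_gauged_vec[OF sq flip that, where c = 1] by simp
  define x y where "x = (\<lambda>i. \<sigma> i * Re (\<psi>0 $ i))" and "y = (\<lambda>i. \<sigma> i * Im (\<psi>0 $ i))"
  have \<psi>0: "\<psi>0 = gauged_vec N \<sigma> x y"
  proof (rule eq_vecI)
    fix i assume "i < dim_vec (gauged_vec N \<sigma> x y)"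
    moreover have "of_real (\<sigma> i) * Complex (x i) (y i) = \<psi>0 $ i"
      by (rule complex_eqI) (simp_all add: x_def y_def sq flip: mult.assoc)
    ultimately show "\<psi>0 $ i = gauged_vec N \<sigma> x y $ i" by (simp add: gauged_vec_def)
  qed (use dim in \<open>simp add: gauged_vec_def\<close>)
  have unit': "ip ?n x x + ip ?n y y = 1"
    using unit unfolding \<psi>0 cscalar_prod_gauged_vec[OF sq] by (metis of_real_eq_1_iff)
  have eq: "ap ?n ?M x k = E' * x k \<and> ap ?n ?M y k = E' * y k" if "k < ?n" for k
  proof -
    have "ising_H N J f0 *\<^sub>v gauged_vec N \<sigma> x y = of_real E' \<cdot>\<^sub>v gauged_vec N \<sigma> x y"
      using ev unfolding \<psi>0 eigenvector_def by simp
    then have "(ising_H N J f0 *\<^sub>v gauged_vec N \<sigma> x y) $ k = (of_real E' \<cdot>\<^sub>v gauged_vec N \<sigma> x y) $ k" by simp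
    also have "\<dots> = of_real E' * (of_real (\<sigma> k) * Complex (x k) (y k))" using that by (simp add: gauged_vec_def)
    finally have "of_real (\<sigma> k) * Complex (ap ?n ?M x k) (ap ?n ?M y k) = of_real E' * (of_real (\<sigma> k) * Complex (x k) (y k))"
      unfolding H[OF that] .
    then have "of_real (\<sigma> k) * Complex (ap ?n ?M x k) (ap ?n ?M y k) = of_real (\<sigma> k) * (of_real E' * Complex (x k) (y k))"
      by (simp only: mult_ac)
    moreover have "of_real (\<sigma> k) \<noteq> (0 :: complex)" using sq[of k] by auto
    ultimately have "Complex (ap ?n ?M x k) (ap ?n ?M y k) = of_real E' * Complex (x k) (y k)"
      by simp
    then show ?thesis by (simp add: complex_eq_iff)
  qed
  \<comment> \<open>\<open>ground_state\<close> compares only with eigenvalues of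
    \<open>ising_H\<close>, so E has to be exhibited as one, with the gauged \<phi> as
    eigenvector.\<close>
  have "E' \<le> E"
  proof (rule least)
    have "eigenvector (ising_H N J f0) (gauged_vec N \<sigma> \<phi> (\<lambda>_. 0)) (of_real E)"
      unfolding eigenvector_def
    proof (intro conjI)
      show "gauged_vec N \<sigma> \<phi> (\<lambda>_. 0) \<in> carrier_vec (dim_row (ising_H N J f0))"
        using ising_H_dim[of N J f0] by simp
      have "gauged_vec N \<sigma> \<phi> (\<lambda>_. 0) \<bullet>c gauged_vec N \<sigma> \<phi> (\<lambda>_. 0) = 1"
        using gap unfolding cscalar_prod_gauged_vec[OF sq] gap_at_def by (simp add: ip_def)
      then show "gauged_vec N \<sigma> \<phi> (\<lambda>_. 0) \<noteq> 0\<^sub>v (dim_row (ising_H N J f0))"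
        using ising_H_dim[of N J f0] by auto
      show "ising_H N J f0 *\<^sub>v gauged_vec N \<sigma> \<phi> (\<lambda>_. 0) = of_real E \<cdot>\<^sub>v gauged_vec N \<sigma> \<phi> (\<lambda>_. 0)"
      proof (rule eq_vecI)
        fix k assume "k < dim_vec (complex_of_real E \<cdot>\<^sub>v gauged_vec N \<sigma> \<phi> (\<lambda>_. 0))"
        then have k: "k < ?n" by (simp add: gauged_vec_def)
        have "ap ?n ?M \<phi> k = E * \<phi> k" using gap k by (simp add: gap_at_def)
        then show "(ising_H N J f0 *\<^sub>v gauged_vec N \<sigma> \<phi> (\<lambda>_. 0)) $ k = (of_real E \<cdot>\<^sub>v gauged_vec N \<sigma> \<phi> (\<lambda>_. 0)) $ k"
          unfolding H[OF k] using k by (simp add: gauged_vec_def ap_def complex_eq_iff)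
      qed (use ising_H_dim[of N J f0] in \<open>simp add: gauged_vec_def\<close>)
    qed
    then show "eigenvalue (ising_H N J f0) (of_real E)" unfolding eigenvalue_def by blast
  qed
  then have min: "ip ?n z (ap ?n ?M z) \<le> E * ip ?n z z" if "\<forall>k<?n. ap ?n ?M z k = E' * z k" for z
    unfolding ip_eigenvector[OF that] by (intro mult_right_mono ip_nonneg)
  have x: "x i = ip ?n \<phi> x * \<phi> i" and y: "y i = ip ?n \<phi> y * \<phi> i" if "i < ?n" for i
    using gap_at_minimizer[OF gap g min[of x]] gap_at_minimizer[OF gap g min[of y]] eq that by blast+
  have "\<psi>0 = gauged_vec N \<sigma> (\<lambda>i. ip ?n \<phi> x * \<phi> i) (\<lambda>i. ip ?n \<phi> y * \<phi> i)"
    unfolding \<psi>0 gauged_vec_def using x y by (intro eq_vecI) simp_all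
  moreover have "(ip ?n \<phi> x)\<^sup>2 + (ip ?n \<phi> y)\<^sup>2 = 1"
  proof -
    have "ip ?n x x = ip ?n (\<lambda>i. ip ?n \<phi> x * \<phi> i) (\<lambda>i. ip ?n \<phi> x * \<phi> i)" using x by (intro ip_cong) simp_all
    moreover have "ip ?n y y = ip ?n (\<lambda>i. ip ?n \<phi> y * \<phi> i) (\<lambda>i. ip ?n \<phi> y * \<phi> i)" using y by (intro ip_cong) simp_all
    moreover have "ip ?n \<phi> \<phi> = 1" using gap by (simp add: gap_at_def)
    ultimately show ?thesis using unit' by (simp add: lin_simps power2_eq_square)
  qed
  ultimately show ?thesis by blast
qed

text \<open>The relative sign s of the target meets the same s from the gauge, and s * s = 1 leaves
  the even superposition.\<close>

lemma cat_overlap: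
  assumes N: "N > 0" and w: "w < 2 ^ N" and sq: "\<And>i. \<sigma> i * \<sigma> i = 1" and \<sigma>: "\<sigma> (cpl N w) = s * \<sigma> w"
  shows "(cmod (gauged_vec N \<sigma> x y \<bullet>c
      (complex_of_real (1 / sqrt 2) \<cdot>\<^sub>v (unit_vec (2 ^ N) w + complex_of_real s \<cdot>\<^sub>v unit_vec (2 ^ N) (cpl N w)))))\<^sup>2 =
    (ip (2 ^ N) (cat_state N w) x)\<^sup>2 + (ip (2 ^ N) (cat_state N w) y)\<^sup>2"
proof -
  define w' where "w' = cpl N w"
  have w': "w' < 2 ^ N" "w \<noteq> w'" using cpl_less[OF w] cpl_neq[OF N, of w] by (auto simp: w'_def)
  have ss: "s * s = 1"
  proof -
    have "\<sigma> w' * \<sigma> w' = s * s * (\<sigma> w * \<sigma> w)" unfolding w'_def \<sigma> by simp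
    then show ?thesis by (simp add: sq)
  qed
  define z where "z = (\<lambda>i. Complex (x i) (y i))"
  define d where "d = complex_of_real (1 / sqrt 2) \<cdot>\<^sub>v (unit_vec (2 ^ N) w + complex_of_real s \<cdot>\<^sub>v unit_vec (2 ^ N) w')"
  have "gauged_vec N \<sigma> x y \<bullet>c d = (\<Sum>i<2 ^ N. of_real (\<sigma> i) * z i * cnj (d $ i))"
    by (simp add: scalar_prod_def gauged_vec_def z_def d_def atLeast0LessThan)
  also have "\<dots> = (\<Sum>i\<in>{w, w'}. of_real (\<sigma> i) * z i * cnj (d $ i))"
    using w w' by (intro sum.mono_neutral_cong_right) (auto simp: d_def)
  also have "\<dots> = of_real (\<sigma> w) * z w * of_real (1 / sqrt 2) + of_real (\<sigma> w') * z w' * of_real (s / sqrt 2)"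
    using w w' by (simp add: d_def)
  also have "\<dots> = of_real (\<sigma> w) * (z w + of_real (s * s) * z w') * of_real (1 / sqrt 2)"
    unfolding w'_def \<sigma> by (simp add: algebra_simps)
  finally have "cmod (gauged_vec N \<sigma> x y \<bullet>c d) = \<bar>\<sigma> w\<bar> * cmod (z w + z w') / sqrt 2"
    by (simp add: ss norm_mult norm_divide)
  also have "\<bar>\<sigma> w\<bar> = 1" using sq[of w] by (auto simp: square_eq_1_iff)
  finally have "(cmod (gauged_vec N \<sigma> x y \<bullet>c d))\<^sup>2 = (cmod (z w + z w'))\<^sup>2 / 2"
    by (simp add: power_divide)
  then show ?thesis
    unfolding ip_cat_state[OF N w] d_def w'_def[symmetric]
    by (simp only: cmod_power2 z_def power_divide add_divide_distrib[of "(x w + x w')\<^sup>2"]) simp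
qed

text \<open>s is the eigenvalue of the initial ground state under the global flip, so it has to be
  the relative sign of the target; the sign of J enters through w.\<close>

lemma cat_state_reachable:
  assumes N: "N \<ge> 2" and J: "J \<noteq> 0" and f0: "f0 \<noteq> 0"
    and gs: "ground_state (ising_H N J f0) \<psi>0"
    and w: "w < 2 ^ N" and min: "\<forall>q<N - 1. J * (spin q w * spin (Suc q) w) = - \<bar>J\<bar>"
  defines "s \<equiv> if J * f0 < 0 then 1 else (- 1) ^ N"
  shows "asymptotically_reachable N J f0 \<psi>0
    (complex_of_real (1 / sqrt 2) \<cdot>\<^sub>v (unit_vec (2 ^ N) w + complex_of_real s \<cdot>\<^sub>v unit_vec (2 ^ N) (cpl N w)))"
proof -
  let ?n = "2 ^ N :: nat"
  define S where "S = \<bar>J * f0\<bar>"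
  have S: "S > 0" using J f0 by (simp add: S_def)
  have "J * f0 \<noteq> 0" using J f0 by simp
  from sign_gauge_exists[OF this, of N] obtain \<sigma> where sq: "\<And>i. \<sigma> i * \<sigma> i = 1"
    and flip: "\<And>q i. q < N \<Longrightarrow> J * f0 * (\<sigma> i * \<sigma> (flip_bit q i)) = - \<bar>J * f0\<bar>"
    and \<sigma>cpl: "\<And>i. \<sigma> (cpl N i) = s * \<sigma> i"
    unfolding s_def by blast
  \<comment> \<open>B removes the transverse field at a constant rate, down to strength 0 at \<tau>
    = 1, while the penalty stays.\<close>
  define A B where "A = penalized N J S" and "B = (\<lambda>i j. S * flips N i j)"
  have H: "(\<lambda>i j. A i j + \<tau> * B i j) = penalized N J (S * (1 - \<tau>))" for \<tau>
    by (intro ext) (simp add: A_def B_def penalized_def stoq_def algebra_simps)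
  have symA: "symm ?n A" unfolding A_def by (rule penalized_sym)
  have symB: "symm ?n B" by (simp add: symm_def B_def flips_sym)
  obtain g1 where g1: "g1 > 0" "gap_at ?n (penalized N J 0) (J * bond N w) (cat_state N w) g1"
    using classical_gap[OF N w min J] by blast
  have gaps: "\<exists>E \<phi> g. g > 0 \<and> gap_at ?n (\<lambda>i j. A i j + \<tau> * B i j) E \<phi> g" if "0 \<le> \<tau>" "\<tau> \<le> 1" for \<tau>
  proof (cases "\<tau> = 1")
    case True
    then show ?thesis unfolding H using g1 by auto
  next
    case False
    then have "S * (1 - \<tau>) > 0" using S that by simp
    from transverse_gap[OF this, of N J] show ?thesis unfolding H by blast
  qed
  obtain E \<phi> g where g: "g > 0" and gap: "gap_at ?n (stoq N J S) E \<phi> g"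
    and gapP: "gap_at ?n (penalized N J S) E \<phi> g" and \<phi>: "\<forall>i<?n. \<phi> (cpl N i) = \<phi> i"
    using transverse_gap[OF S, of N J] by blast
  obtain a b where \<psi>0: "\<psi>0 = gauged_vec N \<sigma> (\<lambda>i. a * \<phi> i) (\<lambda>i. b * \<phi> i)" and ab: "a\<^sup>2 + b\<^sup>2 = 1"
    using ground_state_gauged[OF gs sq flip gap[unfolded S_def] g] by blast
  show ?thesis
    unfolding asymptotically_reachable_def
  proof (intro allI impI)
    fix \<epsilon> :: real assume \<epsilon>: "\<epsilon> > 0"
    have n: "?n > 0" by simp
    have gap0: "gap_at ?n (\<lambda>i j. A i j + 0 * B i j) E \<phi> g" unfolding H using gapP by simp
    have gap1: "gap_at ?n (\<lambda>i j. A i j + 1 * B i j) (J * bond N w) (cat_state N w) g1" unfolding H using g1 by simp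
    from adiabatic_theorem[OF symA symB n gaps gap0 g gap1 g1(1) \<epsilon>]
    obtain T where T: "T > 0" and final: "\<And>x y. real_flow ?n (\<lambda>t i j. A i j + t / T * B i j) x y \<Longrightarrow>
        ip ?n (x 0) (x 0) + ip ?n (y 0) (y 0) = 1 \<Longrightarrow>
        ip ?n (x 0) (ap ?n (\<lambda>i j. A i j + 0 * B i j) (x 0)) + ip ?n (y 0) (ap ?n (\<lambda>i j. A i j + 0 * B i j) (y 0)) = E \<Longrightarrow>
        (ip ?n (cat_state N w) (x T))\<^sup>2 + (ip ?n (cat_state N w) (y T))\<^sup>2 > 1 - \<epsilon>"
      by blast
    from real_flow_exists[of ?n A T B "\<lambda>i. a * \<phi> i" "\<lambda>i. b * \<phi> i"]
    obtain x y where flow: "real_flow ?n (\<lambda>t i j. A i j + t / T * B i j) x y"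
      and init: "\<forall>i<?n. x 0 i = a * \<phi> i \<and> y 0 i = b * \<phi> i" by blast
    have unit\<phi>: "ip ?n \<phi> \<phi> = 1" using gap by (simp add: gap_at_def)
    have ipx: "ip ?n (x 0) v = a * ip ?n \<phi> v" and ipy: "ip ?n (y 0) v = b * ip ?n \<phi> v" for v
      using init ip_cong[of ?n "x 0" "\<lambda>i. a * \<phi> i" v v] ip_cong[of ?n "y 0" "\<lambda>i. b * \<phi> i" v v]
      by (simp_all add: lin_simps)
    have apx: "ap ?n M (x 0) = (\<lambda>i. a * ap ?n M \<phi> i)" and apy: "ap ?n M (y 0) = (\<lambda>i. b * ap ?n M \<phi> i)" for M
      using init ap_cong[of ?n "x 0" "\<lambda>i. a * \<phi> i" M] ap_cong[of ?n "y 0" "\<lambda>i. b * \<phi> i" M]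
      by (simp_all add: ap_scale)
    have "ip ?n (x 0) (x 0) + ip ?n (y 0) (y 0) = 1"
    proof -
      have "ip ?n (x 0) (x 0) = a * a" "ip ?n (y 0) (y 0) = b * b"
        unfolding ipx ipy ip_commute[of ?n \<phi> "x 0"] ip_commute[of ?n \<phi> "y 0"] by (simp_all add: ipx ipy unit\<phi>)
      then show ?thesis using ab by (simp add: power2_eq_square)
    qed
    moreover have "ip ?n (x 0) (ap ?n (\<lambda>i j. A i j + 0 * B i j) (x 0)) + ip ?n (y 0) (ap ?n (\<lambda>i j. A i j + 0 * B i j) (y 0)) = E"
    proof -
      have "ip ?n (x 0) (ap ?n (\<lambda>i j. A i j + 0 * B i j) (x 0)) + ip ?n (y 0) (ap ?n (\<lambda>i j. A i j + 0 * B i j) (y 0))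
          = (a * a + b * b) * ip ?n \<phi> (ap ?n (\<lambda>i j. A i j + 0 * B i j) \<phi>)"
        unfolding ipx ipy apx apy ip_scale_right by (simp add: distrib_right)
      also have "\<dots> = E"
        using ab unfolding gap_at_expectation[OF gap0] by (simp add: power2_eq_square)
      finally show ?thesis .
    qed
    ultimately have fidelity: "(ip ?n (cat_state N w) (x T))\<^sup>2 + (ip ?n (cat_state N w) (y T))\<^sup>2 > 1 - \<epsilon>"
      using final[OF flow] by blast
    define K where "K = (\<lambda>t i j. A i j + t / T * B i j)"
    have K: "K t = penalized N J (S * (1 - t / T))" for t unfolding K_def by (rule H)
    have inv: "\<forall>i<?n. x t (cpl N i) = x t i \<and> y t (cpl N i) = y t i" for t
    proof (rule real_flow_cpl[OF flow[folded K_def]])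
      show "symm ?n (K t)" for t unfolding K by (rule penalized_sym)
      show "K t (cpl N i) (cpl N j) = K t i j" for t i j unfolding K by (rule penalized_cpl)
      show "\<forall>i<?n. x 0 (cpl N i) = x 0 i \<and> y 0 (cpl N i) = y 0 i"
        using init \<phi> cpl_less by simp
    qed
    \<comment> \<open>On the even vectors x t and y t the penalty contributes 0, so the penalized
      flow obeys the equation of the bare chain.\<close>
    have ap_K: "ap ?n (K t) (x t) k = ap ?n (stoq N J (S * (1 - t / T))) (x t) k"
      "ap ?n (K t) (y t) k = ap ?n (stoq N J (S * (1 - t / T))) (y t) k" if "k < ?n" for t k
      unfolding K ap_penalized[OF that] using inv[of t] that by simp_all
    define f where "f = (\<lambda>t. f0 * (1 - t / T))"
    define \<psi> where "\<psi> = (\<lambda>t. gauged_vec N \<sigma> (x t) (y t))"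
    have "schroedinger_solution N J f T \<psi>0 \<psi>"
      unfolding schroedinger_solution_def
    proof (intro conjI ballI allI impI)
      show "\<psi> 0 = \<psi>0"
        unfolding \<psi>_def \<psi>0 gauged_vec_def using init by (intro eq_vecI) simp_all
      fix t show "\<psi> t \<in> carrier_vec ?n" by (simp add: \<psi>_def)
      fix k assume k: "k < ?n"
      define p q where "p = ap ?n (K t) (x t) k" and "q = ap ?n (K t) (y t) k"
      have "((\<lambda>t. x t k) has_real_derivative q) (at t within {0..T})"
        "((\<lambda>t. y t k) has_real_derivative - p) (at t within {0..T})"
        using flow[folded K_def] k unfolding real_flow_def p_def q_def
        by (auto intro: has_field_derivative_at_within)
      then have "((\<lambda>t. Complex (x t k) (y t k)) has_vector_derivative Complex q (- p)) (at t within {0..T})"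
        by (simp add: has_vector_derivative_complex_iff)
      then have "((\<lambda>t. of_real (\<sigma> k) * Complex (x t k) (y t k)) has_vector_derivative of_real (\<sigma> k) * Complex q (- p)) (at t within {0..T})"
        by (rule has_vector_derivative_mult_right)
      moreover have "of_real (\<sigma> k) * Complex q (- p) = (- \<i> \<cdot>\<^sub>v (ising_H N J (f t) *\<^sub>v \<psi> t)) $ k"
      proof -
        have "(ising_H N J (f t) *\<^sub>v \<psi> t) $ k = of_real (\<sigma> k) * Complex p q"
          using ising_H_gauged_vec[OF sq flip k, where c = "1 - t / T" and x = "x t" and y = "y t"]
          unfolding f_def \<psi>_def p_def q_def ap_K[OF k] S_def by simp
        then show ?thesis
          using k ising_H_dim[of N J "f t"] by (simp add: complex_eq_iff)
      qed
      ultimately show "((\<lambda>s. \<psi> s $ k) has_vector_derivative (- \<i> \<cdot>\<^sub>v (ising_H N J (f t) *\<^sub>v \<psi> t)) $ k) (at t within {0..T})"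
        using k by (simp add: \<psi>_def gauged_vec_def)
    qed
    moreover have "continuous_on {0..T} f" "f 0 = f0"
      unfolding f_def using T by (auto intro!: continuous_intros)
    moreover have "(cmod (\<psi> T \<bullet>c (complex_of_real (1 / sqrt 2) \<cdot>\<^sub>v
        (unit_vec ?n w + complex_of_real s \<cdot>\<^sub>v unit_vec ?n (cpl N w)))))\<^sup>2 > 1 - \<epsilon>"
      using cat_overlap[of N w \<sigma> s "x T" "y T", OF _ w sq \<sigma>cpl] N fidelity unfolding \<psi>_def by simp
    ultimately show "\<exists>t\<^sub>f>0. \<exists>f. continuous_on {0..t\<^sub>f} f \<and> f 0 = f0 \<and>
        (\<exists>\<psi>. schroedinger_solution N J f t\<^sub>f \<psi>0 \<psi> \<and>
          (cmod (\<psi> t\<^sub>f \<bullet>c (complex_of_real (1 / sqrt 2) \<cdot>\<^sub>v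
            (unit_vec ?n w + complex_of_real s \<cdot>\<^sub>v unit_vec ?n (cpl N w)))))\<^sup>2 > 1 - \<epsilon>)"
      using T by blast
  qed
qed

text \<open>Neighbouring entries agree exactly when J < 0, which is minimality of every bond;
  complementary lists give indices exchanged by the global flip.\<close>

lemma ket_pair:
  assumes "N \<ge> 2" and bits: "\<forall>b\<in>set bs. b < 2" "\<forall>b\<in>set bs'. b < 2" and len: "length bs = N" "length bs' = N"
    and compl: "\<And>k. k < N \<Longrightarrow> bs ! k = 1 \<longleftrightarrow> bs' ! k \<noteq> 1"
    and pattern: "\<And>k. Suc k < N \<Longrightarrow> (bs ! k = 1) = (bs ! Suc k = 1) \<longleftrightarrow> J < 0"
  shows "\<exists>w<2 ^ N. ket bs = unit_vec (2 ^ N) w \<and> ket bs' = unit_vec (2 ^ N) (cpl N w) \<and>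
    (\<forall>q<N - 1. J * (spin q w * spin (Suc q) w) = - \<bar>J\<bar>)"
proof -
  obtain w where w: "w < 2 ^ N" "ket bs = unit_vec (2 ^ N) w" "\<And>q. q < N \<Longrightarrow> bit w q \<longleftrightarrow> bs ! (N - 1 - q) = 1"
    using ket_unit_vec[OF bits(1)] unfolding len by blast
  obtain w' where w': "w' < 2 ^ N" "ket bs' = unit_vec (2 ^ N) w'" "\<And>q. q < N \<Longrightarrow> bit w' q \<longleftrightarrow> bs' ! (N - 1 - q) = 1"
    using ket_unit_vec[OF bits(2)] unfolding len by blast
  have "w' = cpl N w"
  proof (rule eq_if_bits_eq[OF w'(1) cpl_less[OF w(1)]])
    fix q assume "q < N"
    then show "bit w' q = bit (cpl N w) q"
      using compl[of "N - 1 - q"] by (simp add: w(3) w'(3) bit_cpl)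
  qed
  moreover have "J * (spin q w * spin (Suc q) w) = - \<bar>J\<bar>" if "q < N - 1" for q
  proof -
    \<comment> \<open>List positions run against bit positions: bit \<open>Suc q\<close> is read one
      position to the left of bit \<open>q\<close>.\<close>
    have "N - 1 - q = Suc (N - 1 - Suc q)" using that by simp
    then have "bit w q \<longleftrightarrow> bs ! Suc (N - 1 - Suc q) = 1" using that w(3)[of q] by simp
    moreover have "bit w (Suc q) \<longleftrightarrow> bs ! (N - 1 - Suc q) = 1" using that w(3)[of "Suc q"] by simp
    moreover have "Suc (N - 1 - Suc q) < N" using that by simp
    ultimately have "bit w q = bit w (Suc q) \<longleftrightarrow> J < 0"
      using pattern[of "N - 1 - Suc q"] by blast
    then show ?thesis by (auto simp: spin_def)
  qed
  ultimately show ?thesis using w w' by blast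
qed

theorem mainTheorem1:
  fixes N :: nat and J f\<^sub>0 :: real
  assumes "N \<ge> 2" and "J \<noteq> 0" and "f\<^sub>0 \<noteq> 0"
    and "ground_state (ising_H N J f\<^sub>0) \<psi>\<^sub>0"
  shows
    "(J < 0 \<and> (J * f\<^sub>0 < 0 \<or> (J * f\<^sub>0 > 0 \<and> even N)) \<longrightarrow>
        asymptotically_reachable N J f\<^sub>0 \<psi>\<^sub>0
          (complex_of_real (1 / sqrt 2) \<cdot>\<^sub>v (ket_zeros N + ket_ones N))) \<and>
     (J < 0 \<and> J * f\<^sub>0 > 0 \<and> odd N \<longrightarrow>
        asymptotically_reachable N J f\<^sub>0 \<psi>\<^sub>0
          (complex_of_real (1 / sqrt 2) \<cdot>\<^sub>v (ket_zeros N - ket_ones N))) \<and>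
     (J > 0 \<and> (J * f\<^sub>0 < 0 \<or> (J * f\<^sub>0 > 0 \<and> even N)) \<longrightarrow>
        asymptotically_reachable N J f\<^sub>0 \<psi>\<^sub>0
          (complex_of_real (1 / sqrt 2) \<cdot>\<^sub>v (ket_alt0 N + ket_alt1 N))) \<and>
     (J > 0 \<and> J * f\<^sub>0 > 0 \<and> odd N \<longrightarrow>
        asymptotically_reachable N J f\<^sub>0 \<psi>\<^sub>0
          (complex_of_real (1 / sqrt 2) \<cdot>\<^sub>v (ket_alt0 N - ket_alt1 N)))"
proof -
  \<comment> \<open>The sign is 1 in cases (a) and (c) and -1 in cases (b) and (d).\<close>
  define s :: real where "s = (if J * f\<^sub>0 < 0 then 1 else (- 1) ^ N)"
  have reach: "asymptotically_reachable N J f\<^sub>0 \<psi>\<^sub>0 (complex_of_real (1 / sqrt 2) \<cdot>\<^sub>v (u + complex_of_real s \<cdot>\<^sub>v v))"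
    if "\<exists>w<2 ^ N. u = unit_vec (2 ^ N) w \<and> v = unit_vec (2 ^ N) (cpl N w) \<and>
      (\<forall>q<N - 1. J * (spin q w * spin (Suc q) w) = - \<bar>J\<bar>)" for u v
    using that cat_state_reachable[OF assms(1-4)] unfolding s_def by blast
  have dims: "ket_zeros N \<in> carrier_vec (2 ^ N)" "ket_ones N \<in> carrier_vec (2 ^ N)"
      "ket_alt0 N \<in> carrier_vec (2 ^ N)" "ket_alt1 N \<in> carrier_vec (2 ^ N)"
    using ket_unit_vec[of "replicate N 0"] ket_unit_vec[of "replicate N 1"]
      ket_unit_vec[of "map (\<lambda>n. n mod 2) [0..<N]"] ket_unit_vec[of "map (\<lambda>n. (n + 1) mod 2) [0..<N]"]
    by (auto simp: ket_zeros_def ket_ones_def ket_alt0_def ket_alt1_def)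
  have plus: "u + complex_of_real s \<cdot>\<^sub>v v = u + v" if "J * f\<^sub>0 < 0 \<or> (J * f\<^sub>0 > 0 \<and> even N)" for u v
    using that by (auto simp: s_def)
  have minus: "u + complex_of_real s \<cdot>\<^sub>v v = u - v"
    if "J * f\<^sub>0 > 0" "odd N" "u \<in> carrier_vec (2 ^ N)" "v \<in> carrier_vec (2 ^ N)" for u v
    using that by (auto simp: s_def intro!: eq_vecI)
  have ferro: "asymptotically_reachable N J f\<^sub>0 \<psi>\<^sub>0
      (complex_of_real (1 / sqrt 2) \<cdot>\<^sub>v (ket_zeros N + complex_of_real s \<cdot>\<^sub>v ket_ones N))" if "J < 0"
    unfolding ket_zeros_def ket_ones_def using that assms(1) by (intro reach ket_pair) auto
  have antiferro: "asymptotically_reachable N J f\<^sub>0 \<psi>\<^sub>0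
      (complex_of_real (1 / sqrt 2) \<cdot>\<^sub>v (ket_alt0 N + complex_of_real s \<cdot>\<^sub>v ket_alt1 N))" if "J > 0"
    unfolding ket_alt0_def ket_alt1_def using that assms(1)
    by (intro reach ket_pair) (auto simp: mod2_eq_if)
  show ?thesis
    using ferro antiferro plus minus[OF _ _ dims(1,2)] minus[OF _ _ dims(3,4)] by (intro conjI impI) auto
qed

end
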